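(* Let $\Omega\subset\mathbb{R}^2$ be a bounded Lipschitz domain, $K\subset\Omega$ a measurable set of positive measure, $t>1$, $f\in L^t(K)$ and $\lambda>0$. Let $\mathcal{D}: W^{1,2}(\Omega)\to C^0(\overline{\Omega},\mathbb{R}^{2\times 2}_{sym,+})$ be a continuous mapping such that for every $R>0$ the set $\mathcal{D}(\mathcal{B}_R^K)$ is precompact in $C^0(\overline{\Omega},\mathbb{R}^{2\times 2}_{sym,+})$. Then there exists a function $u\in W^{1,2}(\Omega)$ which is a weak solution of $$\operatorname{div}\big[\mathcal{D}(u)\nabla u\big]=\lambda\,\chi_K\, t\,|u-f|^{t-2}(u-f)\quad\text{in }\Omega,\qquad \mathcal{D}(u)\nabla u\cdot\mathcal{N}=0\quad\text{on }\partial\Omega,$$ that is, $$\int_\Omega \mathcal{D}(u)\nabla u\cdot\nabla\varphi\,dx+\lambda\int_K t\,|u-f|^{t-2}(u-f)\,\varphi\,dx=0\quad\text{for all }\varphi\in W^{1,2}(\Omega).$$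
   Context: $\mathbb{R}^{2\times 2}_{sym,+}$ denotes the set of real symmetric $2\times2$ matrices $F$ with $FQ\cdot Q>0$ for all $Q\in\mathbb{R}^2$, $Q\neq 0$. $C^0(\overline{\Omega},\mathbb{R}^{2\times 2}_{sym,+})$ is the set of continuous maps $\overline{\Omega}\to\mathbb{R}^{2\times 2}_{sym,+}$ with the topology of uniform convergence. A subset is precompact in this space if every sequence in it has a subsequence converging uniformly on $\overline{\Omega}$ to an element of $C^0(\overline{\Omega},\mathbb{R}^{2\times 2}_{sym,+})$ (so the limit is again pointwise positive definite). For $R>0$, the ``data ball'' is $\mathcal{B}_R^K:=\{w\in W^{1,2}(\Omega):\ \|w\|_{L^t(K)}\le R\}$. $\chi_K$ is the characteristic function of $K$ and $\mathcal{N}$ the outward unit normal to $\partial\Omega$. The expression $|z|^{t-2}z$ is read as $0$ when $z=0$. Elements of $W^{1,2}(\Omega)$ are real-valued. *)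

theory Defs
  imports "HOL-Analysis.Analysis"
begin

definition lipschitz_domain :: "'a::euclidean_space set \<Rightarrow> bool" where
  "lipschitz_domain \<Omega> \<longleftrightarrow> open \<Omega> \<and> connected \<Omega> \<and> \<Omega> \<noteq> {} \<and>
     (\<forall>p\<in>frontier \<Omega>. \<exists>r>0. \<exists>\<nu> \<gamma> L. norm \<nu> = 1 \<and> L-lipschitz_on UNIV \<gamma> \<and>
        \<Omega> \<inter> ball p r = {x \<in> ball p r. \<gamma> (x - (x \<bullet> \<nu>) *\<^sub>R \<nu>) < x \<bullet> \<nu>})"
  \<comment> \<open>Near each boundary point the domain is a strict epigraph over the hyperplane orthogonal
      to \<open>\<nu>\<close>. Only the values of \<open>\<gamma>\<close> on that hyperplane are used; asking for a Lipschitz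
      function on the whole space is no restriction, by composition with the projection.\<close>


text \<open>
  Elements of the function spaces below are represented by functions on the whole space, whose
  values outside the set in question are irrelevant and which are not identified when they agree
  almost everywhere. The norms are therefore only seminorms.
\<close>

definition Lp :: "real \<Rightarrow> 'a::euclidean_space set \<Rightarrow> ('a \<Rightarrow> 'b::euclidean_space) set" where
  "Lp p S = {f \<in> borel_measurable (lebesgue_on S).
               integrable (lebesgue_on S) (\<lambda>x. norm (f x) powr p)}"

definition Lp_norm :: "real \<Rightarrow> 'a::euclidean_space set \<Rightarrow> ('a \<Rightarrow> 'b::euclidean_space) \<Rightarrow> real" where
  "Lp_norm p S f = (LINT x|lebesgue_on S. norm (f x) powr p) powr (1 / p)"

primrec C_k :: "nat \<Rightarrow> ('a::euclidean_space \<Rightarrow> real) \<Rightarrow> bool" where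
  "C_k 0 \<phi> \<longleftrightarrow> continuous_on UNIV \<phi>"
| "C_k (Suc k) \<phi> \<longleftrightarrow> (\<forall>x. \<phi> differentiable (at x)) \<and>
     (\<forall>i\<in>Basis. C_k k (\<lambda>x. frechet_derivative \<phi> (at x) i))"

definition test_function :: "'a::euclidean_space set \<Rightarrow> ('a \<Rightarrow> real) \<Rightarrow> bool" where
  "test_function \<Omega> \<phi> \<longleftrightarrow> (\<forall>k. C_k k \<phi>) \<and>
     compact (closure {x. \<phi> x \<noteq> 0}) \<and> closure {x. \<phi> x \<noteq> 0} \<subseteq> \<Omega>"

definition has_weak_gradient ::
  "'a::euclidean_space set \<Rightarrow> ('a \<Rightarrow> real) \<Rightarrow> ('a \<Rightarrow> 'a) \<Rightarrow> bool" where
  "has_weak_gradient \<Omega> u g \<longleftrightarrow> g \<in> Lp 2 \<Omega> \<and>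
     (\<forall>\<phi>. test_function \<Omega> \<phi> \<longrightarrow> (\<forall>i\<in>Basis.
        (LINT x|lebesgue_on \<Omega>. u x * frechet_derivative \<phi> (at x) i)
          = - (LINT x|lebesgue_on \<Omega>. (g x \<bullet> i) * \<phi> x)))"
  \<comment> \<open>Used only for square integrable \<open>u\<close>, for which both integrals exist.\<close>

definition W12 :: "'a::euclidean_space set \<Rightarrow> ('a \<Rightarrow> real) set" where
  "W12 \<Omega> = {u \<in> Lp 2 \<Omega>. \<exists>g. has_weak_gradient \<Omega> u g}"

definition weak_grad :: "'a::euclidean_space set \<Rightarrow> ('a \<Rightarrow> real) \<Rightarrow> 'a \<Rightarrow> 'a" where
  "weak_grad \<Omega> u = (SOME g. has_weak_gradient \<Omega> u g)"
  \<comment> \<open>The weak gradient is unique up to null sets, and it is used under integrals only.\<close>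

definition W12_norm :: "'a::euclidean_space set \<Rightarrow> ('a \<Rightarrow> real) \<Rightarrow> real" where
  "W12_norm \<Omega> u = sqrt ((Lp_norm 2 \<Omega> u)\<^sup>2 + (Lp_norm 2 \<Omega> (weak_grad \<Omega> u))\<^sup>2)"

definition sym_posdef :: "(real^2^2) set" where
  "sym_posdef = {F. transpose F = F \<and> (\<forall>Q. Q \<noteq> 0 \<longrightarrow> (F *v Q) \<bullet> Q > 0)}"

definition C0_sym_posdef :: "(real^2) set \<Rightarrow> (real^2 \<Rightarrow> real^2^2) set" where
  "C0_sym_posdef S = {A. continuous_on S A \<and> A ` S \<subseteq> sym_posdef}"

definition precompact_C0 :: "(real^2) set \<Rightarrow> (real^2 \<Rightarrow> real^2^2) set \<Rightarrow> bool" where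
  "precompact_C0 S \<A> \<longleftrightarrow> (\<forall>s. (\<forall>n. s n \<in> \<A>) \<longrightarrow>
     (\<exists>l\<in>C0_sym_posdef S. \<exists>r::nat \<Rightarrow> nat. strict_mono r \<and>
        uniform_limit S (\<lambda>n. s (r n)) l sequentially))"

text \<open>
  Continuity from \<open>W12\<close> with its seminorm to \<open>C0\<close> with uniform convergence. It forces
  \<open>\<D> u\<close> and \<open>\<D> v\<close> to coincide on the closure of \<open>\<Omega>\<close> whenever \<open>u\<close> and \<open>v\<close> agree almost
  everywhere in \<open>\<Omega>\<close>, so such a \<open>\<D>\<close> is well defined on equivalence classes.
\<close>

definition continuous_W12_C0 ::
  "(real^2) set \<Rightarrow> ((real^2 \<Rightarrow> real) \<Rightarrow> real^2 \<Rightarrow> real^2^2) \<Rightarrow> bool" where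
  "continuous_W12_C0 \<Omega> \<D> \<longleftrightarrow> (\<forall>u\<in>W12 \<Omega>. \<forall>\<epsilon>>0. \<exists>\<delta>>0. \<forall>v\<in>W12 \<Omega>.
     W12_norm \<Omega> (\<lambda>x. v x - u x) < \<delta> \<longrightarrow> (\<forall>x\<in>closure \<Omega>. norm (\<D> v x - \<D> u x) < \<epsilon>))"

definition data_ball ::
  "'a::euclidean_space set \<Rightarrow> 'a set \<Rightarrow> real \<Rightarrow> real \<Rightarrow> ('a \<Rightarrow> real) set" where
  "data_ball \<Omega> K t R = {w \<in> W12 \<Omega>. w \<in> Lp t K \<and> Lp_norm t K w \<le> R}"

text \<open>
  The weak form of \<open>div [A \<nabla>u] = lam \<chi>\<^sub>K t |u - f|\<^sup>t\<^sup>-\<^sup>2 (u - f)\<close> with zero conormal derivative, \<open>A\<close> being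
  the coefficient matrix. Integrability is required explicitly because the integral of a
  non-integrable function is \<open>0\<close> by convention. As \<open>0 powr s = 0\<close>, the nonlinear term vanishes
  where \<open>u = f\<close>, also for \<open>t < 2\<close>.
\<close>

definition weak_solution ::
  "(real^2) set \<Rightarrow> (real^2) set \<Rightarrow> real \<Rightarrow> real \<Rightarrow> (real^2 \<Rightarrow> real) \<Rightarrow>
   (real^2 \<Rightarrow> real^2^2) \<Rightarrow> (real^2 \<Rightarrow> real) \<Rightarrow> bool" where
  "weak_solution \<Omega> K t lam f A u \<longleftrightarrow> (\<forall>\<phi>\<in>W12 \<Omega>.
     integrable (lebesgue_on \<Omega>) (\<lambda>x. (A x *v weak_grad \<Omega> u x) \<bullet> weak_grad \<Omega> \<phi> x) \<and>
     integrable (lebesgue_on K) (\<lambda>x. t * \<bar>u x - f x\<bar> powr (t - 2) * (u x - f x) * \<phi> x) \<and>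
     (LINT x|lebesgue_on \<Omega>. (A x *v weak_grad \<Omega> u x) \<bullet> weak_grad \<Omega> \<phi> x)
       + lam * (LINT x|lebesgue_on K. t * \<bar>u x - f x\<bar> powr (t - 2) * (u x - f x) * \<phi> x) = 0)"

end

theory Submission
  imports Defs
begin

text \<open>
  For a fixed coefficient matrix \<open>A\<close> the equation is the Euler-Lagrange equation of the strictly
  convex energy \<open>1/2 \<integral> A \<nabla>u \<bullet> \<nabla>u + lam \<integral>\<^sub>K |u - f|\<^sup>t\<close>, whose minimiser \<open>u\<^sub>A\<close> is unique up to null sets.
  Comparison with \<open>u = 0\<close> puts every \<open>u\<^sub>A\<close> into one data ball, so \<open>A \<mapsto> \<D> (u\<^sub>A)\<close> has precompact range.
  It is continuous, since for \<open>A\<^sub>n \<rightarrow> A\<close> the minimisers of \<open>A\<^sub>n\<close> form a minimising sequence for \<open>A\<close>; a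
  fixed point \<open>A = \<D> (u\<^sub>A)\<close> is obtained from Brouwer's theorem on finite nets, as in Schauder's theorem.

  Minimising sequences converge strongly: the parallelogram identity makes the gradients Cauchy, the
  Poincare inequality transfers this to the functions up to constants, and the constants stay bounded
  because \<open>K\<close> has positive measure. The inequality also gives the embedding of \<open>W12\<close> into \<open>L\<^sup>t\<close>. It
  is proved on pieces of \<open>\<Omega>\<close> that are star-shaped with respect to a ball, by integrating the gradient
  along segments, and the pieces are glued using connectedness.
\<close>

section \<open>A Schauder-type fixed point lemma\<close>

text \<open>The unknown of the fixed point problem is the coefficient field and not the function.
  All minimisers share a bound in L^t(K), but their gradients are bounded only through the
  ellipticity constant of \<open>A\<close>, which has no positive lower bound over the convex set of
  admissible fields. Compactness therefore has to come from \<open>\<D>\<close>, whose limits stay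
  positive definite by hypothesis. For the same reason continuity is derived with the ellipticity
  constant of the limit field alone: the error made by exchanging \<open>A\<^sub>n\<close> for
  \<open>A\<close> in the energy, a small multiple of the squared gradient norm, is absorbed.

  The number of points of a net grows with the accuracy, so Brouwer's theorem is needed in a
  dimension that is a variable and not a type. It is proved for functions on the naturals, of which
  only the first \<open>n\<close> values count, from Kuhn's combinatorial lemma.

  The embedding into L^t makes the energy finite on all of \<open>W12\<close> and every element of
  \<open>W12\<close> admissible as a test function, for every \<open>t > 1\<close>.\<close>

lemma coordinatewise_convergent_subsequence:
  fixes X :: "nat \<Rightarrow> nat \<Rightarrow> real"
  assumes "\<And>j. j < n \<Longrightarrow> bounded (range (\<lambda>k. X k j))"
  shows "\<exists>r::nat\<Rightarrow>nat. strict_mono r \<and> (\<forall>j<n. convergent (\<lambda>k. X (r k) j))"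
  using assms
proof (induction n)
  case 0
  show ?case by (rule exI[of _ id]) (auto simp: strict_mono_def)
next
  case (Suc n)
  then obtain r :: "nat\<Rightarrow>nat" where r: "strict_mono r" "\<And>j. j<n \<Longrightarrow> convergent (\<lambda>k. X (r k) j)"
    by (meson less_Suc_eq)
  have "bounded (range (\<lambda>k. X (r k) n))"
    by (rule bounded_subset[OF Suc.prems[of n]]) auto
  then obtain l s where s: "strict_mono (s::nat\<Rightarrow>nat)" "((\<lambda>k. X (r k) n) \<circ> s) \<longlonglongrightarrow> l"
    using bounded_imp_convergent_subsequence by blast
  show ?case
  proof (intro exI[of _ "r \<circ> s"] conjI allI impI)
    show "strict_mono (r \<circ> s)" using r s by (simp add: strict_mono_o)
    fix j assume j: "j < Suc n"
    show "convergent (\<lambda>k. X ((r \<circ> s) k) j)"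
    proof (cases "j = n")
      case True
      then show ?thesis using s by (auto simp: convergent_def o_def)
    next
      case False
      with j have "convergent (\<lambda>k. X (r k) j)" using r by auto
      from convergent_subseq_convergent[OF this s(1)] show ?thesis by (simp add: o_def)
    qed
  qed
qed

text \<open>The label of a point records, for each coordinate, whether \<open>g\<close> moves it up
  (0) or down (1). Kuhn's lemma gives on each grid a cell that carries both labels in every
  coordinate. Along a subsequence the cells shrink to one point, and there continuity forces both
  inequalities between \<open>g x i\<close> and \<open>x i\<close>. Continuity is assumed in
  sequential, coordinatewise form, which also makes the values beyond \<open>n\<close>
  irrelevant.\<close>

lemma brouwer_nat_cube:
  fixes n :: nat and g :: "(nat \<Rightarrow> real) \<Rightarrow> nat \<Rightarrow> real" and C :: "(nat \<Rightarrow> real) set"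
  defines "C \<equiv> {x. \<forall>i<n. 0 \<le> x i \<and> x i \<le> 1}"
  assumes maps: "\<And>x. x \<in> C \<Longrightarrow> g x \<in> C"
    and cont: "\<And>X x i. (\<And>k. X k \<in> C) \<Longrightarrow> x \<in> C \<Longrightarrow> (\<And>j. j < n \<Longrightarrow> (\<lambda>k. X k j) \<longlonglongrightarrow> x j) \<Longrightarrow> i < n
            \<Longrightarrow> (\<lambda>k. g (X k) i) \<longlonglongrightarrow> g x i"
  shows "\<exists>x\<in>C. \<forall>i<n. g x i = x i"
proof -
    have "\<exists>l. (\<forall>x i. l x i \<le> (1::nat)) \<and> (\<forall>x i. x \<in> C \<and> i < n \<and> x i = 0 \<longrightarrow> l x i = 0) \<and>
      (\<forall>x i. x \<in> C \<and> i < n \<and> x i = 1 \<longrightarrow> l x i = 1) \<and> (\<forall>x i. x \<in> C \<and> i < n \<and> l x i = 0 \<longrightarrow> x i \<le> g x i) \<and>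
      (\<forall>x i. x \<in> C \<and> i < n \<and> l x i = 1 \<longrightarrow> g x i \<le> x i)"
    proof (rule kuhn_labelling_lemma'[where P="\<lambda>x. x \<in> C" and Q="\<lambda>i. i < n" and f=g])
      show "\<forall>x. x \<in> C \<longrightarrow> g x \<in> C" using maps by blast
      show "\<forall>x. x \<in> C \<longrightarrow> (\<forall>i<n. 0 \<le> x i \<and> x i \<le> 1)" by (simp add: C_def)
    qed
  then obtain l where L: "(\<forall>x i. l x i \<le> (1::nat)) \<and> (\<forall>x i. x \<in> C \<and> i < n \<and> x i = 0 \<longrightarrow> l x i = 0) \<and>
      (\<forall>x i. x \<in> C \<and> i < n \<and> x i = 1 \<longrightarrow> l x i = 1) \<and> (\<forall>x i. x \<in> C \<and> i < n \<and> l x i = 0 \<longrightarrow> x i \<le> g x i) \<and>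
      (\<forall>x i. x \<in> C \<and> i < n \<and> l x i = 1 \<longrightarrow> g x i \<le> x i)" by (rule exE)
  note l = L[THEN conjunct1, rule_format] L[THEN conjunct2, THEN conjunct1, rule_format]
    L[THEN conjunct2, THEN conjunct2, THEN conjunct1, rule_format]
    L[THEN conjunct2, THEN conjunct2, THEN conjunct2, THEN conjunct1, rule_format]
    L[THEN conjunct2, THEN conjunct2, THEN conjunct2, THEN conjunct2, rule_format]
  \<comment> \<open>Grid with mesh \<open>1 / Suc p\<close>; the successor keeps the denominator
    positive for every index \<open>p\<close>.\<close>
  define sc where "sc p a = (\<lambda>i. real (a i) / real (Suc p))" for p :: nat and a :: "nat \<Rightarrow> nat"
  have scC: "sc p a \<in> C" if "\<forall>i<n. a i \<le> Suc p" for p a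
    using that by (simp add: C_def sc_def divide_le_eq del: of_nat_Suc)
  define close where "close q r \<longleftrightarrow> (\<forall>j<n. q j \<le> r j \<and> r j \<le> q j + 1)" for q r :: "nat \<Rightarrow> nat"
  have "\<exists>q. (\<forall>i<n. q i < Suc p) \<and> (\<forall>i<n. \<exists>r s. close q r \<and> close q s \<and> l (sc p r) i \<noteq> l (sc p s) i)"
    for p
  proof (rule kuhn_lemma[of "Suc p" n "\<lambda>a. l (sc p a)"])
    show "\<forall>x. (\<forall>i<n. x i \<le> Suc p) \<longrightarrow> (\<forall>i<n. l (sc p x) i = 0 \<or> l (sc p x) i = 1)"
      using l(1) by (metis One_nat_def le_Suc_eq le_zero_eq)
    show "\<forall>x. (\<forall>i<n. x i \<le> Suc p) \<longrightarrow> (\<forall>i<n. x i = 0 \<longrightarrow> l (sc p x) i = 0)"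
      using l(2) scC by (simp add: sc_def)
    show "\<forall>x. (\<forall>i<n. x i \<le> Suc p) \<longrightarrow> (\<forall>i<n. x i = Suc p \<longrightarrow> l (sc p x) i = 1)"
      using l(3) scC by (simp add: sc_def)
    fix q assume "\<forall>i<n. q i < Suc p" "\<forall>i<n. \<exists>r s. (\<forall>j<n. q j \<le> r j \<and> r j \<le> q j + 1) \<and> (\<forall>j<n. q j \<le> s j \<and> s j \<le> q j + 1) \<and> l (sc p r) i \<noteq> l (sc p s) i"
    then show "\<exists>q. (\<forall>i<n. q i < Suc p) \<and> (\<forall>i<n. \<exists>r s. close q r \<and> close q s \<and> l (sc p r) i \<noteq> l (sc p s) i)"
      unfolding close_def by (intro exI[of _ q] conjI)
  qed simp
  then have "\<forall>p. \<exists>q. (\<forall>i<n. q i < Suc p) \<and> (\<forall>i<n. \<exists>r s. close q r \<and> close q s \<and> l (sc p r) i \<noteq> l (sc p s) i)" ..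
  from choice[OF this] obtain q where q: "\<And>p. \<forall>i<n. q p i < Suc p"
    "\<And>p i. i<n \<Longrightarrow> \<exists>r s. close (q p) r \<and> close (q p) s \<and> l (sc p r) i \<noteq> l (sc p s) i"
    by blast
  \<comment> \<open>For each coordinate the two vertices are ordered so that the first carries label
    0 and the second label 1.\<close>
  have "\<exists>rs. i < n \<longrightarrow> close (q p) (fst rs) \<and> close (q p) (snd rs) \<and> l (sc p (fst rs)) i = 0 \<and> l (sc p (snd rs)) i = 1"
    for p i
  proof (cases "i < n")
    case True
    from q(2)[OF True, of p] obtain r s where *: "close (q p) r" "close (q p) s" "l (sc p r) i \<noteq> l (sc p s) i"
      by blast
    have "l (sc p r) i = 0 \<or> l (sc p r) i = 1" "l (sc p s) i = 0 \<or> l (sc p s) i = 1"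
      using l(1)[of "sc p r" i] l(1)[of "sc p s" i] by linarith+
    with *(3) have "l (sc p r) i = 0 \<and> l (sc p s) i = 1 \<or> l (sc p r) i = 1 \<and> l (sc p s) i = 0"
      by linarith
    then show ?thesis
    proof
      assume "l (sc p r) i = 0 \<and> l (sc p s) i = 1"
      with * show ?thesis by (intro exI[of _ "(r, s)"]) simp
    next
      assume "l (sc p r) i = 1 \<and> l (sc p s) i = 0"
      with * show ?thesis by (intro exI[of _ "(s, r)"]) simp
    qed
  qed simp
  then have "\<forall>pi. \<exists>rs. snd pi < n \<longrightarrow> close (q (fst pi)) (fst rs) \<and> close (q (fst pi)) (snd rs) \<and>
      l (sc (fst pi) (fst rs)) (snd pi) = 0 \<and> l (sc (fst pi) (snd rs)) (snd pi) = 1" by blast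
  from choice[OF this] obtain RS where RS: "\<And>p i. i < n \<Longrightarrow> close (q p) (fst (RS (p, i))) \<and> close (q p) (snd (RS (p, i))) \<and>
      l (sc p (fst (RS (p, i)))) i = 0 \<and> l (sc p (snd (RS (p, i)))) i = 1"
    by force
  define R where "R p i = fst (RS (p, i))" for p i
  define S where "S p i = snd (RS (p, i))" for p i
  have R: "\<And>p i j. i<n \<Longrightarrow> j<n \<Longrightarrow> q p j \<le> R p i j \<and> R p i j \<le> q p j + 1" "\<And>p i. i<n \<Longrightarrow> l (sc p (R p i)) i = 0"
    and S: "\<And>p i j. i<n \<Longrightarrow> j<n \<Longrightarrow> q p j \<le> S p i j \<and> S p i j \<le> q p j + 1" "\<And>p i. i<n \<Longrightarrow> l (sc p (S p i)) i = 1"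
    using RS by (simp_all add: R_def S_def close_def)
  have RC: "sc p (R p i) \<in> C" "sc p (S p i) \<in> C" if "i < n" for p i
  proof -
    have "R p i j \<le> Suc p \<and> S p i j \<le> Suc p" if "j < n" for j
      using R(1)[OF \<open>i < n\<close> that, of p] S(1)[OF \<open>i < n\<close> that, of p] q(1)[of p] that
      by (metis Suc_eq_plus1 Suc_leI order_trans)
    then show "sc p (R p i) \<in> C" "sc p (S p i) \<in> C" by (auto intro!: scC)
  qed
  have qC: "sc p (q p) \<in> C" for p
    using q(1)[of p] by (auto intro!: scC less_imp_le)
  have "bounded (range (\<lambda>p. sc p (q p) j))" if "j < n" for j
    using qC that by (intro boundedI[where B=1]) (auto simp: C_def)
  from coordinatewise_convergent_subsequence[of n "\<lambda>p. sc p (q p)", OF this] obtain \<rho> where \<rho>: "strict_mono (\<rho>::nat\<Rightarrow>nat)"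
    "\<And>j. j<n \<Longrightarrow> convergent (\<lambda>k. sc (\<rho> k) (q (\<rho> k)) j)" by blast
  define x where "x j = lim (\<lambda>k. sc (\<rho> k) (q (\<rho> k)) j)" for j
  have x: "(\<lambda>k. sc (\<rho> k) (q (\<rho> k)) j) \<longlonglongrightarrow> x j" if "j<n" for j
    using \<rho>(2)[OF that] by (simp add: convergent_LIMSEQ_iff x_def)
  have xC: "x \<in> C"
    unfolding C_def
  proof (intro CollectI allI impI conjI)
    fix i assume i: "i < n"
    show "0 \<le> x i" by (rule LIMSEQ_le_const[OF x[OF i]]) (use qC i in \<open>auto simp: C_def\<close>)
    show "x i \<le> 1" by (rule LIMSEQ_le_const2[OF x[OF i]]) (use qC i in \<open>auto simp: C_def\<close>)
  qed
  \<comment> \<open>Every vertex of the cell of \<open>q\<close> differs from it by at most one mesh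
    width in each coordinate, so all the selections \<open>R\<close> and \<open>S\<close> share the
    limit of the lower corners.\<close>
  have near: "(\<lambda>k. sc (\<rho> k) (T (\<rho> k)) j) \<longlonglongrightarrow> x j" if "j < n" and T: "\<And>p. q p j \<le> T p j \<and> T p j \<le> q p j + 1" for T j
  proof (rule tendsto_sandwich[OF _ _ x[OF that(1)]])
    show "\<forall>\<^sub>F k in sequentially. sc (\<rho> k) (q (\<rho> k)) j \<le> sc (\<rho> k) (T (\<rho> k)) j"
      using T by (intro always_eventually allI) (simp add: sc_def divide_right_mono)
    show "\<forall>\<^sub>F k in sequentially. sc (\<rho> k) (T (\<rho> k)) j \<le> sc (\<rho> k) (q (\<rho> k)) j + 1 / real (Suc (\<rho> k))"
    proof (intro always_eventually allI)
      fix k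
      have "real (T (\<rho> k) j) \<le> real (q (\<rho> k) j) + 1" using T[of "\<rho> k"] by linarith
      then show "sc (\<rho> k) (T (\<rho> k)) j \<le> sc (\<rho> k) (q (\<rho> k)) j + 1 / real (Suc (\<rho> k))"
        unfolding sc_def add_divide_distrib[symmetric] by (rule divide_right_mono) simp
    qed
    have "(\<lambda>k. 1 / real (Suc (\<rho> k))) \<longlonglongrightarrow> 0"
      using LIMSEQ_subseq_LIMSEQ[OF LIMSEQ_inverse_real_of_nat \<rho>(1)] by (simp add: o_def inverse_eq_divide)
    from tendsto_add[OF x[OF that(1)] this]
    show "(\<lambda>k. sc (\<rho> k) (q (\<rho> k)) j + 1 / real (Suc (\<rho> k))) \<longlonglongrightarrow> x j" by simp
  qed
  have "g x i = x i" if i: "i < n" for i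
  proof (rule antisym)
    have l1: "(\<lambda>k. g (sc (\<rho> k) (S (\<rho> k) i)) i) \<longlonglongrightarrow> g x i"
      by (rule cont) (use RC i xC near[of _ "\<lambda>p. S p i"] S in auto)
    show "g x i \<le> x i"
      by (rule LIMSEQ_le[OF l1 near[OF i, of "\<lambda>p. S p i"]]) (use S i RC l(5) in auto)
    have l2: "(\<lambda>k. g (sc (\<rho> k) (R (\<rho> k) i)) i) \<longlonglongrightarrow> g x i"
      by (rule cont) (use RC i xC near[of _ "\<lambda>p. R p i"] R in auto)
    show "x i \<le> g x i"
      by (rule LIMSEQ_le[OF near[OF i, of "\<lambda>p. R p i"] l2]) (use R i RC l(4) in auto)
  qed
  with xC show ?thesis by blast
qed

text \<open>If no finite set is a net, a new element can always be chosen that is not uniformly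
  \<epsilon>-close to any earlier one. Two members of a uniformly convergent subsequence would
  eventually be closer than that.\<close>

lemma totally_bounded_uniform:
  fixes P :: "('x \<Rightarrow> 'b::real_normed_vector) set"
  assumes compact: "\<And>s::nat \<Rightarrow> 'x \<Rightarrow> 'b. (\<And>n. s n \<in> P) \<Longrightarrow> \<exists>l r. strict_mono (r::nat\<Rightarrow>nat) \<and> uniform_limit S (\<lambda>n. s (r n)) l sequentially"
    and "\<epsilon> > 0"
  shows "\<exists>F. finite F \<and> F \<subseteq> P \<and> (\<forall>A\<in>P. \<exists>B\<in>F. \<forall>x\<in>S. norm (A x - B x) < \<epsilon>)"
proof (rule ccontr)
  assume neg: "\<not> ?thesis"
  have "\<exists>s. \<forall>n::nat. s n \<in> P \<and> (\<forall>m<n. \<not> (\<forall>x\<in>S. norm (s n x - s m x) < \<epsilon>))"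
  proof -
    have "\<exists>A. A \<in> P \<and> (\<forall>B\<in>F. \<not> (\<forall>x\<in>S. norm (A x - B x) < \<epsilon>))" if F: "finite F" "F \<subseteq> P" for F
    proof -
      have "\<not> (\<forall>A\<in>P. \<exists>B\<in>F. \<forall>x\<in>S. norm (A x - B x) < \<epsilon>)"
      proof
        assume "\<forall>A\<in>P. \<exists>B\<in>F. \<forall>x\<in>S. norm (A x - B x) < \<epsilon>"
        with F have "\<exists>F. finite F \<and> F \<subseteq> P \<and> (\<forall>A\<in>P. \<exists>B\<in>F. \<forall>x\<in>S. norm (A x - B x) < \<epsilon>)"
          by (intro exI[of _ F]) simp
        with neg show False by simp
      qed
      then show ?thesis by (simp add: Ball_def Bex_def)
    qed
    then have "\<forall>F. \<exists>A. finite F \<longrightarrow> F \<subseteq> P \<longrightarrow> A \<in> P \<and> (\<forall>B\<in>F. \<not> (\<forall>x\<in>S. norm (A x - B x) < \<epsilon>))" by simp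
    from choice[OF this] obtain c where "\<forall>F. finite F \<longrightarrow> F \<subseteq> P \<longrightarrow> c F \<in> P \<and> (\<forall>B\<in>F. \<not> (\<forall>x\<in>S. norm (c F x - B x) < \<epsilon>))"
      by (rule exE)
    note c = this[rule_format]
    \<comment> \<open>\<open>s n\<close> collects the elements chosen so far; \<open>c {}\<close>
      only starts the recursion, and the sequence itself consists of the later choices
      \<open>c (s n)\<close>.\<close>
    define s where "s = rec_nat {c {}} (\<lambda>_ F. insert (c F) F)"
    have s: "finite (s n) \<and> s n \<subseteq> P" for n
      by (induction n) (auto simp: s_def c)
    have mono: "s m \<subseteq> s n" if "m \<le> n" for m n
      using that by (induction rule: dec_induct) (auto simp: s_def)
    define a where "a n = c (s n)" for n
    have "a n \<in> P \<and> (\<forall>m<n. \<not> (\<forall>x\<in>S. norm (a n x - a m x) < \<epsilon>))" for n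
    proof -
      have "a m \<in> s n" if "m < n" for m
        using mono[of "Suc m" n] that by (simp add: s_def a_def)
      then show ?thesis using c[of "s n"] s[of n] unfolding a_def by (simp add: Ball_def)
    qed
    then have "\<forall>n. a n \<in> P \<and> (\<forall>m<n. \<not> (\<forall>x\<in>S. norm (a n x - a m x) < \<epsilon>))" by (rule allI)
    then show ?thesis by (rule exI[of _ a])
  qed
  then obtain s where s0: "\<forall>n::nat. s n \<in> P \<and> (\<forall>m<n. \<not> (\<forall>x\<in>S. norm (s n x - s m x) < \<epsilon>))" by (rule exE)
  have s: "s n \<in> P" "m < n \<Longrightarrow> \<not> (\<forall>x\<in>S. norm (s n x - s m x) < \<epsilon>)" for n m
    using s0[THEN spec[of _ n]] by simp_all
  obtain l r where r: "strict_mono (r::nat\<Rightarrow>nat)" "uniform_limit S (\<lambda>n. s (r n)) l sequentially"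
    using compact[of s] s(1) by blast
  from uniform_limitD[OF r(2), of "\<epsilon>/2"] \<open>\<epsilon> > 0\<close> obtain N where N: "\<And>n x. n \<ge> N \<Longrightarrow> x \<in> S \<Longrightarrow> dist (s (r n) x) (l x) < \<epsilon>/2"
    by (auto simp: eventually_sequentially)
  have "norm (s (r (Suc N)) x - s (r N) x) < \<epsilon>" if "x \<in> S" for x
    using N[of N x] N[of "Suc N" x] that
    by (simp only: dist_norm[symmetric]) (metis dist_triangle_half_l le_SucI order_refl)
  moreover have "r N < r (Suc N)" using r(1) by (simp add: strict_mono_less)
  ultimately show False using s(2) by blast
qed

lemma uniform_limit_sum:
  fixes f :: "'i \<Rightarrow> 'k \<Rightarrow> 'x \<Rightarrow> 'b::real_normed_vector"
  assumes "\<And>i. i \<in> I \<Longrightarrow> uniform_limit S (f i) (l i) F"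
  shows "uniform_limit S (\<lambda>k x. \<Sum>i\<in>I. f i k x) (\<lambda>x. \<Sum>i\<in>I. l i x) F"
  using assms
  by (induction I rule: infinite_finite_induct) (auto intro!: uniform_limit_add uniform_limit_const)

text \<open>Schauder's projection. The weights of a point against an \<epsilon>/2-net of
  \<open>P\<close> form a continuous map into a simplex; composing it with convex combination of the
  net and with \<open>\<Phi>\<close> gives a self-map of the weights. At a fixed weight vector the
  combination \<open>K c\<close> is the projection of \<open>\<Phi> (K c)\<close>, and the
  projection averages only net points within \<epsilon> of its argument.\<close>

lemma approximate_fixed_point:
  fixes \<C> P :: "('x \<Rightarrow> 'b::real_normed_vector) set"
  assumes S: "S \<noteq> {}"
    and convex: "\<And>n c A. (\<And>i::nat. i \<le> n \<Longrightarrow> A i \<in> \<C>) \<Longrightarrow> (\<And>i. i \<le> n \<Longrightarrow> (0::real) \<le> c i) \<Longrightarrow> (\<Sum>i\<le>n. c i) = 1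
                 \<Longrightarrow> (\<lambda>x. \<Sum>i\<le>n. c i *\<^sub>R A i x) \<in> \<C>"
    and bdd: "\<And>A. A \<in> \<C> \<Longrightarrow> bounded (A ` S)"
    and P: "P \<subseteq> \<C>" "P \<noteq> {}" and \<Phi>: "\<And>A. A \<in> \<C> \<Longrightarrow> \<Phi> A \<in> P"
    and compact: "\<And>s::nat \<Rightarrow> 'x \<Rightarrow> 'b. (\<And>n. s n \<in> P) \<Longrightarrow> \<exists>l\<in>\<C>. \<exists>r. strict_mono (r::nat\<Rightarrow>nat) \<and> uniform_limit S (\<lambda>n. s (r n)) l sequentially"
    and cont: "\<And>s l. (\<And>n. s n \<in> \<C>) \<Longrightarrow> l \<in> \<C> \<Longrightarrow> uniform_limit S s l sequentially \<Longrightarrow> uniform_limit S (\<lambda>n. \<Phi> (s n)) (\<Phi> l) sequentially"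
    and "\<epsilon> > 0"
  shows "\<exists>A\<in>\<C>. \<forall>x\<in>S. norm (A x - \<Phi> A x) \<le> \<epsilon>"
proof -
  obtain F where F: "finite F" "F \<subseteq> P" "\<And>A. A \<in> P \<Longrightarrow> \<exists>B\<in>F. \<forall>x\<in>S. norm (A x - B x) < \<epsilon>/2"
  proof -
    have "\<exists>F. finite F \<and> F \<subseteq> P \<and> (\<forall>A\<in>P. \<exists>B\<in>F. \<forall>x\<in>S. norm (A x - B x) < \<epsilon>/2)"
    proof (rule totally_bounded_uniform)
      fix s :: "nat \<Rightarrow> 'x \<Rightarrow> 'b" assume "\<And>n. s n \<in> P"
      then show "\<exists>l r. strict_mono (r::nat\<Rightarrow>nat) \<and> uniform_limit S (\<lambda>n. s (r n)) l sequentially"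
        using compact[of s] by blast
    qed (use \<open>\<epsilon> > 0\<close> in simp)
    with that show ?thesis by blast
  qed
  have "F \<noteq> {}" using F(3) P(2) by blast
  obtain n and A :: "nat \<Rightarrow> 'x \<Rightarrow> 'b" where A: "A ` {..n} = F"
  proof -
    obtain m and a :: "nat \<Rightarrow> 'x \<Rightarrow> 'b" where a: "F = a ` {i. i < m}" using finite_imp_nat_seg_image_inj_on[OF F(1)] by blast
    with \<open>F \<noteq> {}\<close> obtain n where "m = Suc n" by (cases m) auto
    with a that[of a n] show ?thesis by (simp add: atMost_def less_Suc_eq_le)
  qed
  have AC: "A i \<in> \<C>" if "i \<le> n" for i using A F(2) P(1) that by blast
  have PC: "B \<in> \<C>" if "B \<in> P" for B using that P by blast
  \<comment> \<open>The sup distance over \<open>S\<close>; boundedness of the members of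
    \<open>\<C>\<close> makes the real supremum meaningful.\<close>
  define d where "d B E = (SUP x\<in>S. norm (B x - E x))" for B E :: "'x \<Rightarrow> 'b"
  have bd: "bdd_above ((\<lambda>x. norm (B x - E x)) ` S)" if BE: "B \<in> \<C>" "E \<in> \<C>" for B E
  proof -
    obtain b where "\<And>x. x \<in> S \<Longrightarrow> norm (B x) \<le> b" using bdd[OF BE(1)] by (auto simp: bounded_iff)
    moreover obtain e where "\<And>x. x \<in> S \<Longrightarrow> norm (E x) \<le> e" using bdd[OF BE(2)] by (auto simp: bounded_iff)
    ultimately show ?thesis
      by (intro bdd_aboveI2[where M="b+e"]) (meson add_mono norm_triangle_ineq4 order_trans)
  qed
  have d_up: "norm (B x - E x) \<le> d B E" if "B \<in> \<C>" "E \<in> \<C>" "x \<in> S" for B E x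
    unfolding d_def using bd that by (intro cSUP_upper)
  have d_le: "d B E \<le> b" if "\<And>x. x \<in> S \<Longrightarrow> norm (B x - E x) \<le> b" for B E b
    unfolding d_def using that S by (intro cSUP_least)
  \<comment> \<open>Net point \<open>A i\<close> gets positive weight only if its distance from
    \<open>B\<close> is below \<epsilon>. The net has radius \<epsilon>/2, so for \<open>B\<close>
    in \<open>P\<close> some weight is at least \<epsilon>/2 and the normalising sum
    \<open>M B\<close> does not vanish.\<close>
  define \<mu> where "\<mu> i B = max 0 (\<epsilon> - d B (A i))" for i B
  define M where "M B = (\<Sum>i\<le>n. \<mu> i B)" for B
  have \<mu>0: "0 \<le> \<mu> i B" for i B by (simp add: \<mu>_def)
  have Mpos: "M B > 0" if BP: "B \<in> P" for B
  proof -
    obtain i where i: "i \<le> n" "\<forall>x\<in>S. norm (B x - A i x) < \<epsilon>/2" using F(3)[OF BP] A by auto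
    then have "d B (A i) \<le> \<epsilon>/2" by (intro d_le) (auto intro: less_imp_le)
    then have "\<mu> i B > 0" using \<open>\<epsilon> > 0\<close> by (simp add: \<mu>_def)
    then show ?thesis unfolding M_def using i \<mu>0 by (intro sum_pos2[of _ i]) auto
  qed
  define \<sigma> where "\<sigma> c = (\<Sum>j<n. c j)" for c :: "nat \<Rightarrow> real"
  \<comment> \<open>\<open>w\<close> retracts the cube onto the simplex of weights; the last weight is what the others leave over.\<close>
  define w where "w c i = (if i < n then c i / max 1 (\<sigma> c) else max 0 (1 - \<sigma> c))" for c :: "nat \<Rightarrow> real" and i
  define C where "C = {x::nat\<Rightarrow>real. \<forall>i<n. 0 \<le> x i \<and> x i \<le> 1}"
  have w0: "0 \<le> w c i" if "c \<in> C" for c i using that by (auto simp: w_def C_def)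
  have sum_split: "(\<Sum>i\<le>n. h i) = (\<Sum>i<n. h i) + h n" for h :: "nat \<Rightarrow> real"
    by (simp add: lessThan_Suc_atMost[symmetric])
  have w1: "(\<Sum>i\<le>n. w c i) = 1" if "c \<in> C" for c
  proof -
    have "(\<Sum>i<n. w c i) = \<sigma> c / max 1 (\<sigma> c)" by (simp add: w_def \<sigma>_def sum_divide_distrib)
    then show ?thesis by (auto simp: sum_split w_def max_def)
  qed
  define K where "K c = (\<lambda>x. \<Sum>i\<le>n. w c i *\<^sub>R A i x)" for c
  have KC: "K c \<in> \<C>" if "c \<in> C" for c
    unfolding K_def by (rule convex) (use AC w0 w1 that in auto)
  define g where "g c i = \<mu> i (\<Phi> (K c)) / M (\<Phi> (K c))" for c i
  have gpos: "0 \<le> g c i" if "c \<in> C" for c i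
    using Mpos[OF \<Phi>[OF KC[OF that]]] \<mu>0 by (simp add: g_def)
  have gsum: "(\<Sum>i\<le>n. g c i) = 1" if "c \<in> C" for c
    using Mpos[OF \<Phi>[OF KC[OF that]]] by (simp add: g_def sum_divide_distrib[symmetric] M_def)
  have "\<exists>c\<in>C. \<forall>i<n. g c i = c i"
    unfolding C_def
  proof (rule brouwer_nat_cube)
    fix c :: "nat \<Rightarrow> real" assume "c \<in> {x. \<forall>i<n. 0 \<le> x i \<and> x i \<le> 1}"
    then have c: "c \<in> C" by (simp add: C_def)
    show "g c \<in> {x. \<forall>i<n. 0 \<le> x i \<and> x i \<le> 1}"
    proof (intro CollectI allI impI conjI)
      fix i assume "i < n"
      then have "g c i \<le> (\<Sum>i\<le>n. g c i)" by (intro member_le_sum) (auto simp: gpos[OF c])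
      then show "g c i \<le> 1" "0 \<le> g c i" using gsum[OF c] gpos[OF c] by auto
    qed
  next
    fix X and c :: "nat \<Rightarrow> real" and i assume "\<And>k. X k \<in> {x. \<forall>i<n. 0 \<le> x i \<and> x i \<le> 1}" "c \<in> {x. \<forall>i<n. 0 \<le> x i \<and> x i \<le> 1}" 
      and lim: "\<And>j. j < n \<Longrightarrow> (\<lambda>k. X k j) \<longlonglongrightarrow> c j" and i: "i < n"
    then have X: "\<And>k. X k \<in> C" and c: "c \<in> C" by (auto simp: C_def)
    have wl: "(\<lambda>k. w (X k) i) \<longlonglongrightarrow> w c i" for i
      unfolding w_def \<sigma>_def by (cases "i < n") (auto intro!: tendsto_intros lim)
    have "uniform_limit S (\<lambda>k. K (X k)) (K c) sequentially"
      unfolding K_def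
    proof (rule uniform_limit_sum)
      fix i assume "i \<in> {..n}"
      then have "bounded (A i ` S)" using bdd AC by auto
      then obtain b where b: "b > 0" "\<And>x. x \<in> S \<Longrightarrow> norm (A i x) \<le> b" by (auto simp: bounded_pos)
      show "uniform_limit S (\<lambda>k x. w (X k) i *\<^sub>R A i x) (\<lambda>x. w c i *\<^sub>R A i x) sequentially"
      proof (rule uniform_limitI)
        fix e :: real assume e: "e > 0"
        have "\<forall>\<^sub>F k in sequentially. dist (w (X k) i) (w c i) < e / b"
          using tendstoD[OF wl] e b by simp
        then show "\<forall>\<^sub>F k in sequentially. \<forall>x\<in>S. dist (w (X k) i *\<^sub>R A i x) (w c i *\<^sub>R A i x) < e"
        proof eventually_elim
          case (elim k)
          show ?case
          proof
            fix x assume "x \<in> S"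
            then have "dist (w (X k) i *\<^sub>R A i x) (w c i *\<^sub>R A i x) \<le> \<bar>w (X k) i - w c i\<bar> * b"
              by (simp add: dist_norm scaleR_diff_left[symmetric] b mult_left_mono)
            also have "\<dots> < e" using elim b by (simp add: dist_real_def pos_less_divide_eq)
            finally show "dist (w (X k) i *\<^sub>R A i x) (w c i *\<^sub>R A i x) < e" .
          qed
        qed
      qed
    qed
    then have ul: "uniform_limit S (\<lambda>k. \<Phi> (K (X k))) (\<Phi> (K c)) sequentially"
      by (intro cont KC X c)
    have dl: "(\<lambda>k. d (\<Phi> (K (X k))) (A j)) \<longlonglongrightarrow> d (\<Phi> (K c)) (A j)" if j: "j \<le> n" for j
    proof (rule LIMSEQ_I)
      fix e :: real assume e: "e > 0"
      have mem: "\<Phi> (K (X k)) \<in> \<C>" "\<Phi> (K c) \<in> \<C>" for k using \<Phi> PC KC X c by auto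
      from uniform_limitD[OF ul, of "e/2"] e obtain N where N: "\<And>k x. k \<ge> N \<Longrightarrow> x \<in> S \<Longrightarrow> norm (\<Phi> (K (X k)) x - \<Phi> (K c) x) < e/2"
        by (auto simp: eventually_sequentially dist_norm)
      have "norm (d (\<Phi> (K (X k))) (A j) - d (\<Phi> (K c)) (A j)) < e" if k: "k \<ge> N" for k
      proof -
        have "d (\<Phi> (K (X k))) (A j) \<le> d (\<Phi> (K c)) (A j) + e/2"
        proof (rule d_le)
          fix x assume x: "x \<in> S"
          have "norm (\<Phi> (K (X k)) x - A j x) \<le> norm (\<Phi> (K (X k)) x - \<Phi> (K c) x) + norm (\<Phi> (K c) x - A j x)"
            using norm_triangle_ineq[of "\<Phi> (K (X k)) x - \<Phi> (K c) x" "\<Phi> (K c) x - A j x"] by simp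
          with N[OF k x] d_up[OF mem(2) AC[OF j] x] show "norm (\<Phi> (K (X k)) x - A j x) \<le> d (\<Phi> (K c)) (A j) + e/2" by linarith
        qed
        moreover have "d (\<Phi> (K c)) (A j) \<le> d (\<Phi> (K (X k))) (A j) + e/2"
        proof (rule d_le)
          fix x assume x: "x \<in> S"
          have "norm (\<Phi> (K c) x - A j x) \<le> norm (\<Phi> (K (X k)) x - \<Phi> (K c) x) + norm (\<Phi> (K (X k)) x - A j x)"
            using norm_triangle_ineq[of "\<Phi> (K c) x - \<Phi> (K (X k)) x" "\<Phi> (K (X k)) x - A j x"] by (simp add: norm_minus_commute)
          with N[OF k x] d_up[OF mem(1) AC[OF j] x] show "norm (\<Phi> (K c) x - A j x) \<le> d (\<Phi> (K (X k))) (A j) + e/2"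
            by (smt (verit, best))
        qed
        ultimately show ?thesis using e by (simp add: abs_if)
      qed
      then show "\<exists>no. \<forall>k\<ge>no. norm (d (\<Phi> (K (X k))) (A j) - d (\<Phi> (K c)) (A j)) < e" by blast
    qed
    show "(\<lambda>k. g (X k) i) \<longlonglongrightarrow> g c i"
      unfolding g_def M_def \<mu>_def
      using Mpos[OF \<Phi>[OF KC[OF c]]] i
      by (intro tendsto_intros dl) (auto simp: M_def \<mu>_def)
  qed
  then obtain c where c: "c \<in> C" "\<And>i. i < n \<Longrightarrow> g c i = c i" by blast
  \<comment> \<open>All weights of \<open>g c\<close> sum to one and the first \<open>n\<close> of
    them are the coordinates of \<open>c\<close>, so \<open>c\<close> lies in the simplex. There the
    retraction \<open>w\<close> changes nothing, and the last weight is matched as well.\<close>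
  have "\<sigma> c \<le> 1" "g c n = 1 - \<sigma> c"
    using gsum[OF c(1)] gpos[OF c(1), of n] c(2) by (auto simp: sum_split \<sigma>_def)
  then have wg: "w c i = g c i" if "i \<le> n" for i
    using that c(2) by (auto simp: w_def)
  have "norm (K c x - \<Phi> (K c) x) \<le> \<epsilon>" if x: "x \<in> S" for x
  proof -
    let ?B = "\<Phi> (K c)"
    have BC: "?B \<in> \<C>" using \<Phi> PC KC c by auto
    have "K c x - ?B x = (\<Sum>i\<le>n. g c i *\<^sub>R (A i x - ?B x))"
      using gsum[OF c(1)] wg by (simp add: K_def scaleR_diff_right sum_subtractf scaleR_sum_left[symmetric])
    also have "norm \<dots> \<le> (\<Sum>i\<le>n. g c i * \<epsilon>)"
    proof (rule sum_norm_le)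
      fix i assume i: "i \<in> {..n}"
      show "norm (g c i *\<^sub>R (A i x - ?B x)) \<le> g c i * \<epsilon>"
      proof (cases "d ?B (A i) < \<epsilon>")
        case True
        then have "norm (A i x - ?B x) \<le> \<epsilon>" using d_up[OF BC AC x, of i] i by (simp add: norm_minus_commute)
        then show ?thesis using gpos[OF c(1), of i] by (simp add: mult_left_mono)
      qed (simp add: g_def \<mu>_def)
    qed
    also have "\<dots> = \<epsilon>" using gsum[OF c(1)] by (simp add: sum_distrib_right[symmetric])
    finally show ?thesis .
  qed
  with KC[OF c(1)] show ?thesis by blast
qed

text \<open>Approximate fixed points with error \<open>1 / Suc k\<close> have images in
  \<open>P\<close>, a subsequence of which converges uniformly to a member of \<open>\<C>\<close>.
  The points themselves then converge to the same limit, and continuity of \<open>\<Phi>\<close>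
  identifies it as a fixed point on \<open>S\<close>.\<close>

lemma uniform_fixed_point:
  fixes \<C> P :: "('x \<Rightarrow> 'b::real_normed_vector) set"
  assumes S: "S \<noteq> {}"
    and convex: "\<And>n c A. (\<And>i::nat. i \<le> n \<Longrightarrow> A i \<in> \<C>) \<Longrightarrow> (\<And>i. i \<le> n \<Longrightarrow> (0::real) \<le> c i) \<Longrightarrow> (\<Sum>i\<le>n. c i) = 1
                 \<Longrightarrow> (\<lambda>x. \<Sum>i\<le>n. c i *\<^sub>R A i x) \<in> \<C>"
    and bdd: "\<And>A. A \<in> \<C> \<Longrightarrow> bounded (A ` S)"
    and P: "P \<subseteq> \<C>" "P \<noteq> {}" and \<Phi>: "\<And>A. A \<in> \<C> \<Longrightarrow> \<Phi> A \<in> P"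
    and compact: "\<And>s::nat \<Rightarrow> 'x \<Rightarrow> 'b. (\<And>n. s n \<in> P) \<Longrightarrow> \<exists>l\<in>\<C>. \<exists>r. strict_mono (r::nat\<Rightarrow>nat) \<and> uniform_limit S (\<lambda>n. s (r n)) l sequentially"
    and cont: "\<And>s l. (\<And>n. s n \<in> \<C>) \<Longrightarrow> l \<in> \<C> \<Longrightarrow> uniform_limit S s l sequentially \<Longrightarrow> uniform_limit S (\<lambda>n. \<Phi> (s n)) (\<Phi> l) sequentially"
  shows "\<exists>A\<in>\<C>. \<forall>x\<in>S. \<Phi> A x = A x"
proof -
  have "\<exists>A\<in>\<C>. \<forall>x\<in>S. norm (A x - \<Phi> A x) \<le> 1 / Suc k" for k
    by (rule approximate_fixed_point[OF S convex bdd P \<Phi> compact cont]) auto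
  then obtain A where A: "\<And>k. A k \<in> \<C>" "\<And>k x. x \<in> S \<Longrightarrow> norm (A k x - \<Phi> (A k) x) \<le> 1 / Suc k" by metis
  obtain l r where l: "l \<in> \<C>" and r: "strict_mono (r::nat\<Rightarrow>nat)" "uniform_limit S (\<lambda>n. \<Phi> (A (r n))) l sequentially"
    using compact[of "\<lambda>n. \<Phi> (A n)"] \<Phi> A(1) by blast
  have "uniform_limit S (\<lambda>n x. A (r n) x - \<Phi> (A (r n)) x) (\<lambda>x. 0) sequentially"
  proof (rule uniform_limitI)
    fix e :: real assume "e > 0"
    then have "\<forall>\<^sub>F n in sequentially. 1 / real (Suc (r n)) < e"
      using order_tendstoD(2)[OF LIMSEQ_subseq_LIMSEQ[OF LIMSEQ_inverse_real_of_nat r(1)]] by (simp add: o_def inverse_eq_divide)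
    then show "\<forall>\<^sub>F n in sequentially. \<forall>x\<in>S. dist (A (r n) x - \<Phi> (A (r n)) x) 0 < e"
      by eventually_elim (use A(2) in \<open>auto intro: order.strict_trans1\<close>)
  qed
  from uniform_limit_add[OF this r(2)] have "uniform_limit S (\<lambda>n. A (r n)) l sequentially" by simp
  from cont[OF A(1) l this] have ul: "uniform_limit S (\<lambda>n. \<Phi> (A (r n))) (\<Phi> l) sequentially" .
  have "\<Phi> l x = l x" if "x \<in> S" for x
    using tendsto_uniform_limitI[OF ul that] tendsto_uniform_limitI[OF r(2) that] LIMSEQ_unique by blast
  with l show ?thesis by blast
qed

section \<open>Test functions and mollification\<close>

text \<open>The functions exp(-1/s) / s^m, continued by 0. They are closed under differentiation up
  to linear combination, so all derivatives of exp(-1/s) stay in one explicit family.\<close>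

definition exp_recip :: "nat \<Rightarrow> real \<Rightarrow> real" where
  "exp_recip m s = (if s > 0 then exp (- 1 / s) / s ^ m else 0)"

text \<open>In the variable y = 1/s this is the decay of y^m exp(-y) at infinity.\<close>

lemma exp_recip_tendsto_0: "(exp_recip m \<longlongrightarrow> 0) (at 0)"
proof -
  have "((\<lambda>s::real. inverse s ^ m / exp (inverse s)) \<longlongrightarrow> 0) (at_right 0)"
    using filterlim_compose[OF tendsto_power_div_exp_0 filterlim_inverse_at_top_right] .
  moreover have "\<forall>\<^sub>F s in at_right 0. inverse s ^ m / exp (inverse s) = exp_recip m s"
    using eventually_at_right_less[of 0]
    by eventually_elim (simp add: exp_recip_def exp_minus field_simps)
  ultimately have "(exp_recip m \<longlongrightarrow> 0) (at_right 0)"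
    by (rule Lim_transform_eventually)
  moreover have "\<forall>\<^sub>F s::real in at_left 0. exp_recip m s = 0"
    unfolding eventually_at_left_field by (rule exI[of _ "-1"]) (simp add: exp_recip_def)
  then have "(exp_recip m \<longlongrightarrow> 0) (at_left 0)"
    by (rule tendsto_eventually)
  ultimately show ?thesis by (simp add: filterlim_at_split)
qed

text \<open>For positive s the induction on \<open>m\<close> divides by s. At 0 the difference
  quotient of the m-th function is the next one of the family, which tends to 0.\<close>

lemma DERIV_exp_recip:
  "(exp_recip m has_real_derivative (exp_recip (m + 2) s - real m * exp_recip (m + 1) s)) (at s)"
proof -
  consider "s > 0" | "s < 0" | "s = 0" by linarith
  then show ?thesis
  proof cases
    case 1
    have "((\<lambda>s. exp (- 1 / s) / s ^ m) has_real_derivative (exp_recip (m + 2) s - real m * exp_recip (m + 1) s)) (at s)"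
    proof (induction m)
      case 0
      with 1 show ?case
        by (auto intro!: derivative_eq_intros simp: exp_recip_def field_simps power2_eq_square)
    next
      case (Suc k)
      have "((\<lambda>s. exp (- 1 / s) / s ^ k / s) has_real_derivative
          ((exp_recip (k + 2) s - real k * exp_recip (k + 1) s) * s - exp (- 1 / s) / s ^ k * 1) / (s * s)) (at s)"
        by (rule DERIV_divide[OF Suc DERIV_ident]) (use 1 in simp)
      moreover have "((exp_recip (k + 2) s - real k * exp_recip (k + 1) s) * s - exp (- 1 / s) / s ^ k * 1) / (s * s)
          = exp_recip (Suc k + 2) s - real (Suc k) * exp_recip (Suc k + 1) s"
        using 1 by (simp add: exp_recip_def field_simps)
      ultimately show ?case by (simp add: mult.commute)
    qed
    then show ?thesis
      by (rule has_field_derivative_transform_within_open[of _ _ _ "{0<..}"]) (use 1 in \<open>auto simp: exp_recip_def\<close>)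
  next
    case 2
    have "((\<lambda>s::real. 0::real) has_real_derivative (exp_recip (m + 2) s - real m * exp_recip (m + 1) s)) (at s)"
      using 2 by (simp add: exp_recip_def)
    then show ?thesis
      by (rule has_field_derivative_transform_within_open[of _ _ _ "{..<0}"]) (use 2 in \<open>auto simp: exp_recip_def\<close>)
  next
    case 3
    have "((\<lambda>h. (exp_recip m (0 + h) - exp_recip m 0) / h) \<longlongrightarrow> 0) (at 0)"
      by (rule Lim_transform_eventually[OF exp_recip_tendsto_0[of "Suc m"]])
        (auto simp: exp_recip_def eventually_at_filter)
    then show ?thesis using 3 by (simp add: DERIV_def exp_recip_def)
  qed
qed

text \<open>Not all smooth functions, only a class that contains the bumps and is closed under partial derivatives.\<close>
inductive smooth :: "('a::euclidean_space \<Rightarrow> real) \<Rightarrow> bool" where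
  const: "smooth (\<lambda>x. c)"
| inner: "smooth (\<lambda>x. x \<bullet> i)"
| bump: "smooth (\<lambda>x. exp_recip m (c - (norm (x - a))\<^sup>2))"
| add: "smooth \<phi> \<Longrightarrow> smooth \<psi> \<Longrightarrow> smooth (\<lambda>x. \<phi> x + \<psi> x)"
| mult: "smooth \<phi> \<Longrightarrow> smooth \<psi> \<Longrightarrow> smooth (\<lambda>x. \<phi> x * \<psi> x)"

lemma has_derivative_bump:
  "((\<lambda>x. exp_recip m (c - (norm (x - a))\<^sup>2)) has_derivative
    (\<lambda>h. (exp_recip (m + 2) (c - (norm (x - a))\<^sup>2) - real m * exp_recip (m + 1) (c - (norm (x - a))\<^sup>2))
       * (- 2 * ((x - a) \<bullet> h)))) (at (x::'a::euclidean_space))"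
proof -
  have "((\<lambda>x. c - (norm (x - a))\<^sup>2) has_derivative (\<lambda>h. - 2 * ((x - a) \<bullet> h))) (at x)"
    unfolding power2_norm_eq_inner
    by (auto intro!: derivative_eq_intros simp: inner_commute)
  from DERIV_compose_FDERIV[OF DERIV_exp_recip this, of m] show ?thesis by (simp add: mult.commute)
qed

lemma smooth_has_derivative:
  "smooth \<phi> \<Longrightarrow> \<exists>\<phi>'. (\<forall>x. (\<phi> has_derivative \<phi>' x) (at x)) \<and> (\<forall>i. smooth (\<lambda>x. \<phi>' x i))"
proof (induction rule: smooth.induct)
  case (const c)
  show ?case by (rule exI[of _ "\<lambda>x h. 0"]) (auto intro: smooth.intros)
next
  case (inner i)
  show ?case
    by (rule exI[of _ "\<lambda>x h. h \<bullet> i"]) (auto intro: smooth.intros intro!: derivative_eq_intros)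
next
  case (bump m c a)
  \<comment> \<open>Differences are written as sums with negated constants, because the class is
    generated by sums and products.\<close>
  have "smooth (\<lambda>x. (exp_recip (m + 2) (c - (norm (x - a))\<^sup>2) + (- real m) * exp_recip (m + 1) (c - (norm (x - a))\<^sup>2))
       * ((- 2) * (x \<bullet> i + (- (a \<bullet> i)))))" for i
    by (intro smooth.intros)
  with has_derivative_bump[of m c a] show ?case
    by (intro exI[of _ "\<lambda>x h. (exp_recip (m + 2) (c - (norm (x - a))\<^sup>2) - real m * exp_recip (m + 1) (c - (norm (x - a))\<^sup>2))
       * (- 2 * ((x - a) \<bullet> h))"]) (simp add: inner_diff_left)
next
  case (add \<phi> \<psi>)
  then obtain \<phi>' \<psi>' where "\<forall>x. (\<phi> has_derivative \<phi>' x) (at x)" "\<forall>i. smooth (\<lambda>x. \<phi>' x i)"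
    "\<forall>x. (\<psi> has_derivative \<psi>' x) (at x)" "\<forall>i. smooth (\<lambda>x. \<psi>' x i)" by blast
  then show ?case
    by (intro exI[of _ "\<lambda>x h. \<phi>' x h + \<psi>' x h"]) (auto intro: smooth.intros intro!: derivative_intros)
next
  case (mult \<phi> \<psi>)
  then obtain \<phi>' \<psi>' where "\<forall>x. (\<phi> has_derivative \<phi>' x) (at x)" "\<forall>i. smooth (\<lambda>x. \<phi>' x i)"
    "\<forall>x. (\<psi> has_derivative \<psi>' x) (at x)" "\<forall>i. smooth (\<lambda>x. \<psi>' x i)" by blast
  with mult.hyps show ?case
    by (intro exI[of _ "\<lambda>x h. \<phi> x * \<psi>' x h + \<phi>' x h * \<psi> x"] conjI allI has_derivative_mult smooth.add smooth.mult) blast+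
qed

lemma smooth_C_k: "smooth \<phi> \<Longrightarrow> C_k k \<phi>"
proof (induction k arbitrary: \<phi>)
  case 0
  then show ?case
    using smooth_has_derivative[OF 0] 
    by (auto simp: continuous_on_eq_continuous_at intro: has_derivative_continuous)
next
  case (Suc k)
  obtain \<phi>' where \<phi>': "\<And>x. (\<phi> has_derivative \<phi>' x) (at x)" "\<And>i. smooth (\<lambda>x. \<phi>' x i)"
    using smooth_has_derivative[OF Suc.prems] by blast
  then have "frechet_derivative \<phi> (at x) = \<phi>' x" for x
    by (metis frechet_derivative_at)
  with \<phi>' Suc.IH show ?case by (auto simp: differentiable_def)
qed

lemma exp_recip_ball:
  assumes "r \<le> norm (x::'a::euclidean_space)" "r > 0" shows "exp_recip m (r\<^sup>2 - (norm x)\<^sup>2) = 0"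
proof -
  have "r\<^sup>2 \<le> (norm x)\<^sup>2" using assms by (intro power_mono) auto
  then show ?thesis by (simp add: exp_recip_def)
qed

lemma test_function_bump:
  fixes a :: "'a::euclidean_space"
  assumes "r > 0" "cball a r \<subseteq> \<Omega>"
  shows "test_function \<Omega> (\<lambda>x. C * exp_recip 0 (r\<^sup>2 - (norm (x - a))\<^sup>2))"
proof -
  have "closure {x. C * exp_recip 0 (r\<^sup>2 - (norm (x - a))\<^sup>2) \<noteq> 0} \<subseteq> cball a r"
  proof (rule closure_minimal)
    show "{x. C * exp_recip 0 (r\<^sup>2 - (norm (x - a))\<^sup>2) \<noteq> 0} \<subseteq> cball a r"
      using exp_recip_ball[OF _ assms(1), where m=0] by (force simp: dist_norm norm_minus_commute)
  qed simp
  moreover have "smooth (\<lambda>x. C * exp_recip 0 (r\<^sup>2 - (norm (x - a))\<^sup>2))"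
    by (intro smooth.intros)
  ultimately show ?thesis
    unfolding test_function_def using smooth_C_k assms(2)
    by (auto intro: bounded_subset[OF bounded_cball] simp: compact_eq_bounded_closed)
qed

lemma continuous_on_exp_recip [continuous_intros]:
  "continuous_on S f \<Longrightarrow> continuous_on S (\<lambda>x. exp_recip m (f x))"
proof -
  have "continuous_on UNIV (exp_recip m)"
    using DERIV_exp_recip by (auto intro!: continuous_at_imp_continuous_on DERIV_isCont)
  then show "continuous_on S f \<Longrightarrow> continuous_on S (\<lambda>x. exp_recip m (f x))"
    by (rule continuous_on_compose2) auto
qed

lemma exp_recip_nonneg: "exp_recip m s \<ge> 0" by (simp add: exp_recip_def)

lemma integrable_bump:
  "r > 0 \<Longrightarrow> integrable lborel (\<lambda>x::'a::euclidean_space. exp_recip m (r\<^sup>2 - (norm x)\<^sup>2))"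
proof -
  assume r: "r > 0"
  have "integrable lborel (\<lambda>x::'a. indicator (cball 0 r) x *\<^sub>R exp_recip m (r\<^sup>2 - (norm x)\<^sup>2))"
    by (intro borel_integrable_compact continuous_intros) auto
  moreover have "(\<lambda>x::'a. indicator (cball 0 r) x *\<^sub>R exp_recip m (r\<^sup>2 - (norm x)\<^sup>2)) = (\<lambda>x. exp_recip m (r\<^sup>2 - (norm x)\<^sup>2))"
  proof
    fix x :: 'a
    show "indicator (cball 0 r) x *\<^sub>R exp_recip m (r\<^sup>2 - (norm x)\<^sup>2) = exp_recip m (r\<^sup>2 - (norm x)\<^sup>2)"
      using exp_recip_ball[of r x m] r by (cases "norm x \<le> r") auto
  qed
  ultimately show ?thesis by simp
qed

text \<open>Each radius has its own profile exp(-1 / (r^2 - |x|^2)) instead of a rescaled fixed one.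
  What is used is nonnegativity, smoothness, mass one and vanishing outside the ball of radius
  \<open>r\<close>.\<close>

definition moll :: "real \<Rightarrow> 'a::euclidean_space \<Rightarrow> real" where
  "moll r x = exp_recip 0 (r\<^sup>2 - (norm x)\<^sup>2) / (LINT x|lborel. exp_recip 0 (r\<^sup>2 - (norm (x::'a))\<^sup>2))"

text \<open>A vanishing integral would make the bump zero almost everywhere, although it is positive
  on an open ball.\<close>

lemma bump_integral_pos:
  assumes "r > 0" shows "(LINT x|lborel. exp_recip 0 (r\<^sup>2 - (norm (x::'a::euclidean_space))\<^sup>2)) > 0"
proof -
  have "(LINT x|lborel. exp_recip 0 (r\<^sup>2 - (norm (x::'a))\<^sup>2)) \<noteq> 0"
  proof
    assume "(LINT x|lborel. exp_recip 0 (r\<^sup>2 - (norm (x::'a))\<^sup>2)) = 0"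
    then have "AE x::'a in lborel. exp_recip 0 (r\<^sup>2 - (norm x)\<^sup>2) = 0"
      using integral_nonneg_eq_0_iff_AE[OF integrable_bump[OF assms, where 'a='a], of 0] by (simp add: exp_recip_nonneg)
    then have "AE x::'a in lborel. x \<notin> ball 0 r"
    proof eventually_elim
      case (elim x)
      then show ?case using assms by (auto simp: exp_recip_def power_strict_mono split: if_splits)
    qed
    then have "emeasure lborel (ball (0::'a) r) = 0"
      by (subst (asm) AE_iff_measurable[OF _ refl]) (auto simp: ball_def)
    then show False using assms open_not_negligible[of "ball (0::'a) r"]
      by (auto simp: negligible_iff_null_sets null_sets_def)
  qed
  moreover have "(LINT x|lborel. exp_recip 0 (r\<^sup>2 - (norm (x::'a))\<^sup>2)) \<ge> 0"
    by (simp add: exp_recip_nonneg)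
  ultimately show ?thesis by linarith
qed

lemma moll_nonneg: "r > 0 \<Longrightarrow> moll r x \<ge> 0"
  using bump_integral_pos by (auto simp: moll_def exp_recip_nonneg intro!: divide_nonneg_pos)

lemma moll_integrable: "r > 0 \<Longrightarrow> integrable lborel (moll r)"
  unfolding moll_def by (intro integrable_divide integrable_bump)

lemma moll_integral: "r > 0 \<Longrightarrow> (LINT x|lborel. moll r (x::'a::euclidean_space)) = 1"
  using bump_integral_pos[of r, where 'a='a] by (simp add: moll_def)

lemma moll_outside: "norm x \<ge> r \<Longrightarrow> r > 0 \<Longrightarrow> moll r x = 0"
  by (simp add: moll_def exp_recip_ball)

lemma moll_continuous [continuous_intros]: "continuous_on S f \<Longrightarrow> continuous_on S (\<lambda>x. moll r (f x))"
  unfolding moll_def divide_inverse by (intro continuous_intros)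

text \<open>The derivative in explicit form; the index 2 arises because differentiating the family
  at \<open>m = 0\<close> leaves the single term with exponent 2.\<close>

definition moll' :: "real \<Rightarrow> 'a::euclidean_space \<Rightarrow> 'a \<Rightarrow> real" where
  "moll' r x h = exp_recip 2 (r\<^sup>2 - (norm x)\<^sup>2) * (- 2 * (x \<bullet> h)) / (LINT x|lborel. exp_recip 0 (r\<^sup>2 - (norm (x::'a))\<^sup>2))"

lemma moll_has_derivative: "(moll r has_derivative moll' r x) (at x)"
proof -
  have "((\<lambda>x. exp_recip 0 (r\<^sup>2 - (norm (x::'a))\<^sup>2)) has_derivative (\<lambda>h. exp_recip 2 (r\<^sup>2 - (norm x)\<^sup>2) * (- 2 * (x \<bullet> h)))) (at x)"
    using has_derivative_bump[of 0 "r\<^sup>2" "0::'a" x] by (simp add: numeral_2_eq_2)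
  then have "((\<lambda>x. exp_recip 0 (r\<^sup>2 - (norm (x::'a))\<^sup>2) / (LINT x|lborel. exp_recip 0 (r\<^sup>2 - (norm (x::'a))\<^sup>2))) has_derivative 
    (\<lambda>h. exp_recip 2 (r\<^sup>2 - (norm x)\<^sup>2) * (- 2 * (x \<bullet> h)) / (LINT x|lborel. exp_recip 0 (r\<^sup>2 - (norm (x::'a))\<^sup>2)))) (at x)"
    unfolding divide_inverse by (rule has_derivative_mult_left)
  then show ?thesis unfolding moll_def[abs_def] moll'_def[abs_def] .
qed

lemma moll'_continuous: "continuous_on S f \<Longrightarrow> continuous_on S g \<Longrightarrow> continuous_on S (\<lambda>x. moll' r (f x) (g x))"
  unfolding moll'_def divide_inverse by (intro continuous_intros)

lemma moll'_linear: "linear (moll' r x)"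
  using moll_has_derivative has_derivative_linear by blast

text \<open>Bounded on the closed ball by compactness and zero outside; the uniform bound is what
  later makes the kernel derivative integrable against \<open>u\<close>.\<close>

lemma moll'_bounded: "r > 0 \<Longrightarrow> \<exists>M. \<forall>x h. norm h \<le> 1 \<longrightarrow> \<bar>moll' r (x::'a::euclidean_space) h\<bar> \<le> M"
proof -
  assume r: "r > 0"
  let ?I = "LINT x|lborel. exp_recip 0 (r\<^sup>2 - (norm (x::'a))\<^sup>2)"
  have "compact ((\<lambda>x::'a. exp_recip 2 (r\<^sup>2 - (norm x)\<^sup>2) * norm x) ` cball 0 r)"
    by (intro compact_continuous_image continuous_intros compact_cball)
  then obtain M where M: "\<And>x::'a. norm x \<le> r \<Longrightarrow> \<bar>exp_recip 2 (r\<^sup>2 - (norm x)\<^sup>2) * norm x\<bar> \<le> M"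
    using compact_imp_bounded by (force simp: bounded_iff)
  have Mg: "\<bar>exp_recip 2 (r\<^sup>2 - (norm x)\<^sup>2) * norm x\<bar> \<le> M" for x :: 'a
    using M[of x] M[of 0] exp_recip_ball[of r x 2] r by (cases "norm x \<le> r") auto
  have "\<bar>moll' r x h\<bar> \<le> 2 * M / ?I" if "norm h \<le> 1" for x h :: 'a
  proof -
    have "\<bar>x \<bullet> h\<bar> \<le> norm x"
      using Cauchy_Schwarz_ineq2[of x h] mult_left_mono[OF that, of "norm x"] by simp
    then have "exp_recip 2 (r\<^sup>2 - (norm x)\<^sup>2) * \<bar>x \<bullet> h\<bar> \<le> exp_recip 2 (r\<^sup>2 - (norm x)\<^sup>2) * norm x"
      by (intro mult_left_mono exp_recip_nonneg)
    also have "\<dots> \<le> M" using Mg[of x] by simp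
    finally show ?thesis
      using bump_integral_pos[OF r, where 'a='a] exp_recip_nonneg[of 2 "r\<^sup>2 - (norm x)\<^sup>2"]
      by (simp add: moll'_def abs_mult divide_right_mono)
  qed
  then show ?thesis by blast
qed

text \<open>Admissibility of the kernel centred at \<open>w\<close>: tested with it, the weak
  gradient identity says that the gradient of the mollified function at \<open>w\<close> is the
  mollified gradient. The sign comes from the reflection in \<open>w - y\<close>.\<close>

lemma test_function_moll:
  fixes w :: "'a::euclidean_space"
  assumes "r > 0" "cball w r \<subseteq> \<Omega>"
  shows "test_function \<Omega> (\<lambda>y. moll r (w - y))"
    and "frechet_derivative (\<lambda>y. moll r (w - y)) (at y) h = - moll' r (w - y) h"
proof -
  have "(\<lambda>y. moll r (w - y)) = (\<lambda>y. (1 / (LINT x|lborel. exp_recip 0 (r\<^sup>2 - (norm (x::'a))\<^sup>2))) * exp_recip 0 (r\<^sup>2 - (norm (y - w))\<^sup>2))"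
    by (simp add: moll_def norm_minus_commute)
  then show "test_function \<Omega> (\<lambda>y. moll r (w - y))"
    using test_function_bump[OF assms] by (simp only:)
  have D: "((\<lambda>y. moll r (w - y)) has_derivative (\<lambda>h. moll' r (w - y) (- h))) (at y)"
    by (rule has_derivative_compose[OF _ moll_has_derivative]) (auto intro!: derivative_eq_intros)
  show "frechet_derivative (\<lambda>y. moll r (w - y)) (at y) h = - moll' r (w - y) h"
    using frechet_derivative_at[OF D] linear_neg[OF moll'_linear] by metis
qed

section \<open>Continuity of translations in L^1\<close>

lemma nn_integral_lborel_affine:
  fixes f :: "'a::euclidean_space \<Rightarrow> ennreal"
  assumes [measurable]: "f \<in> borel_measurable borel" and c: "c \<noteq> 0"
  shows "(\<integral>\<^sup>+x. f x \<partial>lborel) = ennreal (\<bar>c\<bar> ^ DIM('a)) * (\<integral>\<^sup>+x. f (t + c *\<^sub>R x) \<partial>lborel)"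
  by (subst lborel_affine[OF c, of t]) (simp add: nn_integral_density nn_integral_distr nn_integral_cmult)

lemma nn_integral_lborel_shift:
  fixes f :: "'a::euclidean_space \<Rightarrow> ennreal"
  assumes "f \<in> borel_measurable borel"
  shows "(\<integral>\<^sup>+x. f (x - h) \<partial>lborel) = (\<integral>\<^sup>+x. f x \<partial>lborel)"
  using nn_integral_lborel_affine[OF assms, of 1 "- h"] by (simp add: add.commute[of "- h"])

lemma nn_integral_lborel_reflect:
  fixes f :: "'a::euclidean_space \<Rightarrow> ennreal"
  assumes "f \<in> borel_measurable borel"
  shows "(\<integral>\<^sup>+x. f (t - x) \<partial>lborel) = (\<integral>\<^sup>+x. f x \<partial>lborel)"
  using nn_integral_lborel_affine[OF assms, of "-1" t] by simp

text \<open>Inner regularity is a property of finite Borel measures, so it is applied to Lebesgue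
  measure restricted to \<open>A\<close>, which is finite by assumption.\<close>

lemma compact_inner_approx_lborel:
  fixes A :: "'a::euclidean_space set"
  assumes A: "A \<in> sets borel" "emeasure lborel A < \<infinity>" and e: "e > (0::real)"
  shows "\<exists>K. compact K \<and> K \<subseteq> A \<and> emeasure lborel (A - K) < e"
proof -
  define M where "M = density lborel (indicator A)"
  have em: "emeasure M B = emeasure lborel (A \<inter> B)" if "B \<in> sets borel" for B
    using A that by (simp add: M_def emeasure_restricted)
  have "emeasure M A = (SUP K \<in> {K. K \<subseteq> A \<and> compact K}. emeasure M K)"
    by (rule inner_regular) (use A em[of UNIV] in \<open>auto simp: M_def\<close>)
  then have S: "emeasure lborel A = (SUP K \<in> {K. K \<subseteq> A \<and> compact K}. emeasure M K)"
    using em[OF A(1)] by simp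
  show ?thesis
  proof (cases "emeasure lborel A = 0")
    case True
    then show ?thesis using e by (intro exI[of _ "{}"]) auto
  next
    case False
    then have "emeasure lborel A - e < emeasure lborel A"
      using A(2) e by (intro ennreal_between) (auto simp: zero_less_iff_neq_zero)
    then obtain K where K: "K \<subseteq> A" "compact K" "emeasure lborel A - e < emeasure M K"
      unfolding S less_SUP_iff by blast
    have Kb: "K \<in> sets borel" using K(2) by (simp add: borel_compact)
    have "emeasure lborel A = emeasure lborel K + emeasure lborel (A - K)"
      using A(1) Kb K(1) by (subst plus_emeasure) (auto simp: Un_absorb1)
    moreover have "emeasure M K = emeasure lborel K" using em[OF Kb] K(1) by (simp add: Int_absorb1)
    ultimately have "emeasure lborel (A - K) < e"
      using K(3) A(2) e
      by (cases "emeasure lborel K"; cases "emeasure lborel (A - K)")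
         (auto simp: ennreal_plus[symmetric] ennreal_minus simp del: ennreal_plus split: if_splits
            intro!: ennreal_lessI dest!: ennreal_less_iff[THEN iffD1, rotated])
    then show ?thesis using K by blast
  qed
qed

text \<open>\<open>A\<close> is enclosed between a compact \<open>K\<close> and an open
  \<open>U\<close> of nearly the same measure. A shift shorter than the distance from
  \<open>K\<close> to the complement of \<open>U\<close> moves \<open>K\<close> within
  \<open>U\<close>, so the two indicators can differ only on the thin sets \<open>A - K\<close> and
  \<open>U - A\<close> and their translates.\<close>

lemma translation_L1_indicator:
  fixes A :: "'a::euclidean_space set"
  assumes A: "A \<in> sets borel" "emeasure lborel A < \<infinity>" and e: "e > (0::real)"
  shows "\<exists>d>0. \<forall>h. norm h < d \<longrightarrow>
     (\<integral>\<^sup>+x. ennreal \<bar>indicator A (x - h) - indicator A x\<bar> \<partial>lborel) \<le> ennreal e"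
proof -
  obtain K where K: "compact K" "K \<subseteq> A" "emeasure lborel (A - K) < e / 4"
    using compact_inner_approx_lborel[OF A, of "e/4"] e by auto
  obtain U where U: "open U" "A \<subseteq> U" "emeasure lborel (U - A) < e / 4"
    using outer_regular_lborel[OF A(1), of "e/4"] e by auto
  have "\<exists>\<delta>>0. \<forall>x\<in>K. \<forall>y\<in>- U. \<delta> \<le> dist x y"
    by (rule separate_compact_closed) (use K U in auto)
  then obtain d where d: "d > 0" "\<And>x y. x \<in> K \<Longrightarrow> y \<notin> U \<Longrightarrow> d \<le> dist x y" by auto
  have Kb: "K \<in> sets borel" "U \<in> sets borel" using K U by (auto simp: borel_compact)
  have [measurable]: "A \<in> sets borel" "K \<in> sets borel" "U \<in> sets borel" using A Kb by auto
  have "(\<integral>\<^sup>+x. ennreal \<bar>indicator A (x - h) - indicator A x\<bar> \<partial>lborel) \<le> ennreal e" if h: "norm h < d" for h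
  proof -
    have "(\<integral>\<^sup>+x. ennreal \<bar>indicator A (x - h) - indicator A x\<bar> \<partial>lborel) \<le>
      (\<integral>\<^sup>+x. (indicator (A - K) (x - h) + indicator (U - A) x) + (indicator (A - K) x + indicator (U - A) (x - h)) \<partial>lborel)"
    proof (rule nn_integral_mono)
      fix x :: 'a
      have 1: "x \<in> U" if "x - h \<in> K" using d(2)[OF that, of x] h by (force simp: dist_norm)
      have 2: "x - h \<in> U" if "x \<in> K" using d(2)[OF that, of "x - h"] h by (force simp: dist_norm)
      show "ennreal \<bar>indicator A (x - h) - indicator A x\<bar> \<le>
        (indicator (A - K) (x - h) + indicator (U - A) x) + (indicator (A - K) x + indicator (U - A) (x - h))"
        using 1 2 U(2) by (auto simp: indicator_def)
    qed
    also have "\<dots> = emeasure lborel (A - K) + emeasure lborel (U - A) + (emeasure lborel (A - K) + emeasure lborel (U - A))"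
      by (simp add: nn_integral_add nn_integral_lborel_shift[of "indicator _"])
    also have "\<dots> \<le> ennreal (e/4) + ennreal (e/4) + (ennreal (e/4) + ennreal (e/4))"
      by (intro add_mono less_imp_le[OF K(3)] less_imp_le[OF U(3)])
    also have "\<dots> = ennreal e" using e by (simp add: ennreal_plus[symmetric] del: ennreal_plus)
    finally show ?thesis .
  qed
  with d(1) show ?thesis by blast
qed

text \<open>Induction over integrable functions: indicators, sums and dominated limits. In the last
  case the error of the approximation enters twice, once shifted, and translation invariance makes
  both contributions equal.\<close>

lemma translation_L1:
  fixes u :: "'a::euclidean_space \<Rightarrow> 'b::{banach, second_countable_topology}"
  assumes "integrable lborel u" and "e > (0::real)"
  shows "\<exists>d>0. \<forall>h. norm h < d \<longrightarrow> (\<integral>\<^sup>+x. ennreal (norm (u (x - h) - u x)) \<partial>lborel) \<le> ennreal e"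
  using assms
proof (induction arbitrary: e rule: integrable_induct)
  case (base A c)
  \<comment> \<open>The 1 added to \<open>norm c\<close> covers the case
    \<open>c = 0\<close>.\<close>
  obtain d where d: "d > 0" "\<And>h. norm h < d \<Longrightarrow>
     (\<integral>\<^sup>+x. ennreal \<bar>indicator A (x - h) - indicator A x\<bar> \<partial>lborel) \<le> ennreal (e / (norm c + 1))"
    using translation_L1_indicator[of A "e / (norm c + 1)"] base by (auto simp: add_nonneg_pos)
  have [measurable]: "A \<in> sets borel" using base by simp
  have "(\<integral>\<^sup>+x. ennreal (norm (indicator A (x - h) *\<^sub>R c - indicator A x *\<^sub>R c)) \<partial>lborel) \<le> ennreal e" if "norm h < d" for h
  proof -
    have "(\<integral>\<^sup>+x. ennreal (norm (indicator A (x - h) *\<^sub>R c - indicator A x *\<^sub>R c)) \<partial>lborel)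
       = (\<integral>\<^sup>+x. ennreal (norm c) * ennreal \<bar>indicator A (x - h) - indicator A x\<bar> \<partial>lborel)"
      by (simp add: scaleR_diff_left[symmetric] ennreal_mult[symmetric] mult.commute)
    also have "\<dots> = ennreal (norm c) * (\<integral>\<^sup>+x. ennreal \<bar>indicator A (x - h) - indicator A x\<bar> \<partial>lborel)"
      by (rule nn_integral_cmult) measurable
    also have "\<dots> \<le> ennreal (norm c) * ennreal (e / (norm c + 1))"
      by (intro mult_left_mono d that) simp
    also have "\<dots> \<le> ennreal e"
      using base.prems by (auto simp: ennreal_mult[symmetric] divide_le_eq algebra_simps intro!: ennreal_leI) (smt (verit) norm_ge_zero mult_nonneg_nonneg)+
    finally show ?thesis .
  qed
  with d(1) show ?case by blast
next
  case (add f g)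
  obtain d1 where d1: "d1 > 0" "\<And>h. norm h < d1 \<Longrightarrow> (\<integral>\<^sup>+x. ennreal (norm (f (x - h) - f x)) \<partial>lborel) \<le> ennreal (e/2)"
    using add.IH(1)[of "e/2"] add.prems by auto
  obtain d2 where d2: "d2 > 0" "\<And>h. norm h < d2 \<Longrightarrow> (\<integral>\<^sup>+x. ennreal (norm (g (x - h) - g x)) \<partial>lborel) \<le> ennreal (e/2)"
    using add.IH(2)[of "e/2"] add.prems by auto
  have [measurable]: "f \<in> borel_measurable borel" "g \<in> borel_measurable borel"
    using add.hyps by (auto dest: borel_measurable_integrable)
  have "(\<integral>\<^sup>+x. ennreal (norm ((f (x - h) + g (x - h)) - (f x + g x))) \<partial>lborel) \<le> ennreal e" if "norm h < min d1 d2" for h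
  proof -
    have "(\<integral>\<^sup>+x. ennreal (norm ((f (x - h) + g (x - h)) - (f x + g x))) \<partial>lborel)
       \<le> (\<integral>\<^sup>+x. ennreal (norm (f (x - h) - f x)) + ennreal (norm (g (x - h) - g x)) \<partial>lborel)"
      by (intro nn_integral_mono) (simp add: ennreal_plus[symmetric] norm_diff_triangle_ineq del: ennreal_plus)
    also have "\<dots> = (\<integral>\<^sup>+x. ennreal (norm (f (x - h) - f x)) \<partial>lborel) + (\<integral>\<^sup>+x. ennreal (norm (g (x - h) - g x)) \<partial>lborel)"
      by (rule nn_integral_add) measurable
    also have "\<dots> \<le> ennreal (e/2) + ennreal (e/2)"
      by (intro add_mono d1(2) d2(2)) (use that in auto)
    also have "\<dots> = ennreal e" using add.prems by (simp add: ennreal_plus[symmetric] del: ennreal_plus)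
    finally show ?thesis .
  qed
  then show ?case using d1(1) d2(1) by (intro exI[of _ "min d1 d2"]) auto
next
  case (lim f s)
  have [measurable]: "f \<in> borel_measurable borel" "s i \<in> borel_measurable borel" for i
    using lim.hyps(1)[of i] lim.hyps(4) by (auto dest: borel_measurable_integrable)
  have "(\<lambda>i. (\<integral>\<^sup>+x. ennreal (norm (f x - s i x)) \<partial>lborel)) \<longlonglongrightarrow> 0"
  proof (rule nn_integral_dominated_convergence_norm[where w = "\<lambda>x. 2 * norm (f x)"])
    have "(\<integral>\<^sup>+ x. ennreal (2 * norm (f x)) \<partial>lborel) = 2 * (\<integral>\<^sup>+ x. ennreal (norm (f x)) \<partial>lborel)"
      by (simp add: ennreal_mult nn_integral_cmult)
    also have "\<dots> < \<infinity>" using lim.hyps(4) by (simp add: integrable_iff_bounded ennreal_mult_less_top)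
    finally show "(\<integral>\<^sup>+ x. ennreal (2 * norm (f x)) \<partial>lborel) < \<infinity>" .
  qed (use lim.hyps in auto)
  then have "\<forall>\<^sub>F i in sequentially. (\<integral>\<^sup>+x. ennreal (norm (f x - s i x)) \<partial>lborel) < ennreal (e/3)"
    using lim.prems by (intro order_tendstoD) auto
  then obtain i where i: "(\<integral>\<^sup>+x. ennreal (norm (f x - s i x)) \<partial>lborel) < ennreal (e/3)"
    by (auto simp: eventually_sequentially)
  obtain d where d: "d > 0" "\<And>h. norm h < d \<Longrightarrow> (\<integral>\<^sup>+x. ennreal (norm (s i (x - h) - s i x)) \<partial>lborel) \<le> ennreal (e/3)"
    using lim.IH[of "e/3" i] lim.prems by auto
  have "(\<integral>\<^sup>+x. ennreal (norm (f (x - h) - f x)) \<partial>lborel) \<le> ennreal e" if "norm h < d" for h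
  proof -
    have "(\<integral>\<^sup>+x. ennreal (norm (f (x - h) - f x)) \<partial>lborel)
      \<le> (\<integral>\<^sup>+x. ennreal (norm (f (x - h) - s i (x - h))) + ennreal (norm (s i (x - h) - s i x)) + ennreal (norm (f x - s i x)) \<partial>lborel)"
    proof (rule nn_integral_mono)
      fix x
      have "norm (f (x - h) - f x) \<le> norm (f (x - h) - s i (x - h)) + norm (s i (x - h) - s i x) + norm (f x - s i x)"
        using norm_triangle_ineq[of "f (x - h) - s i (x - h)" "s i (x - h) - s i x"]
          norm_triangle_ineq4[of "f (x - h) - s i x" "f x - s i x"] by simp
      then show "ennreal (norm (f (x - h) - f x)) \<le> ennreal (norm (f (x - h) - s i (x - h))) + ennreal (norm (s i (x - h) - s i x)) + ennreal (norm (f x - s i x))"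
        by (simp add: ennreal_plus[symmetric] del: ennreal_plus)
    qed
    also have "\<dots> = (\<integral>\<^sup>+x. ennreal (norm (f (x - h) - s i (x - h))) \<partial>lborel) + (\<integral>\<^sup>+x. ennreal (norm (s i (x - h) - s i x)) \<partial>lborel) + (\<integral>\<^sup>+x. ennreal (norm (f x - s i x)) \<partial>lborel)"
      by (simp add: nn_integral_add)
    also have "\<dots> \<le> ennreal (e/3) + ennreal (e/3) + ennreal (e/3)"
      using i d(2)[OF that] nn_integral_lborel_shift[of "\<lambda>x. ennreal (norm (f x - s i x))" h] by (intro add_mono) auto
    also have "\<dots> = ennreal e" using lim.prems by (simp add: ennreal_plus[symmetric] del: ennreal_plus)
    finally show ?thesis .
  qed
  with d(1) show ?case by blast
qed

section \<open>Mollification and its convergence in L^1\<close>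

definition mollify :: "real \<Rightarrow> ('a::euclidean_space \<Rightarrow> 'b::euclidean_space) \<Rightarrow> 'a \<Rightarrow> 'b" where
  "mollify r u x = (LINT y|lborel. moll r (x - y) *\<^sub>R u y)"

lemma moll_measurable [measurable]: "moll r \<in> borel_measurable borel"
  using moll_continuous[of UNIV "\<lambda>x. x" r] by (intro borel_measurable_continuous_onI) simp

lemma mollify_measurable [measurable]:
  assumes [measurable]: "u \<in> borel_measurable borel" shows "mollify r u \<in> borel_measurable borel"
  unfolding mollify_def by measurable

lemma moll_bounded: "r > 0 \<Longrightarrow> \<exists>M. \<forall>x::'a::euclidean_space. norm (moll r x) \<le> M"
proof -
  assume r: "r > 0"
  have "exp_recip 0 (r\<^sup>2 - (norm x)\<^sup>2) \<le> 1" for x :: 'a by (simp add: exp_recip_def)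
  then have "norm (moll r x) \<le> 1 / (LINT x|lborel. exp_recip 0 (r\<^sup>2 - (norm (x::'a))\<^sup>2))" for x :: 'a
    using bump_integral_pos[OF r, where 'a='a] exp_recip_nonneg
    by (simp only: moll_def real_norm_def abs_divide abs_of_nonneg abs_of_pos divide_right_mono less_imp_le)
  then show ?thesis by blast
qed

lemma integrable_moll_mult:
  fixes u :: "'a::euclidean_space \<Rightarrow> 'b::euclidean_space"
  assumes "r > 0" and u: "integrable lborel u"
  shows "integrable lborel (\<lambda>y. moll r (x - y) *\<^sub>R u y)"
proof -
  obtain M where M: "\<And>x::'a. norm (moll r x) \<le> M" using moll_bounded[OF assms(1)] by blast
  have [measurable]: "u \<in> borel_measurable borel" using u by (auto dest: borel_measurable_integrable)
  show ?thesis
    by (rule Bochner_Integration.integrable_bound[OF integrable_scaleR_right[OF integrable_norm[OF u], of M]])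
       (auto simp: abs_mult intro!: mult_right_mono order_trans[OF M[unfolded real_norm_def] abs_ge_self])
qed

lemma nn_integral_moll: "r > 0 \<Longrightarrow> (\<integral>\<^sup>+x. ennreal (moll r (x::'a::euclidean_space)) \<partial>lborel) = 1"
  using nn_integral_eq_integral[OF moll_integrable[where 'a='a], of r] moll_integral[of r, where 'a='a]
  by (simp add: moll_nonneg)

lemma integrable_moll_reflect: "r > 0 \<Longrightarrow> integrable lborel (\<lambda>y. moll r (x - y))"
  by (rule integrableI_bounded) (use nn_integral_lborel_reflect[of "\<lambda>x. ennreal (moll r x)" x] in \<open>auto simp: moll_nonneg nn_integral_moll\<close>)

lemma integral_moll_reflect: "r > 0 \<Longrightarrow> (LINT y|lborel. moll r (x - y)) = 1"
  using nn_integral_eq_integral[OF integrable_moll_reflect, of r x] nn_integral_lborel_reflect[of "\<lambda>x. ennreal (moll r x)" x]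
  by (simp add: moll_nonneg nn_integral_moll)

text \<open>The kernel has mass one, so the error is an average over \<open>h\<close> of the
  differences u(x - h) - u(x). Tonelli moves the integral over \<open>x\<close> inside, and only
  shifts shorter than \<open>r\<close> carry weight.\<close>

lemma mollify_L1:
  fixes u :: "'a::euclidean_space \<Rightarrow> 'b::euclidean_space"
  assumes u: "integrable lborel u" and e: "e > 0"
  shows "\<exists>d>0. \<forall>r>0. r < d \<longrightarrow> (\<integral>\<^sup>+x. ennreal (norm (mollify r u x - u x)) \<partial>lborel) \<le> ennreal e"
proof -
  have [measurable]: "u \<in> borel_measurable borel" using u by (auto dest: borel_measurable_integrable)
  obtain d where d: "d > 0" "\<And>h. norm h < d \<Longrightarrow> (\<integral>\<^sup>+x. ennreal (norm (u (x - h) - u x)) \<partial>lborel) \<le> ennreal e"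
    using translation_L1[OF u e] by blast
  have "(\<integral>\<^sup>+x. ennreal (norm (mollify r u x - u x)) \<partial>lborel) \<le> ennreal e" if r: "r > 0" "r < d" for r
  proof -
    have "ennreal (norm (mollify r u x - u x)) \<le> (\<integral>\<^sup>+h. ennreal (moll r h) * ennreal (norm (u (x - h) - u x)) \<partial>lborel)" for x
    proof -
      have "mollify r u x - u x = (LINT y|lborel. moll r (x - y) *\<^sub>R u y) - (LINT y|lborel. moll r (x - y) *\<^sub>R u x)"
        using integral_moll_reflect[OF r(1), of x] integral_scaleR_left[OF integrable_moll_reflect[OF r(1), of x], of "u x"]
        by (simp add: mollify_def)
      also have "\<dots> = (LINT y|lborel. moll r (x - y) *\<^sub>R (u y - u x))"
        unfolding scaleR_diff_right
        by (intro Bochner_Integration.integral_diff[symmetric] integrable_moll_mult[OF r(1) u] integrable_scaleR_left integrable_moll_reflect r)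
      finally have "mollify r u x - u x = (LINT y|lborel. moll r (x - y) *\<^sub>R (u y - u x))" .
      moreover have "integrable lborel (\<lambda>y. moll r (x - y) *\<^sub>R (u y - u x))"
        unfolding scaleR_diff_right
        by (intro Bochner_Integration.integrable_diff integrable_moll_mult[OF r(1) u] integrable_scaleR_left integrable_moll_reflect r)
      ultimately have "ennreal (norm (mollify r u x - u x)) \<le> (\<integral>\<^sup>+y. ennreal (norm (moll r (x - y) *\<^sub>R (u y - u x))) \<partial>lborel)"
        using integral_norm_bound_ennreal by metis
      also have "\<dots> = (\<integral>\<^sup>+y. ennreal (moll r (x - y)) * ennreal (norm (u y - u x)) \<partial>lborel)"
        by (simp add: ennreal_mult moll_nonneg[OF r(1)])
      also have "\<dots> = (\<integral>\<^sup>+h. ennreal (moll r h) * ennreal (norm (u (x - h) - u x)) \<partial>lborel)"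
        using nn_integral_lborel_reflect[of "\<lambda>h. ennreal (moll r h) * ennreal (norm (u (x - h) - u x))" x] by simp
      finally show ?thesis .
    qed
    then have "(\<integral>\<^sup>+x. ennreal (norm (mollify r u x - u x)) \<partial>lborel)
      \<le> (\<integral>\<^sup>+x. (\<integral>\<^sup>+h. ennreal (moll r h) * ennreal (norm (u (x - h) - u x)) \<partial>lborel) \<partial>lborel)"
      by (intro nn_integral_mono)
    also have "\<dots> = (\<integral>\<^sup>+h. (\<integral>\<^sup>+x. ennreal (moll r h) * ennreal (norm (u (x - h) - u x)) \<partial>lborel) \<partial>lborel)"
      by (rule lborel_pair.Fubini'[symmetric]) measurable
    also have "\<dots> = (\<integral>\<^sup>+h. ennreal (moll r h) * (\<integral>\<^sup>+x. ennreal (norm (u (x - h) - u x)) \<partial>lborel) \<partial>lborel)"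
      by (intro nn_integral_cong nn_integral_cmult) measurable
    also have "\<dots> \<le> (\<integral>\<^sup>+h. ennreal (moll r (h::'a)) * ennreal e \<partial>lborel)"
    proof (rule nn_integral_mono)
      fix h :: 'a
      show "ennreal (moll r h) * (\<integral>\<^sup>+x. ennreal (norm (u (x - h) - u x)) \<partial>lborel) \<le> ennreal (moll r h) * ennreal e"
      proof (cases "norm h < d")
        case True
        then show ?thesis by (intro mult_left_mono d(2)) auto
      next
        case False
        then have "moll r h = 0" using r by (intro moll_outside) auto
        then show ?thesis by simp
      qed
    qed
    also have "\<dots> = ennreal e" by (simp add: nn_integral_multc nn_integral_moll[OF r(1)])
    finally show ?thesis .
  qed
  with d(1) show ?thesis by blast
qed

lemma mollify_L1_tendsto:
  fixes u :: "'a::euclidean_space \<Rightarrow> 'b::euclidean_space"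
  assumes u: "integrable lborel u" and \<rho>: "\<And>n. \<rho> n > 0" "\<rho> \<longlonglongrightarrow> 0"
  shows "(\<lambda>n. \<integral>\<^sup>+x. ennreal (norm (mollify (\<rho> n) u x - u x)) \<partial>lborel) \<longlonglongrightarrow> 0"
proof (rule tendsto_zero_ennreal)
  fix e :: real assume "e > 0"
  obtain d where d: "d > 0" "\<And>r. r > 0 \<Longrightarrow> r < d \<Longrightarrow> (\<integral>\<^sup>+x. ennreal (norm (mollify r u x - u x)) \<partial>lborel) \<le> ennreal (e/2)"
    using mollify_L1[OF u, of "e/2"] \<open>e > 0\<close> by auto
  have "ennreal (e/2) < ennreal e" using \<open>e > 0\<close> by (simp add: ennreal_lessI)
  moreover have "\<forall>\<^sub>F n in sequentially. \<rho> n < d" using \<rho>(2) d(1) by (rule order_tendstoD)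
  ultimately show "\<forall>\<^sub>F n in sequentially. (\<integral>\<^sup>+x. ennreal (norm (mollify (\<rho> n) u x - u x)) \<partial>lborel) < ennreal e"
    by (auto elim!: eventually_mono intro: le_less_trans d(2) \<rho>(1))
qed

lemma nn_tendsto_0_AE_subseq:
  fixes v :: "nat \<Rightarrow> 'a \<Rightarrow> 'b::euclidean_space"
  assumes [measurable]: "\<And>n. v n \<in> borel_measurable M"
    and lim: "(\<lambda>n. \<integral>\<^sup>+x. ennreal (norm (v n x)) \<partial>M) \<longlonglongrightarrow> 0"
  shows "\<exists>r::nat\<Rightarrow>nat. strict_mono r \<and> (AE x in M. (\<lambda>n. v (r n) x) \<longlonglongrightarrow> 0)"
proof -
  have "\<forall>\<^sub>F n in sequentially. (\<integral>\<^sup>+x. ennreal (norm (v n x)) \<partial>M) < 1"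
    using lim by (rule order_tendstoD) simp
  then obtain N where N: "\<And>n. n \<ge> N \<Longrightarrow> (\<integral>\<^sup>+x. ennreal (norm (v n x)) \<partial>M) < 1" by (auto simp: eventually_sequentially)
  \<comment> \<open>Early members of the sequence need not be integrable, hence the shift by
    \<open>N\<close>.\<close>
  have int: "integrable M (v (n + N))" for n
    using N[of "n + N"] by (intro integrableI_bounded) (auto intro: less_trans)
  have "(\<lambda>n. ennreal (\<integral>x. norm (v (n + N) x) \<partial>M)) \<longlonglongrightarrow> ennreal 0"
    using LIMSEQ_ignore_initial_segment[OF lim, of N]
    by (simp add: nn_integral_eq_integral[OF integrable_norm[OF int]])
  then have "(\<lambda>n. \<integral>x. norm (v (n + N) x) \<partial>M) \<longlonglongrightarrow> 0"
    by (subst (asm) tendsto_ennreal_iff) auto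
  from tendsto_L1_AE_subseq[OF int this] obtain r where "strict_mono (r::nat\<Rightarrow>nat)" "AE x in M. (\<lambda>n. v (r n + N) x) \<longlonglongrightarrow> 0"
    by blast
  then show ?thesis by (intro exI[of _ "\<lambda>n. r n + N"]) (auto simp: strict_mono_def)
qed

text \<open>Truncation at 1 replaces the possibly infinite functions by real ones without affecting
  convergence to 0; where the truncated values are below 1 they are the original ones.\<close>

lemma nn_tendsto_0_AE_subseq_ennreal:
  fixes f :: "nat \<Rightarrow> 'a \<Rightarrow> ennreal"
  assumes [measurable]: "\<And>n. f n \<in> borel_measurable M"
    and lim: "(\<lambda>n. \<integral>\<^sup>+x. f n x \<partial>M) \<longlonglongrightarrow> 0"
  shows "\<exists>r::nat\<Rightarrow>nat. strict_mono r \<and> (AE x in M. (\<lambda>n. f (r n) x) \<longlonglongrightarrow> 0)"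
proof -
  define v where "v n x = enn2real (min 1 (f n x))" for n x
  have v: "ennreal (v n x) = min 1 (f n x)" for n x
  proof -
    have "min 1 (f n x) < top" by (simp add: min_less_iff_disj)
    then show ?thesis unfolding v_def by (rule ennreal_enn2real)
  qed
  have v0: "(\<lambda>n. \<integral>\<^sup>+x. ennreal (norm (v n x)) \<partial>M) \<longlonglongrightarrow> 0"
  proof (rule tendsto_sandwich[OF _ _ tendsto_const lim])
    have "norm (v n x) = v n x" for n x by (simp add: v_def)
    then show "\<forall>\<^sub>F n in sequentially. (\<integral>\<^sup>+x. ennreal (norm (v n x)) \<partial>M) \<le> (\<integral>\<^sup>+x. f n x \<partial>M)"
      by (intro always_eventually allI nn_integral_mono) (simp add: v)
  qed simp
  have vm: "v n \<in> borel_measurable M" for n unfolding v_def by measurable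
  obtain r where r: "strict_mono (r::nat\<Rightarrow>nat)" "AE x in M. (\<lambda>n. v (r n) x) \<longlonglongrightarrow> 0"
    using nn_tendsto_0_AE_subseq[of v M, OF vm v0] by (elim exE conjE)
  from r(2) have "AE x in M. (\<lambda>n. f (r n) x) \<longlonglongrightarrow> 0"
  proof eventually_elim
    case (elim x)
    then have 1: "(\<lambda>n. ennreal (v (r n) x)) \<longlonglongrightarrow> ennreal 0" by (rule tendsto_ennrealI)
    have "\<forall>\<^sub>F n in sequentially. v (r n) x < 1" using elim by (rule order_tendstoD) simp
    then have "\<forall>\<^sub>F n in sequentially. ennreal (v (r n) x) = f (r n) x"
    proof eventually_elim
      case (elim n)
      then have "ennreal (v (r n) x) < ennreal 1" by (intro ennreal_lessI) auto
      then have "min 1 (f (r n) x) < 1" by (simp only: v ennreal_1)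
      then show ?case unfolding v by (simp add: min_def split: if_splits)
    qed
    with 1 show ?case by (simp add: Lim_transform_eventually)
  qed
  with r(1) show ?thesis by blast
qed

text \<open>The mollifier centred at a point of \<Omega> is itself a test function once its radius
  is small, so the mollifications of \<open>h\<close> eventually vanish there, while along a
  subsequence they converge to \<open>h\<close> almost everywhere.\<close>

lemma fundamental_lemma:
  fixes h :: "'a::euclidean_space \<Rightarrow> real"
  assumes h: "integrable lborel h" and \<Omega>: "open \<Omega>"
    and z: "\<And>\<phi>. test_function \<Omega> \<phi> \<Longrightarrow> (LINT x|lborel. h x * \<phi> x) = 0"
  shows "AE x in lborel. x \<in> \<Omega> \<longrightarrow> h x = 0"
proof -
  have [measurable]: "h \<in> borel_measurable borel" using h by (auto dest: borel_measurable_integrable)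
  define \<rho> where "\<rho> n = 1 / real (Suc n)" for n
  have \<rho>: "\<rho> n > 0" "\<rho> \<longlonglongrightarrow> 0" for n
    using LIMSEQ_inverse_real_of_nat unfolding \<rho>_def by (simp_all only: inverse_eq_divide) simp
  obtain r where r: "strict_mono (r::nat\<Rightarrow>nat)" "AE x in lborel. (\<lambda>n. mollify (\<rho> (r n)) h x - h x) \<longlonglongrightarrow> 0"
    using nn_tendsto_0_AE_subseq[OF _ mollify_L1_tendsto[OF h \<rho>]] by auto
  from r(2) show ?thesis
  proof eventually_elim
    case (elim x)
    show ?case
    proof
      assume "x \<in> \<Omega>"
      then obtain e where e: "e > 0" "cball x e \<subseteq> \<Omega>" using \<Omega> open_contains_cball by blast
      have "\<forall>\<^sub>F n in sequentially. \<rho> (r n) < e"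
        using LIMSEQ_subseq_LIMSEQ[OF \<rho>(2) r(1)] e(1) by (intro order_tendstoD) (auto simp: o_def)
      then have "\<forall>\<^sub>F n in sequentially. mollify (\<rho> (r n)) h x - h x = - h x"
      proof eventually_elim
        case (elim n)
        then have "cball x (\<rho> (r n)) \<subseteq> \<Omega>" using e(2) by (force simp: subset_iff)
        from z[OF test_function_moll(1)[OF \<rho>(1) this]] show ?case by (simp add: mollify_def mult.commute)
      qed
      with elim have "(\<lambda>n. - h x) \<longlonglongrightarrow> (0::real)" by (rule Lim_transform_eventually)
      then show "h x = 0" by (simp add: LIMSEQ_const_iff)
    qed
  qed
qed

text \<open>The fundamental theorem of calculus for the mollified function along a curve. Instead of
  differentiating under the integral, the theorem is applied to the kernel along the curve for each
  fixed \<open>y\<close>, and Fubini exchanges \<open>s\<close> and \<open>y\<close>. The whole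
  r-neighbourhood of the curve has to lie in \<Omega>, so that the kernels are admissible test
  functions.\<close>

lemma mollify_segment:
  fixes u :: "'a::euclidean_space \<Rightarrow> real" and g :: "'a \<Rightarrow> 'a" and w w' :: "real \<Rightarrow> 'a"
  assumes u: "integrable lborel u" and g: "integrable lborel g"
    and weak: "\<And>\<phi> i. test_function \<Omega> \<phi> \<Longrightarrow> i \<in> Basis \<Longrightarrow>
        (LINT x|lborel. u x * frechet_derivative \<phi> (at x) i) = - (LINT x|lborel. (g x \<bullet> i) * \<phi> x)"
    and r: "r > 0" and sub: "\<And>s. s \<in> {0..1} \<Longrightarrow> cball (w s) r \<subseteq> \<Omega>"
    and w: "\<And>s. (w has_vector_derivative w' s) (at s)" and w': "continuous_on UNIV w'"
  shows "ennreal \<bar>mollify r u (w 1) - mollify r u (w 0)\<bar>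
     \<le> (\<integral>\<^sup>+s. ennreal (norm (mollify r g (w s)) * norm (w' s)) * indicator {0..1} s \<partial>lborel)"
proof -
  have cw: "continuous_on UNIV w"
    using w by (auto intro!: continuous_at_imp_continuous_on has_vector_derivative_continuous)
  have [measurable]: "u \<in> borel_measurable borel" "g \<in> borel_measurable borel" 
    "w \<in> borel_measurable borel" "w' \<in> borel_measurable borel"
    using u g cw w' by (auto dest: borel_measurable_integrable intro: borel_measurable_continuous_onI)
  have [measurable]: "(\<lambda>(x::'a, h::'a). moll' r x h) \<in> borel_measurable (borel \<Otimes>\<^sub>M borel)"
    unfolding borel_prod case_prod_unfold
    by (intro borel_measurable_continuous_onI moll'_continuous continuous_intros)
  obtain M where M: "\<And>x h::'a. norm h \<le> 1 \<Longrightarrow> \<bar>moll' r x h\<bar> \<le> M" using moll'_bounded[OF r] by blast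
  have Mb: "\<bar>moll' r x h\<bar> \<le> M * norm h" for x h :: 'a
  proof (cases "h = 0")
    case False
    have "moll' r x h = norm h * moll' r x (h /\<^sub>R norm h)"
      using linear_scale[OF moll'_linear[of r x], of "norm h" "h /\<^sub>R norm h"] False by simp
    then show ?thesis
      using M[of "h /\<^sub>R norm h" x] False by (simp add: abs_mult mult.commute)
  qed (simp add: linear_0[OF moll'_linear])
  have ftc: "(LINT s|lborel. indicator {0..1} s *\<^sub>R moll' r (w s - y) (w' s)) = moll r (w 1 - y) - moll r (w 0 - y)" for y
  proof (rule integral_FTC_Icc)
    fix s :: real
    have "((\<lambda>s. w s - y) has_vector_derivative w' s) (at s within {0..1})"
      using w[of s] by (auto intro!: derivative_eq_intros intro: has_vector_derivative_at_within)
    from vector_derivative_diff_chain_within[OF this has_derivative_at_withinI[OF moll_has_derivative]]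
    show "((\<lambda>s. moll r (w s - y)) has_vector_derivative moll' r (w s - y) (w' s)) (at s within {0..1})"
      by (simp add: o_def)
  qed (auto intro!: moll'_continuous continuous_intros continuous_on_subset[OF cw] continuous_on_subset[OF w'])
  define F where "F s y = indicator {0..1} s *\<^sub>R (moll' r (w s - y) (w' s) * u y)" for s y
  have Fm [measurable]: "case_prod F \<in> borel_measurable (lborel \<Otimes>\<^sub>M lborel)"
    unfolding F_def by measurable
  have "compact ((\<lambda>s. norm (w' s)) ` {0..1})"
    by (intro compact_continuous_image continuous_intros continuous_on_subset[OF w']) auto
  then obtain B where B: "\<And>s. s \<in> {0..1} \<Longrightarrow> norm (w' s) \<le> B"
    using compact_imp_bounded by (force simp: bounded_iff)
  have M0: "M \<ge> 0" using M[of 0 0] by simp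
  \<comment> \<open>Justifies Fubini: the kernel derivative is bounded by \<open>M\<close> times the
    speed, the speed by \<open>B\<close> on the unit interval, and \<open>u\<close> is
    integrable.\<close>
  have int: "integrable (lborel \<Otimes>\<^sub>M lborel) (case_prod F)"
  proof (rule integrableI_bounded)
    have "(\<integral>\<^sup>+p. ennreal (norm (case_prod F p)) \<partial>(lborel \<Otimes>\<^sub>M lborel)) = (\<integral>\<^sup>+s. (\<integral>\<^sup>+y. ennreal (norm (F s y)) \<partial>lborel) \<partial>lborel)"
      by (subst lborel.nn_integral_fst[symmetric]) auto
    also have "\<dots> \<le> (\<integral>\<^sup>+s. (\<integral>\<^sup>+y. indicator {0..1} (s::real) * ennreal (M * B) * ennreal (norm (u y)) \<partial>lborel) \<partial>lborel)"
    proof (rule nn_integral_mono, rule nn_integral_mono)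
      fix s y
      have "\<bar>moll' r (w s - y) (w' s)\<bar> * \<bar>u y\<bar> \<le> M * B * \<bar>u y\<bar>" if "s \<in> {0..1}"
        using Mb[of "w s - y" "w' s"] mult_left_mono[OF B[OF that] M0] by (intro mult_right_mono) auto
      moreover have "B \<ge> 0" using order_trans[OF norm_ge_zero B[of 0]] by simp
      ultimately show "ennreal (norm (F s y)) \<le> indicator {0..1} s * ennreal (M * B) * ennreal (norm (u y))"
        using M0 by (auto simp: F_def abs_mult ennreal_mult[symmetric] indicator_def intro!: ennreal_leI)
    qed
    also have "\<dots> = ennreal (M * B) * (\<integral>\<^sup>+y. ennreal (norm (u y)) \<partial>lborel)"
      by (simp add: nn_integral_cmult nn_integral_multc)
    also have "\<dots> < \<infinity>" using u by (simp add: integrable_iff_bounded ennreal_mult_less_top)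
    finally show "(\<integral>\<^sup>+p. ennreal (norm (case_prod F p)) \<partial>(lborel \<Otimes>\<^sub>M lborel)) < \<infinity>" .
  qed (rule Fm)
  have inner: "(LINT y|lborel. F s y) = indicator {0..1} s *\<^sub>R (mollify r g (w s) \<bullet> w' s)" for s
  proof (cases "s \<in> {0..1}")
    case True
    \<comment> \<open>Here the weak gradient enters, tested with the kernel centred at
      \<open>w s\<close>. The two minus signs, from the weak identity and from the reflected
      argument, cancel.\<close>
    have *: "(LINT y|lborel. u y * moll' r (w s - y) i) = mollify r g (w s) \<bullet> i" if i: "i \<in> Basis" for i
    proof -
      have "(LINT y|lborel. u y * moll' r (w s - y) i) = (LINT y|lborel. (g y \<bullet> i) * moll r (w s - y))"
        using weak[OF test_function_moll(1)[OF r sub[OF True]] i]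
        unfolding test_function_moll(2)[OF r sub[OF True]] by simp
      also have "\<dots> = (LINT y|lborel. (moll r (w s - y) *\<^sub>R g y) \<bullet> i)" by (simp add: mult.commute)
      also have "\<dots> = mollify r g (w s) \<bullet> i"
        unfolding mollify_def by (rule integral_inner_left) (rule integrable_moll_mult[OF r g])
      finally show ?thesis .
    qed
    have lin: "moll' r v (w' s) = (\<Sum>i\<in>Basis. (w' s \<bullet> i) * moll' r v i)" for v
      by (subst euclidean_representation[of "w' s", symmetric])
         (simp only: linear_sum[OF moll'_linear] linear_scale[OF moll'_linear] real_scaleR_def)
    have inti: "integrable lborel (\<lambda>y. u y * moll' r (w s - y) i)" if i: "i \<in> Basis" for i
    proof (rule Bochner_Integration.integrable_bound[OF integrable_scaleR_right[OF integrable_norm[OF u], of M]])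
      show "AE y in lborel. norm (u y * moll' r (w s - y) i) \<le> norm (M *\<^sub>R norm (u y))"
      proof (rule AE_I2)
        fix y
        show "norm (u y * moll' r (w s - y) i) \<le> norm (M *\<^sub>R norm (u y))"
          using mult_right_mono[OF M[of i "w s - y"], of "\<bar>u y\<bar>"] M0 i by (simp add: abs_mult mult.commute)
      qed
    qed measurable
    have "(LINT y|lborel. F s y) = (LINT y|lborel. (\<Sum>i\<in>Basis. (w' s \<bullet> i) * (u y * moll' r (w s - y) i)))"
      using True by (intro Bochner_Integration.integral_cong) (auto simp: F_def lin sum_distrib_right sum_distrib_left mult_ac)
    also have "\<dots> = (\<Sum>i\<in>Basis. (w' s \<bullet> i) * (mollify r g (w s) \<bullet> i))"
      using inti * by (subst Bochner_Integration.integral_sum) auto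
    also have "\<dots> = mollify r g (w s) \<bullet> w' s"
      by (subst euclidean_inner[of "mollify r g (w s)"]) (simp add: mult.commute)
    finally show ?thesis using True by simp
  qed (simp add: F_def)
  have "mollify r u (w 1) - mollify r u (w 0) = (LINT y|lborel. moll r (w 1 - y) *\<^sub>R u y - moll r (w 0 - y) *\<^sub>R u y)"
    unfolding mollify_def by (intro Bochner_Integration.integral_diff[symmetric] integrable_moll_mult r u)
  also have "\<dots> = (LINT y|lborel. (LINT s|lborel. F s y))"
  proof (intro Bochner_Integration.integral_cong refl)
    fix y
    have "(LINT s|lborel. F s y) = (LINT s|lborel. (indicator {0..1} s *\<^sub>R moll' r (w s - y) (w' s)) * u y)"
      by (simp add: F_def mult.assoc)
    also have "\<dots> = (moll r (w 1 - y) - moll r (w 0 - y)) * u y" unfolding integral_mult_left_zero ftc ..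
    finally show "moll r (w 1 - y) *\<^sub>R u y - moll r (w 0 - y) *\<^sub>R u y = (LINT s|lborel. F s y)"
      by (simp add: left_diff_distrib)
  qed
  also have "\<dots> = (LINT s|lborel. (LINT y|lborel. F s y))"
    by (rule lborel_pair.Fubini_integral[OF int])
  also have "\<dots> = (LINT s|lborel. indicator {0..1} s *\<^sub>R (mollify r g (w s) \<bullet> w' s))"
    by (simp only: inner)
  finally have eq: "mollify r u (w 1) - mollify r u (w 0) = (LINT s|lborel. indicator {0..1} s *\<^sub>R (mollify r g (w s) \<bullet> w' s))" .
  have int2: "integrable lborel (\<lambda>s. indicator {0..1} s *\<^sub>R (mollify r g (w s) \<bullet> w' s))"
    using lborel_pair.integrable_fst[OF int] by (simp only: inner)
  have "ennreal \<bar>mollify r u (w 1) - mollify r u (w 0)\<bar> \<le> (\<integral>\<^sup>+s. ennreal (norm (indicator {0..1} s *\<^sub>R (mollify r g (w s) \<bullet> w' s))) \<partial>lborel)"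
    unfolding eq using integral_norm_bound_ennreal[OF int2] by simp
  also have "\<dots> \<le> (\<integral>\<^sup>+s. ennreal (norm (mollify r g (w s)) * norm (w' s)) * indicator {0..1} s \<partial>lborel)"
    by (intro nn_integral_mono) (auto simp: indicator_def Cauchy_Schwarz_ineq2 intro!: ennreal_leI)
  finally show ?thesis .
qed

section \<open>The Sobolev--Poincare inequality\<close>

text \<open>Each squaring is Cauchy-Schwarz against the constant 1, whose square integral is at most
  one because the total mass is.\<close>

lemma nn_integral_pow2_le:
  fixes h :: "'a \<Rightarrow> ennreal"
  assumes M: "emeasure M (space M) \<le> 1" and h: "h \<in> borel_measurable M"
  shows "(\<integral>\<^sup>+x. h x \<partial>M) ^ (2 ^ m) \<le> (\<integral>\<^sup>+x. h x ^ (2 ^ m) \<partial>M)"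
  using h
proof (induction m arbitrary: h)
  case 0
  then show ?case by simp
next
  case (Suc m)
  note [measurable] = Suc.prems
  have "(\<integral>\<^sup>+x. h x \<partial>M)\<^sup>2 \<le> (\<integral>\<^sup>+x. h x ^ 2 \<partial>M) * (\<integral>\<^sup>+x. 1 ^ 2 \<partial>M)"
    using Cauchy_Schwarz_nn_integral[of h M "\<lambda>_. 1"] by simp
  also have "\<dots> \<le> (\<integral>\<^sup>+x. h x ^ 2 \<partial>M) * 1"
    using M by (intro mult_left_mono) simp_all
  finally have "((\<integral>\<^sup>+x. h x \<partial>M)\<^sup>2) ^ (2 ^ m) \<le> (\<integral>\<^sup>+x. h x ^ 2 \<partial>M) ^ (2 ^ m)"
    by (intro power_mono) simp_all
  also have "\<dots> \<le> (\<integral>\<^sup>+x. (h x ^ 2) ^ (2 ^ m) \<partial>M)"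
    by (rule Suc.IH) measurable
  finally show ?case by (simp add: power_mult[symmetric])
qed

text \<open>
  Segments are parametrised by \<open>s \<mapsto> x + s\<^sup>k (z - x)\<close>: the speed \<open>s\<^sup>k\<^sup>-\<^sup>1\<close>, raised to the power \<open>2k\<close>, then
  cancels the singularity \<open>s\<^sup>-\<^sup>2\<^sup>k\<^sup>(\<^sup>k\<^sup>-\<^sup>1\<^sup>)\<close> at \<open>x\<close> exactly, and no fractional exponents occur. Later \<open>k\<close> is a
  power of 2, so that Jensen's inequality reduces to iterated Cauchy-Schwarz.
\<close>
lemma segment_kernel_bound:
  fixes G :: "'a::euclidean_space \<Rightarrow> ennreal" and U B :: "'a set" and s :: real
  assumes dim: "DIM('a) = 2" and [measurable]: "G \<in> borel_measurable borel" "U \<in> sets borel" "B \<in> sets borel"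
    and k: "k \<ge> 1" and s: "0 < s" "s \<le> 1"
  shows "(\<integral>\<^sup>+x. ((\<integral>\<^sup>+z. G (x + s ^ k *\<^sub>R (z - x)) * indicator B z \<partial>lborel) * ennreal (s ^ (k - 1))) ^ (2 * k) * indicator U x \<partial>lborel)
    \<le> (4 * emeasure lborel B ^ (k + 1) + emeasure lborel U * 4 ^ k * emeasure lborel B ^ k) * (\<integral>\<^sup>+x. G x ^ 2 \<partial>lborel) ^ k"
proof -
  define t where "t = s ^ k"
  have t: "0 < t" "t \<le> 1" using s by (auto simp: t_def power_le_one)
  define b where "b = emeasure lborel B"
  define N where "N = (\<integral>\<^sup>+x. G x ^ 2 \<partial>lborel)"
  define H where "H x = (\<integral>\<^sup>+z. G (x + t *\<^sub>R (z - x)) * indicator B z \<partial>lborel)" for x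
  have [measurable]: "H \<in> borel_measurable borel" unfolding H_def by measurable
  have ind2: "(\<integral>\<^sup>+z. (indicator B z :: ennreal)\<^sup>2 \<partial>lborel) = b"
    by (simp add: b_def indicator_def power2_eq_square flip: nn_integral_indicator)
       (auto simp: indicator_def intro!: nn_integral_cong)
  \<comment> \<open>For fixed \<open>x\<close> the map from \<open>z\<close> to x + t(z - x) scales
    by t, for fixed \<open>z\<close> the map in \<open>x\<close> scales by 1 - t; in dimension two
    the Jacobians are the squares.\<close>
  have zsub: "ennreal (t\<^sup>2) * (\<integral>\<^sup>+z. (G (x + t *\<^sub>R (z - x)))\<^sup>2 \<partial>lborel) = N" for x
    using nn_integral_lborel_affine[of "\<lambda>w. (G w)\<^sup>2" t "x - t *\<^sub>R x"] t dim
    by (simp add: N_def algebra_simps)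
  have xsub: "ennreal ((1 - t)\<^sup>2) * (\<integral>\<^sup>+x. (G (x + t *\<^sub>R (z - x)))\<^sup>2 \<partial>lborel) = N" if "t < 1" for z
    using nn_integral_lborel_affine[of "\<lambda>w. (G w)\<^sup>2" "1 - t" "t *\<^sub>R z"] that dim
    by (simp add: N_def algebra_simps)
  have cs1: "(H x)\<^sup>2 \<le> (\<integral>\<^sup>+z. (G (x + t *\<^sub>R (z - x)))\<^sup>2 \<partial>lborel) * b" for x
    unfolding H_def ind2[symmetric] by (rule Cauchy_Schwarz_nn_integral) measurable
  \<comment> \<open>The indicator of \<open>B\<close> is split into two copies: one stays with
    \<open>G\<close> and restricts the later integration in \<open>z\<close>, the other yields the
    factor \<open>b\<close>.\<close>
  have cs2: "(H x)\<^sup>2 \<le> (\<integral>\<^sup>+z. (G (x + t *\<^sub>R (z - x)))\<^sup>2 * indicator B z \<partial>lborel) * b" for x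
  proof -
    have "H x = (\<integral>\<^sup>+z. (G (x + t *\<^sub>R (z - x)) * indicator B z) * indicator B z \<partial>lborel)"
      unfolding H_def by (intro nn_integral_cong) (simp add: indicator_def)
    then have "(H x)\<^sup>2 \<le> (\<integral>\<^sup>+z. (G (x + t *\<^sub>R (z - x)) * indicator B z)\<^sup>2 \<partial>lborel) * b"
      unfolding ind2[symmetric] by (simp only:) (rule Cauchy_Schwarz_nn_integral; measurable)
    also have "(\<integral>\<^sup>+z. (G (x + t *\<^sub>R (z - x)) * indicator B z)\<^sup>2 \<partial>lborel) = (\<integral>\<^sup>+z. (G (x + t *\<^sub>R (z - x)))\<^sup>2 * indicator B z \<partial>lborel)"
      by (intro nn_integral_cong) (simp add: indicator_def)
    finally show ?thesis .
  qed
  have sup: "ennreal (t\<^sup>2) * (H x)\<^sup>2 \<le> N * b" for x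
  proof -
    have "ennreal (t\<^sup>2) * (H x)\<^sup>2 \<le> ennreal (t\<^sup>2) * ((\<integral>\<^sup>+z. (G (x + t *\<^sub>R (z - x)))\<^sup>2 \<partial>lborel) * b)"
      by (intro mult_left_mono cs1) simp
    also have "\<dots> = N * b" unfolding zsub[of x, symmetric] by (simp add: mult.assoc)
    finally show ?thesis .
  qed
  \<comment> \<open>The speed contributes s^(2k(k - 1)), which is (t^2)^(k - 1). Thus
    \<open>k - 1\<close> of the \<open>k\<close> factors H^2 are paired with t^2 and bounded
    pointwise by \<open>sup\<close>, and one factor is left for integration in
    \<open>x\<close>.\<close>
  have pow: "(H x * ennreal (s ^ (k - 1))) ^ (2 * k) = (ennreal (t\<^sup>2) * (H x)\<^sup>2) ^ (k - 1) * (H x)\<^sup>2" for x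
  proof -
    have "ennreal (s ^ (k - 1)) ^ (2 * k) = ennreal (t\<^sup>2) ^ (k - 1)"
      using s by (simp add: t_def ennreal_power power_mult[symmetric] mult_ac)
    moreover have "H x ^ (2 * k) = ((H x)\<^sup>2) ^ (k - 1) * (H x)\<^sup>2"
      using k by (simp add: power_mult power_Suc2[symmetric])
    ultimately show ?thesis by (simp add: power_mult_distrib mult_ac)
  qed
  have "(\<integral>\<^sup>+x. (H x * ennreal (s ^ (k - 1))) ^ (2 * k) * indicator U x \<partial>lborel)
    \<le> (4 * b ^ (k + 1) + emeasure lborel U * 4 ^ k * b ^ k) * N ^ k"
  \<comment> \<open>For t \<le> 1/2 the Jacobian (1 - t)^2 of the substitution in \<open>x\<close>
    is at least 1/4. For t > 1/2 the substitution in \<open>z\<close> costs at most a factor 4 and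
    bounds \<open>H\<close> pointwise, so the volume of \<open>U\<close> appears.\<close>
  proof (cases "t \<le> 1/2")
    case True
    have H2: "(\<integral>\<^sup>+x. (H x)\<^sup>2 \<partial>lborel) \<le> 4 * b * N * b"
    proof -
      have "(\<integral>\<^sup>+x. (H x)\<^sup>2 \<partial>lborel) \<le> (\<integral>\<^sup>+x. (\<integral>\<^sup>+z. (G (x + t *\<^sub>R (z - x)))\<^sup>2 * indicator B z \<partial>lborel) * b \<partial>lborel)"
        by (intro nn_integral_mono cs2)
      also have "\<dots> = (\<integral>\<^sup>+x. (\<integral>\<^sup>+z. (G (x + t *\<^sub>R (z - x)))\<^sup>2 * indicator B z \<partial>lborel) \<partial>lborel) * b"
        by (rule nn_integral_multc) measurable
      also have "(\<integral>\<^sup>+x. (\<integral>\<^sup>+z. (G (x + t *\<^sub>R (z - x)))\<^sup>2 * indicator B z \<partial>lborel) \<partial>lborel)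
         = (\<integral>\<^sup>+z. (\<integral>\<^sup>+x. (G (x + t *\<^sub>R (z - x)))\<^sup>2 * indicator B z \<partial>lborel) \<partial>lborel)"
        by (rule lborel_pair.Fubini'[symmetric]) measurable
      also have "\<dots> = (\<integral>\<^sup>+z. (\<integral>\<^sup>+x. (G (x + t *\<^sub>R (z - x)))\<^sup>2 \<partial>lborel) * indicator B z \<partial>lborel)"
        by (intro nn_integral_cong nn_integral_multc) measurable
      also have "\<dots> \<le> (\<integral>\<^sup>+z. (4 * N) * indicator B z \<partial>lborel)"
      proof (intro nn_integral_mono mult_right_mono)
        fix z :: 'a
        have "1 \<le> 4 * (1 - t)\<^sup>2" using True t power_mono[of "1/2" "1 - t" 2] by (simp add: power2_eq_square)
        then have "ennreal 1 \<le> ennreal (4 * (1 - t)\<^sup>2)" by (rule ennreal_leI)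
        then have "1 * (\<integral>\<^sup>+x. (G (x + t *\<^sub>R (z - x)))\<^sup>2 \<partial>lborel) \<le> ennreal (4 * (1 - t)\<^sup>2) * (\<integral>\<^sup>+x. (G (x + t *\<^sub>R (z - x)))\<^sup>2 \<partial>lborel)"
          by (intro mult_right_mono) simp_all
        also have "\<dots> = 4 * N" using xsub[of z] True by (simp add: ennreal_mult mult.assoc)
        finally show "(\<integral>\<^sup>+x. (G (x + t *\<^sub>R (z - x)))\<^sup>2 \<partial>lborel) \<le> 4 * N" by simp
      qed simp
      also have "\<dots> = 4 * N * b" by (simp add: nn_integral_cmult b_def)
      finally show ?thesis by (simp add: mult_ac mult_right_mono)
    qed
    have "(\<integral>\<^sup>+x. (H x * ennreal (s ^ (k - 1))) ^ (2 * k) * indicator U x \<partial>lborel) \<le> (\<integral>\<^sup>+x. (N * b) ^ (k - 1) * (H x)\<^sup>2 \<partial>lborel)"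
    proof (rule nn_integral_mono)
      fix x
      have "(H x * ennreal (s ^ (k - 1))) ^ (2 * k) * indicator U x \<le> (H x * ennreal (s ^ (k - 1))) ^ (2 * k)"
        by (simp add: indicator_def)
      also have "\<dots> \<le> (N * b) ^ (k - 1) * (H x)\<^sup>2"
        unfolding pow by (intro mult_right_mono power_mono sup) simp_all
      finally show "(H x * ennreal (s ^ (k - 1))) ^ (2 * k) * indicator U x \<le> (N * b) ^ (k - 1) * (H x)\<^sup>2" .
    qed
    also have "\<dots> = (N * b) ^ (k - 1) * (\<integral>\<^sup>+x. (H x)\<^sup>2 \<partial>lborel)"
      by (rule nn_integral_cmult) measurable
    also have "\<dots> \<le> (N * b) ^ (k - 1) * (4 * b * N * b)"
      by (intro mult_left_mono H2) simp
    also have "\<dots> = 4 * b ^ (k + 1) * N ^ k"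
    proof -
      obtain j where "k = Suc j" using k by (cases k) auto
      then show ?thesis by (simp add: power_mult_distrib mult_ac)
    qed
    also have "\<dots> \<le> (4 * b ^ (k + 1) + emeasure lborel U * 4 ^ k * b ^ k) * N ^ k"
      by (intro mult_right_mono) simp_all
    finally show ?thesis .
  next
    case False
    have *: "(H x * ennreal (s ^ (k - 1))) ^ (2 * k) \<le> (4 * N * b) ^ k" for x
    proof -
      have "1 \<le> 4 * t\<^sup>2" using False power_mono[of "1/2" t 2] by (simp add: power2_eq_square)
      then have "ennreal 1 \<le> ennreal (4 * t\<^sup>2)" by (rule ennreal_leI)
      then have "1 * (H x)\<^sup>2 \<le> ennreal (4 * t\<^sup>2) * (H x)\<^sup>2" by (intro mult_right_mono) simp_all
      also have "\<dots> = 4 * (ennreal (t\<^sup>2) * (H x)\<^sup>2)" by (simp add: ennreal_mult mult.assoc)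
      also have "\<dots> \<le> 4 * (N * b)" by (intro mult_left_mono sup) simp
      finally have 1: "(H x)\<^sup>2 \<le> 4 * N * b" by (simp add: mult.assoc)
      have "ennreal (s ^ (k - 1)) \<le> ennreal 1" using s by (intro ennreal_leI power_le_one) auto
      then have "H x * ennreal (s ^ (k - 1)) \<le> H x * 1" by (intro mult_left_mono) simp_all
      then have "(H x * ennreal (s ^ (k - 1))) ^ (2 * k) \<le> (H x) ^ (2 * k)" by (intro power_mono) simp_all
      also have "\<dots> = ((H x)\<^sup>2) ^ k" by (simp add: power_mult)
      also have "\<dots> \<le> (4 * N * b) ^ k" by (intro power_mono 1) simp
      finally show ?thesis .
    qed
    have "(\<integral>\<^sup>+x. (H x * ennreal (s ^ (k - 1))) ^ (2 * k) * indicator U x \<partial>lborel) \<le> (\<integral>\<^sup>+x. (4 * N * b) ^ k * indicator U x \<partial>lborel)"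
      by (intro nn_integral_mono mult_right_mono *) simp
    also have "\<dots> = emeasure lborel U * 4 ^ k * b ^ k * N ^ k"
      by (subst nn_integral_cmult_indicator) (simp_all add: power_mult_distrib mult_ac)
    also have "\<dots> \<le> (4 * b ^ (k + 1) + emeasure lborel U * 4 ^ k * b ^ k) * N ^ k"
      by (intro mult_right_mono) simp_all
    finally show ?thesis .
  qed
  then show ?thesis by (simp add: H_def t_def b_def N_def)
qed

text \<open>The same case distinction without powers: for small \<open>t\<close> the substitution is
  made in \<open>x\<close>, otherwise in \<open>z\<close>, and the bound is uniform in
  \<open>t\<close>. It transfers L^1 convergence of mollified gradients to their integrals along
  segments.\<close>

lemma segment_kernel_L1:
  fixes G :: "'a::euclidean_space \<Rightarrow> ennreal" and U B :: "'a set" and t :: real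
  assumes dim: "DIM('a) = 2" and [measurable]: "G \<in> borel_measurable borel" "U \<in> sets borel" "B \<in> sets borel"
    and t: "0 \<le> t" "t \<le> 1"
  shows "(\<integral>\<^sup>+x. (\<integral>\<^sup>+z. G (x + t *\<^sub>R (z - x)) * indicator B z \<partial>lborel) * indicator U x \<partial>lborel)
    \<le> 4 * (emeasure lborel U + emeasure lborel B) * (\<integral>\<^sup>+x. G x \<partial>lborel)"
proof (cases "t \<le> 1/2")
  case True
  have "(\<integral>\<^sup>+x. (\<integral>\<^sup>+z. G (x + t *\<^sub>R (z - x)) * indicator B z \<partial>lborel) * indicator U x \<partial>lborel)
      \<le> (\<integral>\<^sup>+x. (\<integral>\<^sup>+z. G (x + t *\<^sub>R (z - x)) * indicator B z \<partial>lborel) \<partial>lborel)"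
    by (intro nn_integral_mono) (simp add: indicator_def)
  also have "\<dots> = (\<integral>\<^sup>+z. (\<integral>\<^sup>+x. G (x + t *\<^sub>R (z - x)) * indicator B z \<partial>lborel) \<partial>lborel)"
    by (rule lborel_pair.Fubini'[symmetric]) measurable
  also have "\<dots> = (\<integral>\<^sup>+z. (\<integral>\<^sup>+x. G (x + t *\<^sub>R (z - x)) \<partial>lborel) * indicator B z \<partial>lborel)"
    by (intro nn_integral_cong nn_integral_multc) measurable
  also have "\<dots> \<le> (\<integral>\<^sup>+z. (4 * (\<integral>\<^sup>+x. G x \<partial>lborel)) * indicator B z \<partial>lborel)"
  proof (intro nn_integral_mono mult_right_mono)
    fix z :: 'a
    have xsub: "ennreal ((1 - t)\<^sup>2) * (\<integral>\<^sup>+x. G (x + t *\<^sub>R (z - x)) \<partial>lborel) = (\<integral>\<^sup>+x. G x \<partial>lborel)"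
      using nn_integral_lborel_affine[of "\<lambda>w. G w" "1 - t" "t *\<^sub>R z"] True dim
      by (simp add: algebra_simps)
    have "1 \<le> 4 * (1 - t)\<^sup>2" using True t power_mono[of "1/2" "1 - t" 2] by (simp add: power2_eq_square)
    then have "ennreal 1 \<le> ennreal (4 * (1 - t)\<^sup>2)" by (rule ennreal_leI)
    then have "1 * (\<integral>\<^sup>+x. G (x + t *\<^sub>R (z - x)) \<partial>lborel) \<le> ennreal (4 * (1 - t)\<^sup>2) * (\<integral>\<^sup>+x. G (x + t *\<^sub>R (z - x)) \<partial>lborel)"
      by (intro mult_right_mono) simp_all
    also have "\<dots> = 4 * (\<integral>\<^sup>+x. G x \<partial>lborel)" unfolding xsub[symmetric] by (simp add: ennreal_mult mult.assoc)
    finally show "(\<integral>\<^sup>+x. G (x + t *\<^sub>R (z - x)) \<partial>lborel) \<le> 4 * (\<integral>\<^sup>+x. G x \<partial>lborel)" by simp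
  qed simp
  also have "\<dots> = 4 * emeasure lborel B * (\<integral>\<^sup>+x. G x \<partial>lborel)"
    by (subst nn_integral_cmult_indicator) (simp_all add: mult_ac)
  also have "\<dots> \<le> 4 * (emeasure lborel U + emeasure lborel B) * (\<integral>\<^sup>+x. G x \<partial>lborel)"
    by (intro mult_right_mono mult_left_mono) simp_all
  finally show ?thesis .
next
  case False
  have "(\<integral>\<^sup>+x. (\<integral>\<^sup>+z. G (x + t *\<^sub>R (z - x)) * indicator B z \<partial>lborel) * indicator U x \<partial>lborel)
      \<le> (\<integral>\<^sup>+x. (4 * (\<integral>\<^sup>+x. G x \<partial>lborel)) * indicator U x \<partial>lborel)"
  proof (intro nn_integral_mono mult_right_mono)
    fix x :: 'a
    have zsub: "ennreal (t\<^sup>2) * (\<integral>\<^sup>+z. G (x + t *\<^sub>R (z - x)) \<partial>lborel) = (\<integral>\<^sup>+x. G x \<partial>lborel)"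
      using nn_integral_lborel_affine[of "\<lambda>w. G w" t "x - t *\<^sub>R x"] False dim
      by (simp add: algebra_simps)
    have "1 \<le> 4 * t\<^sup>2" using False power_mono[of "1/2" t 2] by (simp add: power2_eq_square)
    then have "ennreal 1 \<le> ennreal (4 * t\<^sup>2)" by (rule ennreal_leI)
    then have "1 * (\<integral>\<^sup>+z. G (x + t *\<^sub>R (z - x)) \<partial>lborel) \<le> ennreal (4 * t\<^sup>2) * (\<integral>\<^sup>+z. G (x + t *\<^sub>R (z - x)) \<partial>lborel)"
      by (intro mult_right_mono) simp_all
    also have "\<dots> = 4 * (\<integral>\<^sup>+x. G x \<partial>lborel)" unfolding zsub[symmetric] by (simp add: ennreal_mult mult.assoc)
    finally have "(\<integral>\<^sup>+z. G (x + t *\<^sub>R (z - x)) \<partial>lborel) \<le> 4 * (\<integral>\<^sup>+x. G x \<partial>lborel)" by simp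
    then show "(\<integral>\<^sup>+z. G (x + t *\<^sub>R (z - x)) * indicator B z \<partial>lborel) \<le> 4 * (\<integral>\<^sup>+x. G x \<partial>lborel)"
      by (rule order_trans[rotated]) (auto intro!: nn_integral_mono simp: indicator_def)
  qed simp
  also have "\<dots> = 4 * emeasure lborel U * (\<integral>\<^sup>+x. G x \<partial>lborel)"
    by (subst nn_integral_cmult_indicator) (simp_all add: mult_ac)
  also have "\<dots> \<le> 4 * (emeasure lborel U + emeasure lborel B) * (\<integral>\<^sup>+x. G x \<partial>lborel)"
    by (intro mult_right_mono mult_left_mono) simp_all
  finally show ?thesis .
qed

definition weak_pair :: "'a::euclidean_space set \<Rightarrow> ('a \<Rightarrow> real) \<Rightarrow> ('a \<Rightarrow> 'a) \<Rightarrow> bool" where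
  "weak_pair \<Omega> u g \<longleftrightarrow> integrable lborel u \<and> integrable lborel g \<and>
     (\<forall>\<phi>. test_function \<Omega> \<phi> \<longrightarrow> (\<forall>i\<in>Basis.
        (LINT x|lborel. u x * frechet_derivative \<phi> (at x) i) = - (LINT x|lborel. (g x \<bullet> i) * \<phi> x)))"

text \<open>For mollified functions the estimate is the fundamental theorem along the segment. As
  the radius shrinks, the left side converges almost everywhere for a subsequence. On the right, the
  error of the gradient, integrated along segments, tends to 0 in L^1 over \<open>U\<close> times
  \<open>B\<close>, hence almost everywhere along a further subsequence.\<close>

lemma weak_pair_segment:
  fixes u :: "'a::euclidean_space \<Rightarrow> real" and g :: "'a \<Rightarrow> 'a" and U B \<Omega> :: "'a set"
  assumes dim: "DIM('a) = 2" and \<Omega>: "open \<Omega>"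
    and mU [measurable]: "U \<in> sets borel" and mB [measurable]: "B \<in> sets borel"
    and fin: "emeasure lborel U < \<infinity>" "emeasure lborel B < \<infinity>"
    and D: "\<And>x z. x \<in> U \<Longrightarrow> z \<in> B \<Longrightarrow> norm (z - x) \<le> D"
    and star: "\<And>x z t. x \<in> U \<Longrightarrow> z \<in> B \<Longrightarrow> 0 \<le> t \<Longrightarrow> t \<le> 1 \<Longrightarrow> x + t *\<^sub>R (z - x) \<in> \<Omega>"
    and k: "k \<ge> 1" and wp: "weak_pair \<Omega> u g"
  shows "AE x in lborel. AE z in lborel. x \<in> U \<longrightarrow> z \<in> B \<longrightarrow> ennreal \<bar>u z - u x\<bar> \<le>
    ennreal (real k * D) * (\<integral>\<^sup>+s. ennreal (norm (g (x + s ^ k *\<^sub>R (z - x)))) * ennreal (s ^ (k - 1)) * indicator {0..1} s \<partial>lborel)"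
proof -
  have u: "integrable lborel u" and g: "integrable lborel g"
    and weak: "\<And>\<phi> i. test_function \<Omega> \<phi> \<Longrightarrow> i \<in> Basis \<Longrightarrow>
        (LINT x|lborel. u x * frechet_derivative \<phi> (at x) i) = - (LINT x|lborel. (g x \<bullet> i) * \<phi> x)"
    using wp by (auto simp: weak_pair_def)
  have [measurable]: "u \<in> borel_measurable borel" "g \<in> borel_measurable borel"
    using u g by (auto dest: borel_measurable_integrable)
  define \<rho> where "\<rho> n = 1 / real (Suc n)" for n
  have \<rho>: "\<rho> n > 0" "\<rho> \<longlonglongrightarrow> 0" for n
    using LIMSEQ_inverse_real_of_nat unfolding \<rho>_def by (simp_all only: inverse_eq_divide) simp
  obtain r1 where r1: "strict_mono (r1::nat\<Rightarrow>nat)" "AE x in lborel. (\<lambda>n. mollify (\<rho> (r1 n)) u x - u x) \<longlonglongrightarrow> 0"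
    using nn_tendsto_0_AE_subseq[OF _ mollify_L1_tendsto[OF u \<rho>]] by auto
  define \<rho>1 where "\<rho>1 n = \<rho> (r1 n)" for n
  have \<rho>1: "\<rho>1 n > 0" "\<rho>1 \<longlonglongrightarrow> 0" for n
    using \<rho>(1) LIMSEQ_subseq_LIMSEQ[OF \<rho>(2) r1(1)] by (auto simp: \<rho>1_def[abs_def] o_def)
  define q where "q n y = ennreal (norm (mollify (\<rho>1 n) g y - g y))" for n y
  have [measurable]: "q n \<in> borel_measurable borel" for n unfolding q_def by measurable
  have q0: "(\<lambda>n. \<integral>\<^sup>+y. q n y \<partial>lborel) \<longlonglongrightarrow> 0"
    unfolding q_def by (rule mollify_L1_tendsto[OF g \<rho>1])
  define I where "I s = (indicator {0..1} s :: ennreal)" for s :: real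
  have [measurable]: "I \<in> borel_measurable borel" unfolding I_def by measurable
  \<comment> \<open>Error of the mollified gradient, integrated along the segment from
    \<open>x\<close> to \<open>z\<close> and cut off to \<open>U\<close> and \<open>B\<close>. The
    weight s^(k - 1), being at most 1, is kept on the limit term only.\<close>
  define T where "T n x z = (\<integral>\<^sup>+s. q n (x + s ^ k *\<^sub>R (z - x)) * I s \<partial>lborel) * indicator B z * indicator U x" for n x z
  have Tm [measurable]: "case_prod (T n) \<in> borel_measurable (lborel \<Otimes>\<^sub>M lborel)" for n
    unfolding T_def by measurable
  have Tn: "(\<integral>\<^sup>+p. case_prod (T n) p \<partial>(lborel \<Otimes>\<^sub>M lborel)) \<le> 4 * (emeasure lborel U + emeasure lborel B) * (\<integral>\<^sup>+y. q n y \<partial>lborel)" for n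
  proof -
    have "(\<integral>\<^sup>+p. case_prod (T n) p \<partial>(lborel \<Otimes>\<^sub>M lborel)) = (\<integral>\<^sup>+x. (\<integral>\<^sup>+z. T n x z \<partial>lborel) \<partial>lborel)"
      by (subst lborel.nn_integral_fst[symmetric]) auto
    also have "\<dots> = (\<integral>\<^sup>+x. (\<integral>\<^sup>+z. (\<integral>\<^sup>+s. q n (x + s ^ k *\<^sub>R (z - x)) * indicator B z * indicator U x * I s \<partial>lborel) \<partial>lborel) \<partial>lborel)"
    proof (intro nn_integral_cong)
      fix x z :: 'a
      have "(\<integral>\<^sup>+s. q n (x + s ^ k *\<^sub>R (z - x)) * I s * (indicator B z * indicator U x) \<partial>lborel)
         = (\<integral>\<^sup>+s. q n (x + s ^ k *\<^sub>R (z - x)) * I s \<partial>lborel) * (indicator B z * indicator U x)"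
        by (rule nn_integral_multc) measurable
      then show "T n x z = (\<integral>\<^sup>+s. q n (x + s ^ k *\<^sub>R (z - x)) * indicator B z * indicator U x * I s \<partial>lborel)"
        by (simp add: T_def mult_ac)
    qed
    also have "\<dots> = (\<integral>\<^sup>+x. (\<integral>\<^sup>+s. (\<integral>\<^sup>+z. q n (x + s ^ k *\<^sub>R (z - x)) * indicator B z * indicator U x * I s \<partial>lborel) \<partial>lborel) \<partial>lborel)"
      by (intro nn_integral_cong lborel_pair.Fubini'[symmetric]) measurable
    also have "\<dots> = (\<integral>\<^sup>+s. (\<integral>\<^sup>+x. (\<integral>\<^sup>+z. q n (x + s ^ k *\<^sub>R (z - x)) * indicator B z * indicator U x * I s \<partial>lborel) \<partial>lborel) \<partial>lborel)"
      by (rule lborel_pair.Fubini'[symmetric]) measurable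
    also have "\<dots> = (\<integral>\<^sup>+s. (\<integral>\<^sup>+x. (\<integral>\<^sup>+z. q n (x + s ^ k *\<^sub>R (z - x)) * indicator B z \<partial>lborel) * indicator U x \<partial>lborel) * I s \<partial>lborel)"
      by (intro nn_integral_cong) (simp add: nn_integral_multc)
    also have "\<dots> \<le> (\<integral>\<^sup>+s. 4 * (emeasure lborel U + emeasure lborel B) * (\<integral>\<^sup>+y. q n y \<partial>lborel) * I s \<partial>lborel)"
    proof (rule nn_integral_mono)
      fix s :: real
      show "(\<integral>\<^sup>+x. (\<integral>\<^sup>+z. q n (x + s ^ k *\<^sub>R (z - x)) * indicator B z \<partial>lborel) * indicator U x \<partial>lborel) * I s
        \<le> 4 * (emeasure lborel U + emeasure lborel B) * (\<integral>\<^sup>+y. q n y \<partial>lborel) * I s"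
        using segment_kernel_L1[OF dim, of "q n" U B "s ^ k"]
        by (cases "s \<in> {0..1}") (auto simp: I_def power_le_one)
    qed
    also have "\<dots> = 4 * (emeasure lborel U + emeasure lborel B) * (\<integral>\<^sup>+y. q n y \<partial>lborel)"
      by (simp add: nn_integral_cmult I_def)
    finally show ?thesis .
  qed
  have "(\<lambda>n. 4 * (emeasure lborel U + emeasure lborel B) * (\<integral>\<^sup>+y. q n y \<partial>lborel)) \<longlonglongrightarrow> 4 * (emeasure lborel U + emeasure lborel B) * 0"
    by (intro ennreal_tendsto_cmult q0) (use fin in \<open>simp add: ennreal_mult_less_top\<close>)
  then have "(\<lambda>n. 4 * (emeasure lborel U + emeasure lborel B) * (\<integral>\<^sup>+y. q n y \<partial>lborel)) \<longlonglongrightarrow> 0" by simp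
  from tendsto_sandwich[OF _ _ tendsto_const this] Tn
  have T0: "(\<lambda>n. \<integral>\<^sup>+p. case_prod (T n) p \<partial>(lborel \<Otimes>\<^sub>M lborel)) \<longlonglongrightarrow> 0" by simp
  obtain r2 where r2: "strict_mono (r2::nat\<Rightarrow>nat)" "AE p in lborel \<Otimes>\<^sub>M lborel. (\<lambda>n. case_prod (T (r2 n)) p) \<longlonglongrightarrow> 0"
    using nn_tendsto_0_AE_subseq_ennreal[OF Tm T0] by blast
  have AT: "AE x in lborel. AE z in lborel. (\<lambda>n. T (r2 n) x z) \<longlonglongrightarrow> 0"
    using lborel_pair.AE_pair[OF r2(2)] by simp
  have Au: "AE x in lborel. (\<lambda>n. mollify (\<rho>1 (r2 n)) u x) \<longlonglongrightarrow> u x"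
    using r1(2)
  proof eventually_elim
    case (elim x)
    then have "(\<lambda>n. mollify (\<rho>1 n) u x) \<longlonglongrightarrow> u x" unfolding \<rho>1_def by (rule LIM_zero_cancel)
    from LIMSEQ_subseq_LIMSEQ[OF this r2(1)] show ?case by (simp add: o_def)
  qed
  have main: "ennreal \<bar>u z - u x\<bar> \<le>
    ennreal (real k * D) * (\<integral>\<^sup>+s. ennreal (norm (g (x + s ^ k *\<^sub>R (z - x)))) * ennreal (s ^ (k - 1)) * I s \<partial>lborel)"
    if xU: "x \<in> U" and zB: "z \<in> B" and lT: "(\<lambda>n. T (r2 n) x z) \<longlonglongrightarrow> 0"
      and lx: "(\<lambda>n. mollify (\<rho>1 (r2 n)) u x) \<longlonglongrightarrow> u x" and lz: "(\<lambda>n. mollify (\<rho>1 (r2 n)) u z) \<longlonglongrightarrow> u z" for x z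
  proof -
    define w where "w s = x + s ^ k *\<^sub>R (z - x)" for s :: real
    define w' where "w' s = (real k * s ^ (k - 1)) *\<^sub>R (z - x)" for s :: real
    have dw: "(w has_vector_derivative w' s) (at s)" for s
      unfolding w_def w'_def by (auto intro!: derivative_eq_intros)
    have cw: "continuous_on S w" for S unfolding w_def by (intro continuous_intros)
    have [measurable]: "w \<in> borel_measurable borel" using cw by (rule borel_measurable_continuous_onI)
    have w01: "w 0 = x" "w 1 = z" using k by (auto simp: w_def power_0_left)
    have "w ` {0..1} \<subseteq> \<Omega>" using star[OF xU zB] by (auto simp: w_def power_le_one)
    moreover have "compact (w ` {0..1})" by (intro compact_continuous_image cw) auto
    \<comment> \<open>The distance of the segment from the complement of \<Omega> depends on
      \<open>x\<close> and \<open>z\<close>, so the mollified estimate holds only from some index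
      on; this is enough for the limit.\<close>
    ultimately have "\<exists>\<delta>>0. \<forall>a\<in>w ` {0..1}. \<forall>b\<in>-\<Omega>. \<delta> \<le> dist a b"
      using \<Omega> by (intro separate_compact_closed) auto
    then obtain \<delta> where \<delta>: "\<delta> > 0" "\<And>s b. s \<in> {0..1} \<Longrightarrow> b \<notin> \<Omega> \<Longrightarrow> \<delta> \<le> dist (w s) b" by auto
    have D0: "D \<ge> 0" using order_trans[OF norm_ge_zero D[OF xU zB]] .
    have "\<forall>\<^sub>F n in sequentially. \<rho>1 (r2 n) < \<delta>"
      using LIMSEQ_subseq_LIMSEQ[OF \<rho>1(2) r2(1)] \<delta>(1) by (intro order_tendstoD) (auto simp: o_def)
    then have ev: "\<forall>\<^sub>F n in sequentially. ennreal \<bar>mollify (\<rho>1 (r2 n)) u z - mollify (\<rho>1 (r2 n)) u x\<bar>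
      \<le> ennreal (real k * D) * (T (r2 n) x z + (\<integral>\<^sup>+s. ennreal (norm (g (w s))) * ennreal (s ^ (k - 1)) * I s \<partial>lborel))"
    proof eventually_elim
      case (elim n)
      let ?r = "\<rho>1 (r2 n)"
      have "cball (w s) ?r \<subseteq> \<Omega>" if "s \<in> {0..1}" for s
        using \<delta>(2)[OF that] elim by force
      then have "ennreal \<bar>mollify ?r u (w 1) - mollify ?r u (w 0)\<bar>
         \<le> (\<integral>\<^sup>+s. ennreal (norm (mollify ?r g (w s)) * norm (w' s)) * indicator {0..1} s \<partial>lborel)"
        by (intro mollify_segment[OF u g weak \<rho>1(1) _ dw]) (auto simp: w'_def intro!: continuous_intros)
      also have "\<dots> \<le> (\<integral>\<^sup>+s. ennreal (real k * D) * (q (r2 n) (w s) * I s + ennreal (norm (g (w s))) * ennreal (s ^ (k - 1)) * I s) \<partial>lborel)"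
      proof (rule nn_integral_mono)
        fix s :: real
        show "ennreal (norm (mollify ?r g (w s)) * norm (w' s)) * indicator {0..1} s
          \<le> ennreal (real k * D) * (q (r2 n) (w s) * I s + ennreal (norm (g (w s))) * ennreal (s ^ (k - 1)) * I s)"
        proof (cases "s \<in> {0..1}")
          case True
          then have s: "0 \<le> s" "s \<le> 1" by auto
          let ?a = "norm (mollify ?r g (w s) - g (w s))" and ?b = "norm (g (w s))"
          have p: "0 \<le> s ^ (k - 1)" "s ^ (k - 1) \<le> 1" using s by (auto simp: power_le_one)
          have "norm (w' s) = real k * s ^ (k - 1) * norm (z - x)" using p by (simp add: w'_def)
          also have "\<dots> \<le> real k * s ^ (k - 1) * D" using D[OF xU zB] p by (intro mult_left_mono) auto
          finally have 1: "norm (w' s) \<le> real k * s ^ (k - 1) * D" .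
          have 2: "norm (mollify ?r g (w s)) \<le> ?a + ?b"
            using norm_triangle_ineq[of "mollify ?r g (w s) - g (w s)" "g (w s)"] by simp
          have "norm (mollify ?r g (w s)) * norm (w' s) \<le> (?a + ?b) * (real k * s ^ (k - 1) * D)"
            by (intro mult_mono 1 2) auto
          also have "\<dots> = (real k * D) * (?a * s ^ (k - 1) + ?b * s ^ (k - 1))" by (simp add: algebra_simps)
          also have "\<dots> \<le> (real k * D) * (?a + ?b * s ^ (k - 1))"
            using D0 p mult_left_mono[OF p(2), of ?a] by (intro mult_left_mono add_right_mono) auto
          finally have "ennreal (norm (mollify ?r g (w s)) * norm (w' s)) \<le> ennreal ((real k * D) * (?a + ?b * s ^ (k - 1)))"
            by (rule ennreal_leI)
          also have "\<dots> = ennreal (real k * D) * (ennreal ?a + ennreal ?b * ennreal (s ^ (k - 1)))"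
            using D0 p by (simp add: ennreal_mult ennreal_plus)
          finally show ?thesis using True by (simp add: I_def q_def)
        qed (simp add: I_def)
      qed
      also have "\<dots> = ennreal (real k * D) * ((\<integral>\<^sup>+s. q (r2 n) (w s) * I s \<partial>lborel) + (\<integral>\<^sup>+s. ennreal (norm (g (w s))) * ennreal (s ^ (k - 1)) * I s \<partial>lborel))"
        by (simp add: nn_integral_cmult nn_integral_add)
      also have "(\<integral>\<^sup>+s. q (r2 n) (w s) * I s \<partial>lborel) = T (r2 n) x z"
        using xU zB by (simp add: T_def w_def)
      finally show ?case by (simp add: w01)
    qed
    have "(\<lambda>n. ennreal (real k * D) * (T (r2 n) x z + (\<integral>\<^sup>+s. ennreal (norm (g (w s))) * ennreal (s ^ (k - 1)) * I s \<partial>lborel)))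
      \<longlonglongrightarrow> ennreal (real k * D) * (0 + (\<integral>\<^sup>+s. ennreal (norm (g (w s))) * ennreal (s ^ (k - 1)) * I s \<partial>lborel))"
      by (intro ennreal_tendsto_cmult tendsto_add lT tendsto_const) simp
    moreover have "(\<lambda>n. ennreal \<bar>mollify (\<rho>1 (r2 n)) u z - mollify (\<rho>1 (r2 n)) u x\<bar>) \<longlonglongrightarrow> ennreal \<bar>u z - u x\<bar>"
      by (intro tendsto_ennrealI tendsto_rabs tendsto_diff lx lz)
    ultimately show ?thesis
      using tendsto_le[OF trivial_limit_sequentially _ _ ev] by (simp add: w_def)
  qed
  show ?thesis
    using AT Au
  proof eventually_elim
    case (elim x)
    from elim(1) Au show ?case
      by eventually_elim (use main elim(2) in \<open>simp add: I_def\<close>)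
  qed
qed

text \<open>The constant \<open>c\<close> is the mean of \<open>u\<close> over \<open>B\<close>.
  Averaging the segment estimate over \<open>z\<close> in \<open>B\<close> bounds |u(x) - c| by an
  integral over \<open>s\<close> of a kernel; Jensen takes the power 2k inside that integral, and
  the kernel bound is uniform in \<open>s\<close>.\<close>

lemma star_shaped_sobolev_poincare:
  fixes U B \<Omega> :: "'a::euclidean_space set"
  assumes dim: "DIM('a) = 2" and \<Omega>: "open \<Omega>"
    and mU [measurable]: "U \<in> sets borel" and mB [measurable]: "B \<in> sets borel"
    and fin: "emeasure lborel U < \<infinity>" "emeasure lborel B < \<infinity>" "emeasure lborel B > 0"
    and D: "\<And>x z. x \<in> U \<Longrightarrow> z \<in> B \<Longrightarrow> norm (z - x) \<le> D"
    and star: "\<And>x z t. x \<in> U \<Longrightarrow> z \<in> B \<Longrightarrow> 0 \<le> t \<Longrightarrow> t \<le> 1 \<Longrightarrow> x + t *\<^sub>R (z - x) \<in> \<Omega>"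
    and k: "k = 2 ^ m"
  shows "\<exists>C. \<forall>u g. weak_pair \<Omega> u g \<longrightarrow> (\<exists>c. (\<integral>\<^sup>+x. ennreal (\<bar>u x - c\<bar> ^ (2 * k)) * indicator U x \<partial>lborel)
            \<le> ennreal C * (\<integral>\<^sup>+x. ennreal ((norm (g x))\<^sup>2) \<partial>lborel) ^ k)"
proof -
  have k1: "k \<ge> 1" using k by simp
  have k2: "2 * k = 2 ^ Suc m" using k by simp
  define b where "b = measure lborel B"
  have eb: "emeasure lborel B = ennreal b" using fin by (simp add: b_def emeasure_eq_ennreal_measure)
  have b: "b > 0" using fin(3) unfolding eb by simp
  define \<kappa> where "\<kappa> = ennreal (real k * D / b)"
  define C0 where "C0 = 4 * emeasure lborel B ^ (k + 1) + emeasure lborel U * 4 ^ k * emeasure lborel B ^ k"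
  have C0: "C0 < \<infinity>"
    using fin unfolding C0_def by (simp add: ennreal_mult_less_top power_less_top_ennreal)
  define C where "C = enn2real (\<kappa> ^ (2 * k) * C0)"
  have C: "ennreal C = \<kappa> ^ (2 * k) * C0"
    unfolding C_def using C0 by (intro ennreal_enn2real) (simp add: \<kappa>_def ennreal_mult_less_top power_less_top_ennreal)
  \<comment> \<open>Lebesgue measure on the unit interval, so that Jensen's inequality applies with
    total mass one.\<close>
  define M where "M = density lborel (indicator {0..1::real} :: real \<Rightarrow> ennreal)"
  have M1: "emeasure M (space M) \<le> 1" by (simp add: M_def emeasure_density)
  have nnM: "(\<integral>\<^sup>+s. h s \<partial>M) = (\<integral>\<^sup>+s. h s * indicator {0..1} s \<partial>lborel)" if "h \<in> borel_measurable borel" for h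
    using that by (simp add: M_def nn_integral_density mult.commute)
  have setsM [measurable_cong]: "sets M = sets borel" by (simp add: M_def)
  have "\<exists>c. (\<integral>\<^sup>+x. ennreal (\<bar>u x - c\<bar> ^ (2 * k)) * indicator U x \<partial>lborel)
            \<le> ennreal C * (\<integral>\<^sup>+x. ennreal ((norm (g x))\<^sup>2) \<partial>lborel) ^ k" if wp: "weak_pair \<Omega> u g" for u g
  proof -
    have u: "integrable lborel u" and g: "integrable lborel g" using wp by (auto simp: weak_pair_def)
    have [measurable]: "u \<in> borel_measurable borel" "g \<in> borel_measurable borel"
      using u g by (auto dest: borel_measurable_integrable)
    define G where "G x = ennreal (norm (g x))" for x
    have [measurable]: "G \<in> borel_measurable borel" unfolding G_def by measurable
    define H where "H s x = (\<integral>\<^sup>+z. G (x + s ^ k *\<^sub>R (z - x)) * indicator B z \<partial>lborel) * ennreal (s ^ (k - 1))" for s x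
    have Hm [measurable]: "case_prod H \<in> borel_measurable (borel \<Otimes>\<^sub>M borel)" unfolding H_def by measurable
    define c where "c = (LINT z|lborel. indicator B z *\<^sub>R u z) / b"
    have iB: "integrable lborel (\<lambda>z. indicator B z *\<^sub>R u z)" by (intro integrable_mult_indicator u) simp
    have iBc: "integrable lborel (\<lambda>z. indicator B z *\<^sub>R a)" for a :: real
      using fin(2) by (intro integrable_scaleR_left integrable_real_indicator) auto
    have seg: "AE x in lborel. AE z in lborel. x \<in> U \<longrightarrow> z \<in> B \<longrightarrow> ennreal \<bar>u z - u x\<bar> \<le>
        ennreal (real k * D) * (\<integral>\<^sup>+s. ennreal (norm (g (x + s ^ k *\<^sub>R (z - x)))) * ennreal (s ^ (k - 1)) * indicator {0..1} s \<partial>lborel)"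
      by (rule weak_pair_segment[OF dim \<Omega> mU mB fin(1,2) D star k1 wp])
    have bound: "AE x in lborel. x \<in> U \<longrightarrow> ennreal \<bar>u x - c\<bar> \<le> \<kappa> * (\<integral>\<^sup>+s. H s x \<partial>M)"
      using seg
    proof eventually_elim
      case (elim x)
      show ?case
      proof
        assume x: "x \<in> U"
        have "b * (u x - c) = (LINT z|lborel. indicator B z *\<^sub>R u x) - (LINT z|lborel. indicator B z *\<^sub>R u z)"
          using b fin(2) by (simp add: c_def b_def right_diff_distrib)
        also have "\<dots> = (LINT z|lborel. indicator B z *\<^sub>R (u x - u z))"
          unfolding scaleR_diff_right by (rule Bochner_Integration.integral_diff[symmetric]) (intro iB iBc)+
        finally have e: "b * (u x - c) = (LINT z|lborel. indicator B z *\<^sub>R (u x - u z))" .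
        have "integrable lborel (\<lambda>z. indicator B z *\<^sub>R (u x - u z))"
          unfolding scaleR_diff_right by (intro Bochner_Integration.integrable_diff iB iBc)
        from integral_norm_bound_ennreal[OF this] 
        have "ennreal \<bar>b * (u x - c)\<bar> \<le> (\<integral>\<^sup>+z. ennreal (norm (indicator B z *\<^sub>R (u x - u z))) \<partial>lborel)"
          unfolding e by simp
        also have "\<dots> \<le> (\<integral>\<^sup>+z. ennreal (real k * D) * ((\<integral>\<^sup>+s. G (x + s ^ k *\<^sub>R (z - x)) * ennreal (s ^ (k - 1)) * indicator {0..1} s \<partial>lborel) * indicator B z) \<partial>lborel)"
        proof (rule nn_integral_mono_AE)
          from elim show "AE z in lborel. ennreal (norm (indicator B z *\<^sub>R (u x - u z))) \<le> ennreal (real k * D) *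
            ((\<integral>\<^sup>+s. G (x + s ^ k *\<^sub>R (z - x)) * ennreal (s ^ (k - 1)) * indicator {0..1} s \<partial>lborel) * indicator B z)"
            by eventually_elim (use x in \<open>auto simp: indicator_def G_def abs_minus_commute\<close>)
        qed
        also have "\<dots> = ennreal (real k * D) * (\<integral>\<^sup>+z. ((\<integral>\<^sup>+s. G (x + s ^ k *\<^sub>R (z - x)) * ennreal (s ^ (k - 1)) * indicator {0..1} s * indicator B z \<partial>lborel)) \<partial>lborel)"
          by (simp add: nn_integral_cmult nn_integral_multc)
        also have "(\<integral>\<^sup>+z. ((\<integral>\<^sup>+s. G (x + s ^ k *\<^sub>R (z - x)) * ennreal (s ^ (k - 1)) * indicator {0..1} s * indicator B z \<partial>lborel)) \<partial>lborel)
           = (\<integral>\<^sup>+s. ((\<integral>\<^sup>+z. G (x + s ^ k *\<^sub>R (z - x)) * ennreal (s ^ (k - 1)) * indicator {0..1} s * indicator B z \<partial>lborel)) \<partial>lborel)"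
          by (rule lborel_pair.Fubini'[symmetric]) measurable
        also have "\<dots> = (\<integral>\<^sup>+s. ((\<integral>\<^sup>+z. (G (x + s ^ k *\<^sub>R (z - x)) * indicator B z) * (ennreal (s ^ (k - 1)) * indicator {0..1} s) \<partial>lborel)) \<partial>lborel)"
          by (simp add: mult_ac)
        also have "\<dots> = (\<integral>\<^sup>+s. H s x * indicator {0..1} s \<partial>lborel)"
          unfolding H_def by (intro nn_integral_cong, subst nn_integral_multc) (simp_all add: mult.assoc)
        also have "\<dots> = (\<integral>\<^sup>+s. H s x \<partial>M)" by (rule nnM[symmetric]) measurable
        finally have "ennreal \<bar>b * (u x - c)\<bar> \<le> ennreal (real k * D) * (\<integral>\<^sup>+s. H s x \<partial>M)" .
        then have "ennreal (1 / b) * ennreal \<bar>b * (u x - c)\<bar> \<le> ennreal (1 / b) * (ennreal (real k * D) * (\<integral>\<^sup>+s. H s x \<partial>M))"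
          by (rule mult_left_mono) simp
        also have "ennreal (1 / b) * ennreal \<bar>b * (u x - c)\<bar> = ennreal \<bar>u x - c\<bar>"
          using b by (simp add: ennreal_mult[symmetric] abs_mult)
        also have "ennreal (1 / b) * (ennreal (real k * D) * (\<integral>\<^sup>+s. H s x \<partial>M)) = \<kappa> * (\<integral>\<^sup>+s. H s x \<partial>M)"
          using b by (simp add: \<kappa>_def mult.assoc[symmetric] ennreal_mult'[symmetric])
        finally show "ennreal \<bar>u x - c\<bar> \<le> \<kappa> * (\<integral>\<^sup>+s. H s x \<partial>M)" .
      qed
    qed
    have "(\<integral>\<^sup>+x. ennreal (\<bar>u x - c\<bar> ^ (2 * k)) * indicator U x \<partial>lborel)
      \<le> (\<integral>\<^sup>+x. \<kappa> ^ (2 * k) * ((\<integral>\<^sup>+s. (H s x) ^ (2 * k) \<partial>M) * indicator U x) \<partial>lborel)"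
    proof (rule nn_integral_mono_AE)
      from bound show "AE x in lborel. ennreal (\<bar>u x - c\<bar> ^ (2 * k)) * indicator U x \<le> \<kappa> ^ (2 * k) * ((\<integral>\<^sup>+s. (H s x) ^ (2 * k) \<partial>M) * indicator U x)"
      proof eventually_elim
        case (elim x)
        show ?case
        proof (cases "x \<in> U")
          case True
          then have "ennreal \<bar>u x - c\<bar> ^ (2 * k) \<le> (\<kappa> * (\<integral>\<^sup>+s. H s x \<partial>M)) ^ (2 * k)"
            using elim by (intro power_mono) simp_all
          also have "\<dots> \<le> \<kappa> ^ (2 * k) * (\<integral>\<^sup>+s. (H s x) ^ (2 * k) \<partial>M)"
            unfolding power_mult_distrib k2 by (intro mult_left_mono nn_integral_pow2_le[OF M1]) simp_all
          finally show ?thesis using True by (simp add: ennreal_power)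
        qed simp
      qed
    qed
    also have "\<dots> = \<kappa> ^ (2 * k) * (\<integral>\<^sup>+x. (\<integral>\<^sup>+s. (H s x) ^ (2 * k) \<partial>M) * indicator U x \<partial>lborel)"
      by (rule nn_integral_cmult) (simp add: nnM)
    also have "(\<integral>\<^sup>+x. (\<integral>\<^sup>+s. (H s x) ^ (2 * k) \<partial>M) * indicator U x \<partial>lborel)
       = (\<integral>\<^sup>+x. (\<integral>\<^sup>+s. (H s x) ^ (2 * k) * indicator {0..1} s * indicator U x \<partial>lborel) \<partial>lborel)"
      by (simp add: nnM nn_integral_multc)
    also have "\<dots> = (\<integral>\<^sup>+s. (\<integral>\<^sup>+x. (H s x) ^ (2 * k) * indicator {0..1} s * indicator U x \<partial>lborel) \<partial>lborel)"
      by (rule lborel_pair.Fubini'[symmetric]) measurable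
    also have "\<dots> \<le> (\<integral>\<^sup>+s. C0 * (\<integral>\<^sup>+x. (G x)\<^sup>2 \<partial>lborel) ^ k * indicator {0..1} (s::real) \<partial>lborel)"
    proof (rule nn_integral_mono_AE)
      \<comment> \<open>The kernel bound requires s > 0; the endpoint is a null set.\<close>
      have "AE s in lborel. s \<noteq> (0::real)" by (rule AE_lborel_singleton)
      then show "AE s in lborel. (\<integral>\<^sup>+x. (H s x) ^ (2 * k) * indicator {0..1} s * indicator U x \<partial>lborel) \<le> C0 * (\<integral>\<^sup>+x. (G x)\<^sup>2 \<partial>lborel) ^ k * indicator {0..1} s"
      proof eventually_elim
        case (elim s)
        then show ?case
          using segment_kernel_bound[OF dim, of G U B k s] k1
          by (cases "s \<in> {0..1}") (auto simp: H_def C0_def)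
      qed
    qed
    also have "\<dots> = C0 * (\<integral>\<^sup>+x. (G x)\<^sup>2 \<partial>lborel) ^ k"
      by (subst nn_integral_cmult_indicator) simp_all
    finally have "(\<integral>\<^sup>+x. ennreal (\<bar>u x - c\<bar> ^ (2 * k)) * indicator U x \<partial>lborel) \<le> ennreal C * (\<integral>\<^sup>+x. (G x)\<^sup>2 \<partial>lborel) ^ k"
      unfolding C by (simp add: mult.assoc mult_left_mono)
    then show ?thesis by (intro exI[of _ c]) (simp add: G_def ennreal_power)
  qed
  then show ?thesis by blast
qed

text \<open>The gradient is integrated over the whole space although \<open>u\<close> is measured on
  \<open>S\<close> only, because the segments belonging to a piece may leave it. All pieces thus
  share one right-hand side. Both sides carry powers instead of roots, which keeps the inequality
  within \<open>ennreal\<close>.\<close>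

definition sobolev_poincare_on :: "'a::euclidean_space set \<Rightarrow> nat \<Rightarrow> 'a set \<Rightarrow> bool" where
  "sobolev_poincare_on \<Omega> k S \<longleftrightarrow> (\<exists>C. \<forall>u g. weak_pair \<Omega> u g \<longrightarrow>
     (\<exists>c. (\<integral>\<^sup>+x. ennreal (\<bar>u x - c\<bar> ^ (2 * k)) * indicator S x \<partial>lborel)
            \<le> ennreal C * (\<integral>\<^sup>+x. ennreal ((norm (g x))\<^sup>2) \<partial>lborel) ^ k))"

section \<open>Gluing the inequality over overlapping pieces\<close>

lemma power_abs_add_le: "\<bar>a + b\<bar> ^ n \<le> 2 ^ n * (\<bar>a\<bar> ^ n + \<bar>b\<bar> ^ n)" for a b :: real
proof -
  have "\<bar>a + b\<bar> ^ n \<le> (2 * max \<bar>a\<bar> \<bar>b\<bar>) ^ n" by (intro power_mono) auto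
  also have "\<dots> = 2 ^ n * max \<bar>a\<bar> \<bar>b\<bar> ^ n" by (simp add: power_mult_distrib)
  also have "max \<bar>a\<bar> \<bar>b\<bar> ^ n \<le> \<bar>a\<bar> ^ n + \<bar>b\<bar> ^ n" by (simp add: max_def)
  finally show ?thesis by simp
qed

lemma ennreal_power_abs_add_le:
  "ennreal (\<bar>a + b\<bar> ^ n) \<le> 2 ^ n * (ennreal (\<bar>a\<bar> ^ n) + ennreal (\<bar>b\<bar> ^ n))"
proof -
  have "ennreal (\<bar>a + b\<bar> ^ n) \<le> ennreal (2 ^ n * (\<bar>a\<bar> ^ n + \<bar>b\<bar> ^ n))"
    by (intro ennreal_leI power_abs_add_le)
  then show ?thesis by (simp add: ennreal_mult ennreal_plus ennreal_power[symmetric])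
qed

text \<open>On the overlap, which has positive measure, \<open>u\<close> is close to the constants
  of both pieces, so their difference is controlled by the gradient. The constant of
  \<open>S\<close> then serves \<open>T\<close> as well, at the cost of the measure of
  \<open>T\<close>.\<close>

lemma sobolev_poincare_on_Un:
  fixes S T \<Omega> :: "'a::euclidean_space set"
  assumes S: "sobolev_poincare_on \<Omega> k S" and T: "sobolev_poincare_on \<Omega> k T"
    and [measurable]: "S \<in> sets borel" "T \<in> sets borel" and fin: "emeasure lborel T < \<infinity>"
    and pos: "emeasure lborel (S \<inter> T) > 0"
  shows "sobolev_poincare_on \<Omega> k (S \<union> T)"
proof -
  obtain C1 where C1: "\<And>u g. weak_pair \<Omega> u g \<Longrightarrow> \<exists>c. (\<integral>\<^sup>+x. ennreal (\<bar>u x - c\<bar> ^ (2 * k)) * indicator S x \<partial>lborel)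
            \<le> ennreal C1 * (\<integral>\<^sup>+x. ennreal ((norm (g x))\<^sup>2) \<partial>lborel) ^ k"
    using S unfolding sobolev_poincare_on_def by blast
  obtain C2 where C2: "\<And>u g. weak_pair \<Omega> u g \<Longrightarrow> \<exists>c. (\<integral>\<^sup>+x. ennreal (\<bar>u x - c\<bar> ^ (2 * k)) * indicator T x \<partial>lborel)
            \<le> ennreal C2 * (\<integral>\<^sup>+x. ennreal ((norm (g x))\<^sup>2) \<partial>lborel) ^ k"
    using T unfolding sobolev_poincare_on_def by blast
  define d where "d = measure lborel (S \<inter> T)"
  have "emeasure lborel (S \<inter> T) < \<infinity>"
    using fin by (rule le_less_trans[rotated]) (intro emeasure_mono; simp)
  then have ed: "emeasure lborel (S \<inter> T) = ennreal d" by (simp add: d_def emeasure_eq_ennreal_measure)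
  have d: "d > 0" using pos unfolding ed by simp
  define P where "P = (2::ennreal) ^ (2 * k)"
  define C where "C = ennreal C1 + P * (ennreal C2 + ennreal (1 / d) * (P * (ennreal C1 + ennreal C2)) * emeasure lborel T)"
  have "C < top" using fin by (simp add: C_def P_def ennreal_mult_less_top power_less_top_ennreal)
  then have C: "ennreal (enn2real C) = C" by simp
  have "\<exists>c. (\<integral>\<^sup>+x. ennreal (\<bar>u x - c\<bar> ^ (2 * k)) * indicator (S \<union> T) x \<partial>lborel)
            \<le> C * (\<integral>\<^sup>+x. ennreal ((norm (g x))\<^sup>2) \<partial>lborel) ^ k" if wp: "weak_pair \<Omega> u g" for u g
  proof -
    have [measurable]: "u \<in> borel_measurable borel" using wp by (auto simp: weak_pair_def dest: borel_measurable_integrable)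
    define N where "N = (\<integral>\<^sup>+x. ennreal ((norm (g x))\<^sup>2) \<partial>lborel) ^ k"
    obtain a b where a: "(\<integral>\<^sup>+x. ennreal (\<bar>u x - a\<bar> ^ (2 * k)) * indicator S x \<partial>lborel) \<le> ennreal C1 * N"
      and b: "(\<integral>\<^sup>+x. ennreal (\<bar>u x - b\<bar> ^ (2 * k)) * indicator T x \<partial>lborel) \<le> ennreal C2 * N"
      using C1[OF wp] C2[OF wp] by (auto simp: N_def)
    define e where "e = \<bar>b - a\<bar> ^ (2 * k)"
    have "ennreal e * ennreal d = (\<integral>\<^sup>+x. ennreal e * indicator (S \<inter> T) x \<partial>lborel)"
      by (subst nn_integral_cmult_indicator) (simp_all add: ed)
    also have "\<dots> \<le> (\<integral>\<^sup>+x. P * (ennreal (\<bar>u x - a\<bar> ^ (2 * k)) * indicator S x + ennreal (\<bar>u x - b\<bar> ^ (2 * k)) * indicator T x) \<partial>lborel)"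
    proof (rule nn_integral_mono)
      fix x
      have "ennreal e \<le> P * (ennreal (\<bar>u x - a\<bar> ^ (2 * k)) + ennreal (\<bar>b - u x\<bar> ^ (2 * k)))"
        using ennreal_power_abs_add_le[of "u x - a" "b - u x" "2 * k"] by (simp add: e_def P_def)
      then show "ennreal e * indicator (S \<inter> T) x \<le> P * (ennreal (\<bar>u x - a\<bar> ^ (2 * k)) * indicator S x + ennreal (\<bar>u x - b\<bar> ^ (2 * k)) * indicator T x)"
        by (simp add: indicator_def abs_minus_commute)
    qed
    also have "\<dots> = P * ((\<integral>\<^sup>+x. ennreal (\<bar>u x - a\<bar> ^ (2 * k)) * indicator S x \<partial>lborel) + (\<integral>\<^sup>+x. ennreal (\<bar>u x - b\<bar> ^ (2 * k)) * indicator T x \<partial>lborel))"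
      by (simp add: nn_integral_cmult nn_integral_add)
    also have "\<dots> \<le> P * (ennreal C1 * N + ennreal C2 * N)"
      by (intro mult_left_mono add_mono a b) simp
    finally have "ennreal (1 / d) * (ennreal e * ennreal d) \<le> ennreal (1 / d) * (P * (ennreal C1 * N + ennreal C2 * N))"
      by (rule mult_left_mono) simp
    moreover have "ennreal (1 / d) * (ennreal e * ennreal d) = ennreal e"
      using d by (simp add: e_def ennreal_mult[symmetric])
    ultimately have e: "ennreal e \<le> ennreal (1 / d) * (P * (ennreal C1 * N + ennreal C2 * N))" by simp
    have "(\<integral>\<^sup>+x. ennreal (\<bar>u x - a\<bar> ^ (2 * k)) * indicator (S \<union> T) x \<partial>lborel)
      \<le> (\<integral>\<^sup>+x. ennreal (\<bar>u x - a\<bar> ^ (2 * k)) * indicator S x + P * (ennreal (\<bar>u x - b\<bar> ^ (2 * k)) * indicator T x + ennreal e * indicator T x) \<partial>lborel)"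
    proof (rule nn_integral_mono)
      fix x
      have "ennreal (\<bar>u x - a\<bar> ^ (2 * k)) \<le> P * (ennreal (\<bar>u x - b\<bar> ^ (2 * k)) + ennreal e)"
        using ennreal_power_abs_add_le[of "u x - b" "b - a" "2 * k"] by (simp add: e_def P_def)
      then show "ennreal (\<bar>u x - a\<bar> ^ (2 * k)) * indicator (S \<union> T) x \<le>
        ennreal (\<bar>u x - a\<bar> ^ (2 * k)) * indicator S x + P * (ennreal (\<bar>u x - b\<bar> ^ (2 * k)) * indicator T x + ennreal e * indicator T x)"
        by (simp add: indicator_def)
    qed
    also have "\<dots> = (\<integral>\<^sup>+x. ennreal (\<bar>u x - a\<bar> ^ (2 * k)) * indicator S x \<partial>lborel) + P * ((\<integral>\<^sup>+x. ennreal (\<bar>u x - b\<bar> ^ (2 * k)) * indicator T x \<partial>lborel) + ennreal e * emeasure lborel T)"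
      by (simp add: nn_integral_cmult nn_integral_add)
    also have "\<dots> \<le> ennreal C1 * N + P * (ennreal C2 * N + ennreal (1 / d) * (P * (ennreal C1 * N + ennreal C2 * N)) * emeasure lborel T)"
      by (intro add_mono mult_left_mono mult_right_mono a b e) simp_all
    also have "\<dots> = C * N" by (simp add: C_def distrib_left distrib_right mult_ac)
    finally show ?thesis unfolding N_def by blast
  qed
  then show ?thesis unfolding sobolev_poincare_on_def by (intro exI[of _ "enn2real C"]) (simp add: C)
qed

lemma emeasure_open_pos:
  fixes S :: "'a::euclidean_space set"
  assumes "open S" "S \<noteq> {}" shows "emeasure lborel S > 0"
  using assms open_not_negligible[of S]
  by (auto simp: negligible_iff_null_sets null_sets_def zero_less_iff_neq_zero)

text \<open>Take a maximal subfamily whose nonempty union \<open>V\<close> satisfies the inequality.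
  A piece meeting \<open>V\<close> does so in a nonempty open set, hence with positive measure, and
  is absorbed. The pieces that miss \<open>V\<close> form an open set, which connectedness forces to
  be empty.\<close>

lemma sobolev_poincare_on_connected:
  fixes \<Omega> :: "'a::euclidean_space set"
  assumes \<Omega>: "connected \<Omega>" "bounded \<Omega>" "\<Omega> \<noteq> {}"
    and \<C>: "finite \<C>" "\<Union>\<C> = \<Omega>" "\<And>S. S \<in> \<C> \<Longrightarrow> open S" "\<And>S. S \<in> \<C> \<Longrightarrow> sobolev_poincare_on \<Omega> k S"
  shows "sobolev_poincare_on \<Omega> k \<Omega>"
proof -
  define \<A> where "\<A> = {\<F>. \<F> \<subseteq> \<C> \<and> \<Union>\<F> \<noteq> {} \<and> sobolev_poincare_on \<Omega> k (\<Union>\<F>)}"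
  have "finite \<A>" using \<C>(1) by (auto simp: \<A>_def)
  moreover obtain S where "S \<in> \<C>" "S \<noteq> {}" using \<C>(2) \<Omega>(3) by auto
  then have "{S} \<in> \<A>" using \<C>(4) by (auto simp: \<A>_def)
  ultimately obtain \<F> where \<F>: "\<F> \<in> \<A>" "\<And>\<G>. \<G> \<in> \<A> \<Longrightarrow> \<F> \<subseteq> \<G> \<Longrightarrow> \<F> = \<G>"
    using finite_has_maximal[of \<A>] by blast
  define V where "V = \<Union>\<F>"
  have V: "open V" "V \<noteq> {}" "V \<subseteq> \<Omega>" "sobolev_poincare_on \<Omega> k V"
    using \<F>(1) \<C> by (auto simp: \<A>_def V_def intro!: open_Union)
  have meet: "S \<subseteq> V" if S: "S \<in> \<C>" "S \<inter> V \<noteq> {}" for S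
  proof -
    have "sobolev_poincare_on \<Omega> k (V \<union> S)"
    proof (rule sobolev_poincare_on_Un[OF V(4) \<C>(4)[OF S(1)]])
      show "emeasure lborel S < \<infinity>"
        using bounded_subset[OF \<Omega>(2), of S] \<C>(2) S(1) by (intro emeasure_bounded_finite) auto
      show "emeasure lborel (V \<inter> S) > 0"
        using V(1) \<C>(3)[OF S(1)] S(2) by (intro emeasure_open_pos) auto
    qed (use V(1) \<C>(3)[OF S(1)] in auto)
    then have "insert S \<F> \<in> \<A>"
      using \<F>(1) S V(2) by (auto simp: \<A>_def V_def Un_commute)
    from \<F>(2)[OF this] show ?thesis by (auto simp: V_def)
  qed
  define W where "W = \<Union>{S \<in> \<C>. S \<inter> V = {}}"
  have "open W" using \<C>(3) by (auto simp: W_def)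
  moreover have "\<Omega> \<subseteq> V \<union> W"
  proof
    fix x assume "x \<in> \<Omega>"
    then obtain S where "S \<in> \<C>" "x \<in> S" using \<C>(2) by blast
    then show "x \<in> V \<union> W" using meet[of S] by (cases "S \<inter> V = {}") (auto simp: W_def)
  qed
  moreover have "V \<inter> W \<inter> \<Omega> = {}" by (auto simp: W_def)
  ultimately have "V \<inter> \<Omega> = {} \<or> W \<inter> \<Omega> = {}"
    using connectedD[OF \<Omega>(1) V(1)] by blast
  then have "\<Omega> = V" using V \<open>\<Omega> \<subseteq> V \<union> W\<close> by blast
  then show ?thesis using V(4) by simp
qed

text \<open>At a boundary point, \<open>C\<close> is a cylinder in the direction \<nu> and
  \<open>B\<close> its upper part. A segment from \<open>x\<close> to a point of \<open>B\<close>
  either starts above every boundary height within the cylinder, and then stays there, or it climbs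
  at least \<open>L\<close> times its horizontal displacement, so it cannot cross the graph, whose
  slope is at most \<open>L\<close>.\<close>

lemma lipschitz_domain_star_piece:
  fixes \<Omega> :: "'a::euclidean_space set"
  assumes \<Omega>: "lipschitz_domain \<Omega>" and p: "p \<in> closure \<Omega>"
  shows "\<exists>C B. open C \<and> p \<in> C \<and> bounded C \<and> open B \<and> B \<noteq> {} \<and> bounded B \<and>
    (\<forall>x\<in>C \<inter> \<Omega>. \<forall>z\<in>B. \<forall>t\<in>{0..1}. x + t *\<^sub>R (z - x) \<in> \<Omega>)"
proof (cases "p \<in> \<Omega>")
  case True
  then obtain e where e: "e > 0" "ball p e \<subseteq> \<Omega>" using \<Omega> unfolding lipschitz_domain_def open_contains_ball by blast
  have "x + t *\<^sub>R (z - x) \<in> \<Omega>" if "x \<in> ball p e" "z \<in> ball p e" "t \<in> {0..1}" for x z t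
  proof -
    have "(1 - t) *\<^sub>R x + t *\<^sub>R z \<in> ball p e" using that by (intro convexD[OF convex_ball]) auto
    then show ?thesis using e(2) by (auto simp: algebra_simps)
  qed
  then show ?thesis using e by (intro exI[of _ "ball p e"]) auto
next
  case False
  then have "p \<in> frontier \<Omega>" using p \<Omega> by (simp add: frontier_def interior_open lipschitz_domain_def)
  then obtain r \<nu> \<gamma> L where r: "r > 0" and \<nu>: "norm \<nu> = 1" and \<gamma>: "L-lipschitz_on UNIV \<gamma>"
    and eq: "\<Omega> \<inter> ball p r = {x \<in> ball p r. \<gamma> (x - (x \<bullet> \<nu>) *\<^sub>R \<nu>) < x \<bullet> \<nu>}"
    using \<Omega> unfolding lipschitz_domain_def by blast
  have L: "L \<ge> 0" using \<gamma> by (rule lipschitz_on_nonneg)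
  define T where "T x = x - (x \<bullet> \<nu>) *\<^sub>R \<nu>" for x
  have lip: "\<gamma> y \<le> \<gamma> x + L * norm (y - x)" for x y
    using lipschitz_onD[OF \<gamma>, of y x] by (simp add: dist_norm abs_le_iff)
  have Tlin: "T (x + t *\<^sub>R (z - x)) = T x + t *\<^sub>R (T z - T x)" for x z t
    by (simp add: T_def algebra_simps inner_simps)
  have cT: "continuous_on S T" for S unfolding T_def by (intro continuous_intros)
  have mem: "x \<in> \<Omega> \<longleftrightarrow> \<gamma> (T x) < x \<bullet> \<nu>" if "x \<in> ball p r" for x
    using eq that unfolding T_def by blast
  \<comment> \<open>Points of \<Omega> near \<open>p\<close> lie above the graph, and the inequality
    survives the limit.\<close>
  have \<gamma>p: "\<gamma> (T p) \<le> p \<bullet> \<nu>"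
  proof -
    obtain s where s: "\<And>n. s n \<in> \<Omega>" "s \<longlonglongrightarrow> p" using p unfolding closure_sequential by blast
    have "continuous_on UNIV \<gamma>" by (rule lipschitz_on_continuous_on[OF \<gamma>])
    then have "continuous_on UNIV (\<lambda>x. \<gamma> (T x))" by (rule continuous_on_compose2[OF _ cT]) auto
    then have 1: "(\<lambda>n. \<gamma> (T (s n))) \<longlonglongrightarrow> \<gamma> (T p)"
      using s(2) by (rule continuous_on_tendsto_compose) auto
    have 2: "(\<lambda>n. s n \<bullet> \<nu>) \<longlonglongrightarrow> p \<bullet> \<nu>" by (intro tendsto_intros s)
    have "\<forall>\<^sub>F n in sequentially. s n \<in> ball p r"
      using tendstoD[OF s(2) r] by (simp add: dist_commute)
    then have "\<forall>\<^sub>F n in sequentially. \<gamma> (T (s n)) \<le> s n \<bullet> \<nu>"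
      by eventually_elim (use mem s(1) in \<open>auto intro: less_imp_le\<close>)
    then show ?thesis by (rule tendsto_le[OF trivial_limit_sequentially 2 1])
  qed
  define h where "h = r / 2"
  \<comment> \<open>The horizontal radius is so small that over the cylinder the graph departs from
    its value at \<open>T p\<close> by at most r/8; adding 1 covers \<open>L = 0\<close>.\<close>
  define a where "a = r / (8 * (L + 1))"
  have a: "a > 0" "a \<le> r / 8" "L * a \<le> r / 8"
    using r L by (auto simp: a_def divide_simps mult_right_mono)
  define C where "C = {x. norm (T x - T p) < a \<and> \<bar>(x - p) \<bullet> \<nu>\<bar> < h}"
  \<comment> \<open>Heights are relative to \<open>p\<close>. A point \<open>x\<close> below height
    La has at least 2La to climb to a point above 3La, and two points of the cylinder are at
    horizontal distance at most 2a.\<close>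
  define B where "B = {x \<in> C. (x - p) \<bullet> \<nu> > 3 * (L * a)}"
  have "open C"
    unfolding C_def by (intro open_Collect_conj open_Collect_less continuous_intros cT)
  then have "open B"
    unfolding B_def by (intro open_Collect_conj open_Collect_less continuous_intros) simp
  have "p \<in> C" using a r by (simp add: C_def h_def)
  have Cball: "C \<subseteq> ball p r"
  proof
    fix x assume "x \<in> C"
    have "x - p = (T x - T p) + ((x - p) \<bullet> \<nu>) *\<^sub>R \<nu>" by (simp add: T_def algebra_simps inner_simps)
    then have "norm (x - p) \<le> norm (T x - T p) + norm (((x - p) \<bullet> \<nu>) *\<^sub>R \<nu>)" by (metis norm_triangle_ineq)
    also have "\<dots> < a + h" using \<open>x \<in> C\<close> \<nu> by (simp add: C_def)
    also have "\<dots> \<le> r" using a r by (simp add: h_def)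
    finally show "x \<in> ball p r" by (simp add: dist_norm norm_minus_commute)
  qed
  then have bdd: "bounded C" "bounded B" by (auto intro: bounded_subset[OF bounded_ball] simp: B_def)
  have "\<nu> \<bullet> \<nu> = 1" using \<nu> by (simp add: dot_square_norm)
  \<comment> \<open>The height 7r/16 lies between 3La, which is at most 6r/16, and \<open>h\<close>,
    which is 8r/16.\<close>
  then have "p + (7 / 16 * r) *\<^sub>R \<nu> \<in> B"
    using a r by (simp add: B_def C_def h_def T_def inner_simps algebra_simps)
  then have "B \<noteq> {}" by blast
  have "x + t *\<^sub>R (z - x) \<in> \<Omega>" if x: "x \<in> C" "x \<in> \<Omega>" and z: "z \<in> B" and t: "0 \<le> t" "t \<le> 1" for x z t
  proof (cases "t = 0")
    case True
    then show ?thesis using x by simp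
  next
    case False
    then have t0: "t > 0" using t by simp
    let ?w = "x + t *\<^sub>R (z - x)"
    have zC: "z \<in> C" "(z - p) \<bullet> \<nu> > 3 * (L * a)" using z by (auto simp: B_def)
    have "(1 - t) *\<^sub>R (T x - T p) + t *\<^sub>R (T z - T p) \<in> ball 0 a"
      using x(1) zC(1) t by (intro convexD[OF convex_ball]) (auto simp: C_def)
    then have w1: "norm (T ?w - T p) < a" unfolding Tlin by (simp add: algebra_simps)
    have "(1 - t) *\<^sub>R ((x - p) \<bullet> \<nu>) + t *\<^sub>R ((z - p) \<bullet> \<nu>) \<in> ball 0 h"
      using x(1) zC(1) t by (intro convexD[OF convex_ball]) (auto simp: C_def)
    then have "\<bar>(?w - p) \<bullet> \<nu>\<bar> < h" by (simp add: algebra_simps inner_simps)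
    with w1 have "?w \<in> C" by (simp add: C_def)
    then have wb: "?w \<in> ball p r" using Cball by blast
    have xg: "\<gamma> (T x) < x \<bullet> \<nu>" using mem[of x] x Cball by blast
    have La: "0 \<le> L * a" using L a by simp
    have "\<gamma> (T ?w) < ?w \<bullet> \<nu>"
    proof (cases "x \<bullet> \<nu> \<ge> p \<bullet> \<nu> + L * a")
      case True
      have "\<gamma> (T ?w) \<le> \<gamma> (T p) + L * norm (T ?w - T p)" by (rule lip)
      also have "\<dots> \<le> p \<bullet> \<nu> + L * a" using \<gamma>p w1 L by (intro add_mono mult_left_mono) auto
      also have "\<dots> < ?w \<bullet> \<nu>"
      proof -
        have "z \<bullet> \<nu> > p \<bullet> \<nu> + L * a" using zC(2) La by (simp add: inner_simps)
        then have "t * (z \<bullet> \<nu>) > t * (p \<bullet> \<nu> + L * a)" using t0 by simp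
        moreover have "(1 - t) * (x \<bullet> \<nu>) \<ge> (1 - t) * (p \<bullet> \<nu> + L * a)" using True t by (intro mult_left_mono) auto
        ultimately have "(1 - t) * (x \<bullet> \<nu>) + t * (z \<bullet> \<nu>) > (1 - t) * (p \<bullet> \<nu> + L * a) + t * (p \<bullet> \<nu> + L * a)" by linarith
        then show ?thesis by (simp add: algebra_simps inner_simps)
      qed
      finally show ?thesis .
    next
      case False
      have "norm (T z - T x) \<le> norm (T z - T p) + norm (T x - T p)"
        using norm_triangle_ineq4[of "T z - T p" "T x - T p"] by simp
      then have "norm (T z - T x) \<le> 2 * a" using x(1) zC(1) by (auto simp: C_def)
      then have "L * norm (T z - T x) \<le> 2 * (L * a)" using mult_left_mono[OF _ L] by fastforce
      also have "\<dots> \<le> z \<bullet> \<nu> - x \<bullet> \<nu>" using zC(2) False by (simp add: inner_simps)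
      finally have "t * (L * norm (T z - T x)) \<le> t * (z \<bullet> \<nu> - x \<bullet> \<nu>)" using t by (intro mult_left_mono)
      moreover have "\<gamma> (T ?w) \<le> \<gamma> (T x) + t * (L * norm (T z - T x))"
        using lip[of "T ?w" "T x"] t unfolding Tlin by (simp add: mult_ac)
      ultimately have "\<gamma> (T ?w) < x \<bullet> \<nu> + t * (z \<bullet> \<nu> - x \<bullet> \<nu>)" using xg by linarith
      then show ?thesis by (simp add: algebra_simps inner_simps)
    qed
    then show ?thesis using mem[OF wb] by simp
  qed
  then show ?thesis
    using \<open>open C\<close> \<open>p \<in> C\<close> bdd \<open>open B\<close> \<open>B \<noteq> {}\<close> by (intro exI[of _ C] exI[of _ B]) auto
qed

lemma lipschitz_domain_sobolev_poincare:
  fixes \<Omega> :: "'a::euclidean_space set"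
  assumes dim: "DIM('a) = 2" and \<Omega>: "lipschitz_domain \<Omega>" "bounded \<Omega>" and k: "k = 2 ^ m"
  shows "sobolev_poincare_on \<Omega> k \<Omega>"
proof -
  have \<Omega>': "open \<Omega>" "connected \<Omega>" "\<Omega> \<noteq> {}" using \<Omega> by (auto simp: lipschitz_domain_def)
  have "\<forall>p\<in>closure \<Omega>. \<exists>CB. open (fst CB) \<and> p \<in> fst CB \<and> bounded (fst CB) \<and> open (snd CB) \<and> snd CB \<noteq> {} \<and> bounded (snd CB) \<and>
    (\<forall>x\<in>fst CB \<inter> \<Omega>. \<forall>z\<in>snd CB. \<forall>t\<in>{0..1}. x + t *\<^sub>R (z - x) \<in> \<Omega>)"
    using lipschitz_domain_star_piece[OF \<Omega>(1)] by simp
  from bchoice[OF this] obtain CB where CB: "\<forall>p\<in>closure \<Omega>. open (fst (CB p)) \<and> p \<in> fst (CB p) \<and> bounded (fst (CB p)) \<and> open (snd (CB p)) \<and> snd (CB p) \<noteq> {} \<and> bounded (snd (CB p)) \<and>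
    (\<forall>x\<in>fst (CB p) \<inter> \<Omega>. \<forall>z\<in>snd (CB p). \<forall>t\<in>{0..1}. x + t *\<^sub>R (z - x) \<in> \<Omega>)" by (rule exE)
  have "compact (closure \<Omega>)" using \<Omega>(2) by simp
  then obtain F where F: "F \<subseteq> closure \<Omega>" "finite F" "closure \<Omega> \<subseteq> (\<Union>p\<in>F. fst (CB p))"
    using compactE_image[of "closure \<Omega>" "closure \<Omega>" "\<lambda>p. fst (CB p)"] CB by blast
  show ?thesis
  proof (rule sobolev_poincare_on_connected[OF \<Omega>'(2) \<Omega>(2) \<Omega>'(3)])
    show "finite ((\<lambda>p. fst (CB p) \<inter> \<Omega>) ` F)" using F by simp
    show "\<Union>((\<lambda>p. fst (CB p) \<inter> \<Omega>) ` F) = \<Omega>" using F(3) closure_subset[of \<Omega>] by auto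
  next
    fix S assume "S \<in> (\<lambda>p. fst (CB p) \<inter> \<Omega>) ` F"
    then obtain p where p: "p \<in> closure \<Omega>" and S: "S = fst (CB p) \<inter> \<Omega>" using F(1) by auto
    note c = bspec[OF CB p]
    show "open S" using c \<Omega>'(1) S by auto
    obtain b1 where b1: "\<And>x. x \<in> fst (CB p) \<Longrightarrow> norm x \<le> b1" using c unfolding bounded_iff by blast
    obtain b2 where b2: "\<And>x. x \<in> snd (CB p) \<Longrightarrow> norm x \<le> b2" using c unfolding bounded_iff by blast
    show "sobolev_poincare_on \<Omega> k S"
      unfolding sobolev_poincare_on_def
    proof (rule star_shaped_sobolev_poincare[OF dim \<Omega>'(1), where B = "snd (CB p)" and D = "b2 + b1" and m = m])
      fix x z assume xz: "x \<in> S" "z \<in> snd (CB p)"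
      show "norm (z - x) \<le> b2 + b1"
        using norm_triangle_ineq4[of z x] b1[of x] b2[OF xz(2)] xz(1) by (auto simp: S)
      show "x + t *\<^sub>R (z - x) \<in> \<Omega>" if "0 \<le> t" "t \<le> 1" for t
        using c xz that by (auto simp: S)
    next
      show "emeasure lborel S < \<infinity>"
        using \<Omega>(2) by (intro emeasure_bounded_finite) (auto simp: S intro: bounded_subset)
      show "emeasure lborel (snd (CB p)) < \<infinity>" using c by (intro emeasure_bounded_finite) auto
      show "emeasure lborel (snd (CB p)) > 0" using c by (intro emeasure_open_pos) auto
    qed (use c \<open>open S\<close> k in auto)
  qed
qed

section \<open>Weak gradients and the space W12\<close>

lemma Lp_2_iff: "f \<in> Lp 2 S \<longleftrightarrow> f \<in> borel_measurable (lebesgue_on S) \<and> integrable (lebesgue_on S) (\<lambda>x. (norm (f x))\<^sup>2)"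
  by (simp add: Lp_def)

lemma finite_measure_lebesgue_on_bounded:
  assumes "bounded S" "S \<in> sets lebesgue" shows "finite_measure (lebesgue_on S)"
  using bounded_set_imp_lmeasurable[OF assms] by (rule finite_measure_lebesgue_on)

lemma Lp_2_integrable:
  fixes f :: "'a::euclidean_space \<Rightarrow> 'b::euclidean_space"
  assumes f: "f \<in> Lp 2 S" and S: "bounded S" "S \<in> sets lebesgue"
  shows "integrable (lebesgue_on S) f"
proof -
  interpret finite_measure "lebesgue_on S" using finite_measure_lebesgue_on_bounded[OF S] .
  show ?thesis
  proof (rule Bochner_Integration.integrable_bound)
    show "integrable (lebesgue_on S) (\<lambda>x. 1 + (norm (f x))\<^sup>2)" using f by (simp add: Lp_2_iff)
    show "f \<in> borel_measurable (lebesgue_on S)" using f by (simp add: Lp_2_iff)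
    have "norm (f x) \<le> 1 + (norm (f x))\<^sup>2" for x
      using sum_squares_bound[of "norm (f x)" 1] by (simp add: power2_eq_square) (smt (verit) norm_ge_zero)
    then show "AE x in lebesgue_on S. norm (f x) \<le> norm (1 + (norm (f x))\<^sup>2)" by (auto simp: abs_of_nonneg add_nonneg_nonneg)
  qed
qed

text \<open>Functions on \<open>S\<close> are only Lebesgue measurable, whereas joint measurability,
  Fubini and mollification are phrased over \<open>lborel\<close>. The representative of the
  extension by zero is built coordinate by coordinate.\<close>

lemma borel_representative:
  fixes f :: "'a::euclidean_space \<Rightarrow> 'b::euclidean_space"
  assumes f: "f \<in> borel_measurable (lebesgue_on S)" and S: "S \<in> sets lebesgue"
  shows "\<exists>f'\<in>borel_measurable borel. AE x in lborel. f' x = indicator S x *\<^sub>R f x"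
proof -
  have m: "(\<lambda>x. indicator S x *\<^sub>R f x) \<in> borel_measurable lebesgue"
    using f S by (subst (asm) borel_measurable_restrict_space_iff) auto
  have "\<exists>g. g \<in> borel_measurable borel \<and> (AE x in lborel. (indicator S x *\<^sub>R f x) \<bullet> i = g x)" if "i \<in> Basis" for i :: 'b
  proof -
    have "(\<lambda>x. (indicator S x *\<^sub>R f x) \<bullet> i) \<in> borel_measurable lebesgue" using m by (rule borel_measurable_inner) simp
    from completion_ex_borel_measurable_real[OF this] show ?thesis by auto
  qed
  then have "\<forall>i\<in>(Basis::'b set). \<exists>g. g \<in> borel_measurable borel \<and> (AE x in lborel. (indicator S x *\<^sub>R f x) \<bullet> i = g x)" by blast
  from bchoice[OF this] obtain g where g: "\<forall>i\<in>(Basis::'b set). g i \<in> borel_measurable borel \<and> (AE x in lborel. (indicator S x *\<^sub>R f x) \<bullet> i = g i x)"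
    by (rule exE)
  define f' where "f' x = (\<Sum>i\<in>Basis. g i x *\<^sub>R i)" for x
  have "f' \<in> borel_measurable borel" unfolding f'_def using g by (intro borel_measurable_sum borel_measurable_scaleR) auto
  moreover have "AE x in lborel. \<forall>i\<in>(Basis::'b set). (indicator S x *\<^sub>R f x) \<bullet> i = g i x"
    using g by (intro AE_finite_allI) auto
  then have "AE x in lborel. f' x = indicator S x *\<^sub>R f x"
  proof eventually_elim
    case (elim x)
    then have "f' x = (\<Sum>i\<in>Basis. ((indicator S x *\<^sub>R f x) \<bullet> i) *\<^sub>R i)" by (simp add: f'_def)
    then show ?case by (simp only: euclidean_representation)
  qed
  ultimately show ?thesis by blast
qed

lemma lebesgue_on_integral_representative:
  fixes f f' \<psi> :: "'a::euclidean_space \<Rightarrow> real"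
  assumes f: "f \<in> borel_measurable (lebesgue_on S)" and S: "S \<in> sets lebesgue"
    and f': "f' \<in> borel_measurable borel" "AE x in lborel. f' x = indicator S x *\<^sub>R f x"
    and \<psi>: "continuous_on UNIV \<psi>"
  shows "(LINT x|lebesgue_on S. f x * \<psi> x) = (LINT x|lborel. f' x * \<psi> x)"
proof -
  have \<psi>m: "\<psi> \<in> borel_measurable borel" using \<psi> by (rule borel_measurable_continuous_onI)
  have m: "(\<lambda>x. indicator S x *\<^sub>R f x) \<in> borel_measurable lebesgue"
    using f S by (subst (asm) borel_measurable_restrict_space_iff) auto
  have ml: "f' \<in> borel_measurable lebesgue" "\<psi> \<in> borel_measurable lebesgue"
    using f' \<psi>m by (auto intro: measurable_completion)
  have "(LINT x|lebesgue_on S. f x * \<psi> x) = (LINT x|lebesgue. (indicator S x *\<^sub>R f x) * \<psi> x)"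
    using S by (subst integral_restrict_space) (auto simp: mult.assoc)
  also have "\<dots> = (LINT x|lebesgue. f' x * \<psi> x)"
  proof (rule integral_cong_AE)
    show "AE x in lebesgue. (indicator S x *\<^sub>R f x) * \<psi> x = f' x * \<psi> x"
      using AE_completion[OF f'(2)] by eventually_elim simp
  qed (intro borel_measurable_times m ml)+
  also have "\<dots> = (LINT x|lborel. f' x * \<psi> x)"
    using f' \<psi>m by (intro integral_completion) auto
  finally show ?thesis .
qed

lemma lebesgue_on_nn_integral_representative:
  fixes f f' :: "'a::euclidean_space \<Rightarrow> 'b::euclidean_space" and F :: "'b \<Rightarrow> ennreal"
  assumes S: "S \<in> sets lebesgue" and f': "AE x in lborel. f' x = indicator S x *\<^sub>R f x"
  shows "(\<integral>\<^sup>+x. F (f x) \<partial>lebesgue_on S) = (\<integral>\<^sup>+x. F (f' x) * indicator S x \<partial>lborel)"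
proof -
  have "(\<integral>\<^sup>+x. F (f x) \<partial>lebesgue_on S) = (\<integral>\<^sup>+x. F (f x) * indicator S x \<partial>lebesgue)"
    using S by (subst nn_integral_restrict_space) auto
  also have "\<dots> = (\<integral>\<^sup>+x. F (f x) * indicator S x \<partial>lborel)" by (rule nn_integral_completion)
  also have "\<dots> = (\<integral>\<^sup>+x. F (f' x) * indicator S x \<partial>lborel)"
  proof (rule nn_integral_cong_AE)
    show "AE x in lborel. F (f x) * indicator S x = F (f' x) * indicator S x"
      using f' by eventually_elim (auto simp: indicator_def)
  qed
  finally show ?thesis .
qed

lemma representative_integrable:
  fixes f f' :: "'a::euclidean_space \<Rightarrow> 'b::euclidean_space"
  assumes S: "S \<in> sets lebesgue" and f: "integrable (lebesgue_on S) f"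
    and f': "f' \<in> borel_measurable borel" "AE x in lborel. f' x = indicator S x *\<^sub>R f x"
  shows "integrable lborel f'"
proof -
  have 1: "integrable lebesgue (\<lambda>x. indicator S x *\<^sub>R f x)"
    using f S by (subst (asm) integrable_restrict_space) auto
  have "integrable lebesgue f'"
    by (rule integrable_cong_AE_imp[OF 1]) (use f' AE_completion[OF f'(2)] in \<open>auto intro: measurable_completion\<close>)
  then show ?thesis using f'(1) by (subst (asm) integrable_completion) auto
qed

lemma test_function_regular:
  assumes "test_function \<Omega> \<phi>" "i \<in> Basis"
  shows "continuous_on UNIV \<phi>" "continuous_on UNIV (\<lambda>x. frechet_derivative \<phi> (at x) i)"
proof -
  have "C_k 0 \<phi>" "C_k (Suc 0) \<phi>" using assms by (auto simp: test_function_def)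
  then show "continuous_on UNIV \<phi>" "continuous_on UNIV (\<lambda>x. frechet_derivative \<phi> (at x) i)" using assms(2) by auto
qed

lemma test_function_bounded:
  fixes \<phi> :: "'a::euclidean_space \<Rightarrow> real"
  assumes t: "test_function \<Omega> \<phi>"
  shows "\<exists>B. \<forall>x. \<bar>\<phi> x\<bar> \<le> B" and "i \<in> Basis \<Longrightarrow> \<exists>B. \<forall>x. \<bar>frechet_derivative \<phi> (at x) i\<bar> \<le> B"
proof -
  define K where "K = closure {x. \<phi> x \<noteq> 0}"
  have K: "compact K" using t by (simp add: test_function_def K_def)
  have bd: "\<exists>B. \<forall>x. \<bar>f x\<bar> \<le> B" if "continuous_on UNIV f" "\<And>x. x \<notin> K \<Longrightarrow> f x = 0" for f :: "'a \<Rightarrow> real"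
  proof -
    have "compact (f ` K)" using K that(1) by (intro compact_continuous_image continuous_on_subset[OF that(1)]) auto
    then obtain B where B: "\<And>x. x \<in> K \<Longrightarrow> \<bar>f x\<bar> \<le> B" using compact_imp_bounded by (force simp: bounded_iff)
    have "\<bar>f x\<bar> \<le> max B 0" for x using B[of x] that(2)[of x] by (cases "x \<in> K") auto
    then show ?thesis by blast
  qed
  have z: "\<phi> x = 0" if "x \<notin> K" for x using that closure_subset[of "{x. \<phi> x \<noteq> 0}"] by (auto simp: K_def)
  obtain j :: 'a where "j \<in> Basis" using nonempty_Basis by blast
  then show "\<exists>B. \<forall>x. \<bar>\<phi> x\<bar> \<le> B" using test_function_regular(1)[OF t] z by (intro bd)
  assume i: "i \<in> Basis"
  \<comment> \<open>Off its support \<phi> vanishes on an open set, so its derivative does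
    too.\<close>
  have "frechet_derivative \<phi> (at x) i = 0" if "x \<notin> K" for x
  proof -
    have "((\<lambda>x. 0) has_derivative (\<lambda>h. 0)) (at x)" by simp
    then have "(\<phi> has_derivative (\<lambda>h. 0)) (at x)"
      by (rule has_derivative_transform_within_open[of _ _ _ _ "- K"]) (use K that z in \<open>auto intro: compact_imp_closed\<close>)
    then show ?thesis using frechet_derivative_at by metis
  qed
  then show "\<exists>B. \<forall>x. \<bar>frechet_derivative \<phi> (at x) i\<bar> \<le> B" using test_function_regular(2)[OF t i] by (intro bd)
qed

lemma integrable_mult_bounded_continuous:
  fixes f \<psi> :: "'a::euclidean_space \<Rightarrow> real"
  assumes f: "integrable (lebesgue_on S) f" and \<psi>: "continuous_on UNIV \<psi>" and B: "\<And>x. \<bar>\<psi> x\<bar> \<le> B"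
  shows "integrable (lebesgue_on S) (\<lambda>x. f x * \<psi> x)"
proof (rule Bochner_Integration.integrable_bound[OF integrable_mult_right[OF integrable_norm[OF f], of B]])
  have "\<psi> \<in> borel_measurable lebesgue"
    using borel_measurable_continuous_onI[OF \<psi>] by (auto intro: measurable_completion)
  then have "\<psi> \<in> borel_measurable (lebesgue_on S)" by (rule measurable_restrict_space1)
  then show "(\<lambda>x. f x * \<psi> x) \<in> borel_measurable (lebesgue_on S)" using f by (auto dest: borel_measurable_integrable)
  show "AE x in lebesgue_on S. norm (f x * \<psi> x) \<le> norm (B * norm (f x))"
  proof (rule AE_I2)
    fix x
    have "\<bar>f x\<bar> * \<bar>\<psi> x\<bar> \<le> \<bar>f x\<bar> * B" by (intro mult_left_mono B) simp
    also have "\<dots> \<le> \<bar>B * \<bar>f x\<bar>\<bar>" by (simp add: mult.commute)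
    finally show "norm (f x * \<psi> x) \<le> norm (B * norm (f x))" by (simp add: abs_mult)
  qed
qed

lemma Lp_2_inner: "g \<in> Lp 2 S \<Longrightarrow> i \<in> Basis \<Longrightarrow> (\<lambda>x. g x \<bullet> i) \<in> Lp 2 S"
  for g :: "'a::euclidean_space \<Rightarrow> 'b::euclidean_space"
proof -
  assume g: "g \<in> Lp 2 S" and i: "i \<in> Basis"
  have m: "(\<lambda>x. g x \<bullet> i) \<in> borel_measurable (lebesgue_on S)" using g by (auto simp: Lp_2_iff intro: borel_measurable_inner)
  have "integrable (lebesgue_on S) (\<lambda>x. (norm (g x \<bullet> i))\<^sup>2)"
  proof (rule Bochner_Integration.integrable_bound[of _ "\<lambda>x. (norm (g x))\<^sup>2"])
    show "integrable (lebesgue_on S) (\<lambda>x. (norm (g x))\<^sup>2)" using g by (simp add: Lp_2_iff)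
    show "(\<lambda>x. (norm (g x \<bullet> i))\<^sup>2) \<in> borel_measurable (lebesgue_on S)" using m by simp
    have "(norm (g x \<bullet> i))\<^sup>2 \<le> (norm (g x))\<^sup>2" for x
      using Basis_le_norm[OF i, of "g x"] by (intro power_mono) simp_all
    then show "AE x in lebesgue_on S. norm ((norm (g x \<bullet> i))\<^sup>2) \<le> norm ((norm (g x))\<^sup>2)"
      by (intro AE_I2) simp
  qed
  with m show ?thesis by (simp add: Lp_2_iff)
qed

lemma Lp_2_lincomb:
  fixes f g :: "'a::euclidean_space \<Rightarrow> 'b::euclidean_space"
  assumes f: "f \<in> Lp 2 S" and g: "g \<in> Lp 2 S"
  shows "(\<lambda>x. a *\<^sub>R f x + b *\<^sub>R g x) \<in> Lp 2 S"
proof -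
  have m: "(\<lambda>x. a *\<^sub>R f x + b *\<^sub>R g x) \<in> borel_measurable (lebesgue_on S)"
    using f g unfolding Lp_2_iff by (intro borel_measurable_add borel_measurable_scaleR) auto
  have le: "(norm (a *\<^sub>R f x + b *\<^sub>R g x))\<^sup>2 \<le> 2 * a\<^sup>2 * (norm (f x))\<^sup>2 + 2 * b\<^sup>2 * (norm (g x))\<^sup>2" for x
  proof -
    have "norm (a *\<^sub>R f x + b *\<^sub>R g x) \<le> \<bar>a\<bar> * norm (f x) + \<bar>b\<bar> * norm (g x)"
      using norm_triangle_ineq[of "a *\<^sub>R f x" "b *\<^sub>R g x"] by simp
    then have "(norm (a *\<^sub>R f x + b *\<^sub>R g x))\<^sup>2 \<le> (\<bar>a\<bar> * norm (f x) + \<bar>b\<bar> * norm (g x))\<^sup>2" by (intro power_mono) auto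
    also have "\<dots> \<le> 2 * (\<bar>a\<bar> * norm (f x))\<^sup>2 + 2 * (\<bar>b\<bar> * norm (g x))\<^sup>2"
      using sum_squares_bound[of "\<bar>a\<bar> * norm (f x)" "\<bar>b\<bar> * norm (g x)"] by (simp add: power2_sum)
    finally show ?thesis by (simp add: power_mult_distrib)
  qed
  have "integrable (lebesgue_on S) (\<lambda>x. (norm (a *\<^sub>R f x + b *\<^sub>R g x))\<^sup>2)"
  proof (rule Bochner_Integration.integrable_bound)
    show "integrable (lebesgue_on S) (\<lambda>x. 2 * a\<^sup>2 * (norm (f x))\<^sup>2 + 2 * b\<^sup>2 * (norm (g x))\<^sup>2)"
      using f g by (simp add: Lp_2_iff)
    show "AE x in lebesgue_on S. norm ((norm (a *\<^sub>R f x + b *\<^sub>R g x))\<^sup>2) \<le> norm (2 * a\<^sup>2 * (norm (f x))\<^sup>2 + 2 * b\<^sup>2 * (norm (g x))\<^sup>2)"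
      using order_trans[OF le abs_ge_self] by (intro AE_I2) simp
  qed (use m in simp)
  with m show ?thesis by (simp add: Lp_2_iff)
qed

text \<open>The bridge from functions on \<Omega> to mollifiable pairs: both representatives vanish
  almost everywhere off \<Omega>, so integrals against continuous functions are unchanged.\<close>

lemma has_weak_gradient_weak_pair:
  fixes \<Omega> :: "'a::euclidean_space set"
  assumes \<Omega>: "open \<Omega>" "bounded \<Omega>" and u: "u \<in> Lp 2 \<Omega>" and g: "has_weak_gradient \<Omega> u g"
  shows "\<exists>u' g'. weak_pair \<Omega> u' g' \<and> (AE x in lborel. u' x = indicator \<Omega> x *\<^sub>R u x) \<and> (AE x in lborel. g' x = indicator \<Omega> x *\<^sub>R g x)"
proof -
  have S: "\<Omega> \<in> sets lebesgue" using \<Omega> by auto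
  have gL: "g \<in> Lp 2 \<Omega>" using g by (simp add: has_weak_gradient_def)
  obtain u' where u': "u' \<in> borel_measurable borel" "AE x in lborel. u' x = indicator \<Omega> x *\<^sub>R u x"
    using borel_representative[of u \<Omega>] u S by (auto simp: Lp_2_iff)
  obtain g' where g': "g' \<in> borel_measurable borel" "AE x in lborel. g' x = indicator \<Omega> x *\<^sub>R g x"
    using borel_representative[of g \<Omega>] gL S by (auto simp: Lp_2_iff)
  have "weak_pair \<Omega> u' g'"
    unfolding weak_pair_def
  proof (intro conjI allI impI ballI)
    show "integrable lborel u'" using representative_integrable[OF S Lp_2_integrable[OF u \<Omega>(2) S] u'] .
    show "integrable lborel g'" using representative_integrable[OF S Lp_2_integrable[OF gL \<Omega>(2) S] g'] .
    fix \<phi> and i :: 'a assume \<phi>: "test_function \<Omega> \<phi>" and i: "i \<in> Basis"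
    have "(LINT x|lborel. u' x * frechet_derivative \<phi> (at x) i) = (LINT x|lebesgue_on \<Omega>. u x * frechet_derivative \<phi> (at x) i)"
      using u by (intro lebesgue_on_integral_representative[symmetric] S u' test_function_regular(2)[OF \<phi> i]) (simp add: Lp_2_iff)
    also have "\<dots> = - (LINT x|lebesgue_on \<Omega>. (g x \<bullet> i) * \<phi> x)" using g \<phi> i by (simp add: has_weak_gradient_def)
    also have "(LINT x|lebesgue_on \<Omega>. (g x \<bullet> i) * \<phi> x) = (LINT x|lborel. (g' x \<bullet> i) * \<phi> x)"
    proof (rule lebesgue_on_integral_representative[OF _ S _ _ test_function_regular(1)[OF \<phi> i]])
      show "(\<lambda>x. g x \<bullet> i) \<in> borel_measurable (lebesgue_on \<Omega>)" using Lp_2_inner[OF gL i] by (simp add: Lp_2_iff)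
      show "(\<lambda>x. g' x \<bullet> i) \<in> borel_measurable borel" using g'(1) by simp
      show "AE x in lborel. g' x \<bullet> i = indicator \<Omega> x *\<^sub>R (g x \<bullet> i)" using g'(2) by eventually_elim simp
    qed
    finally show "(LINT x|lborel. u' x * frechet_derivative \<phi> (at x) i) = - (LINT x|lborel. (g' x \<bullet> i) * \<phi> x)" .
  qed
  with u' g' show ?thesis by blast
qed

text \<open>The representative of the gradient vanishes almost everywhere outside \<Omega>, so the
  integral over the whole space in the glued inequality is an integral over \<Omega>.\<close>

lemma sobolev_poincare:
  fixes \<Omega> :: "'a::euclidean_space set"
  assumes dim: "DIM('a) = 2" and \<Omega>: "lipschitz_domain \<Omega>" "bounded \<Omega>" and k: "k = 2 ^ m"
  shows "\<exists>C. \<forall>u g. u \<in> Lp 2 \<Omega> \<longrightarrow> has_weak_gradient \<Omega> u g \<longrightarrow> (\<exists>c.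
     (\<integral>\<^sup>+x. ennreal (\<bar>u x - c\<bar> ^ (2 * k)) \<partial>lebesgue_on \<Omega>)
       \<le> ennreal C * (\<integral>\<^sup>+x. ennreal ((norm (g x))\<^sup>2) \<partial>lebesgue_on \<Omega>) ^ k)"
proof -
  have o: "open \<Omega>" using \<Omega> by (simp add: lipschitz_domain_def)
  then have S: "\<Omega> \<in> sets lebesgue" by auto
  obtain C where C: "\<And>u g. weak_pair \<Omega> u g \<Longrightarrow> \<exists>c. (\<integral>\<^sup>+x. ennreal (\<bar>u x - c\<bar> ^ (2 * k)) * indicator \<Omega> x \<partial>lborel)
            \<le> ennreal C * (\<integral>\<^sup>+x. ennreal ((norm (g x))\<^sup>2) \<partial>lborel) ^ k"
    using lipschitz_domain_sobolev_poincare[OF assms] unfolding sobolev_poincare_on_def by blast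
  have "\<exists>c. (\<integral>\<^sup>+x. ennreal (\<bar>u x - c\<bar> ^ (2 * k)) \<partial>lebesgue_on \<Omega>)
       \<le> ennreal C * (\<integral>\<^sup>+x. ennreal ((norm (g x))\<^sup>2) \<partial>lebesgue_on \<Omega>) ^ k"
    if u: "u \<in> Lp 2 \<Omega>" and g: "has_weak_gradient \<Omega> u g" for u g
  proof -
    obtain u' g' where wp: "weak_pair \<Omega> u' g'" and u': "AE x in lborel. u' x = indicator \<Omega> x *\<^sub>R u x"
      and g': "AE x in lborel. g' x = indicator \<Omega> x *\<^sub>R g x"
      using has_weak_gradient_weak_pair[OF o \<Omega>(2) u g] by blast
    obtain c where c: "(\<integral>\<^sup>+x. ennreal (\<bar>u' x - c\<bar> ^ (2 * k)) * indicator \<Omega> x \<partial>lborel)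
            \<le> ennreal C * (\<integral>\<^sup>+x. ennreal ((norm (g' x))\<^sup>2) \<partial>lborel) ^ k" using C[OF wp] by blast
    have "(\<integral>\<^sup>+x. ennreal ((norm (g' x))\<^sup>2) \<partial>lborel) = (\<integral>\<^sup>+x. ennreal ((norm (g' x))\<^sup>2) * indicator \<Omega> x \<partial>lborel)"
    proof (rule nn_integral_cong_AE)
      show "AE x in lborel. ennreal ((norm (g' x))\<^sup>2) = ennreal ((norm (g' x))\<^sup>2) * indicator \<Omega> x"
        using g' by eventually_elim (auto simp: indicator_def)
    qed
    with c show ?thesis
      using lebesgue_on_nn_integral_representative[OF S u', of "\<lambda>y. ennreal (\<bar>y - c\<bar> ^ (2 * k))"]
        lebesgue_on_nn_integral_representative[OF S g', of "\<lambda>y. ennreal ((norm y)\<^sup>2)"]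
      by (intro exI[of _ c]) simp
  qed
  then show ?thesis by blast
qed

text \<open>Makes \<open>weak_grad\<close>, which is a choice, determined up to null sets: each
  component of the difference is orthogonal to all test functions.\<close>

lemma has_weak_gradient_unique:
  fixes \<Omega> :: "'a::euclidean_space set"
  assumes \<Omega>: "open \<Omega>" "bounded \<Omega>" and g: "has_weak_gradient \<Omega> u g" and h: "has_weak_gradient \<Omega> u h"
  shows "AE x in lebesgue_on \<Omega>. g x = h x"
proof -
  have S: "\<Omega> \<in> sets lebesgue" using \<Omega> by auto
  have L: "g \<in> Lp 2 \<Omega>" "h \<in> Lp 2 \<Omega>" using g h by (auto simp: has_weak_gradient_def)
  have "AE x in lborel. x \<in> \<Omega> \<longrightarrow> (g x - h x) \<bullet> i = 0" if i: "i \<in> Basis" for i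
  proof -
    have m: "(\<lambda>x. (g x - h x) \<bullet> i) \<in> borel_measurable (lebesgue_on \<Omega>)" using L by (auto simp: Lp_2_iff)
    have int: "integrable (lebesgue_on \<Omega>) (\<lambda>x. g x \<bullet> i)" "integrable (lebesgue_on \<Omega>) (\<lambda>x. h x \<bullet> i)"
      using L by (auto intro!: Lp_2_integrable[OF _ \<Omega>(2) S] Lp_2_inner i)
    obtain f where f: "f \<in> borel_measurable borel" "AE x in lborel. f x = indicator \<Omega> x *\<^sub>R ((g x - h x) \<bullet> i)"
      using borel_representative[OF m S] by blast
    have fi: "integrable lborel f"
      by (rule representative_integrable[OF S _ f]) (use int in \<open>simp add: inner_diff_left\<close>)
    have "AE x in lborel. x \<in> \<Omega> \<longrightarrow> f x = 0"
    proof (rule fundamental_lemma[OF fi \<Omega>(1)])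
      fix \<phi> assume \<phi>: "test_function \<Omega> \<phi>"
      obtain B where B: "\<And>x. \<bar>\<phi> x\<bar> \<le> B" using test_function_bounded(1)[OF \<phi>] by blast
      note c = test_function_regular(1)[OF \<phi> i]
      have "(LINT x|lborel. f x * \<phi> x) = (LINT x|lebesgue_on \<Omega>. ((g x - h x) \<bullet> i) * \<phi> x)"
        by (rule lebesgue_on_integral_representative[OF m S f c, symmetric])
      also have "\<dots> = (LINT x|lebesgue_on \<Omega>. (g x \<bullet> i) * \<phi> x) - (LINT x|lebesgue_on \<Omega>. (h x \<bullet> i) * \<phi> x)"
        unfolding inner_diff_left left_diff_distrib
        by (intro Bochner_Integration.integral_diff integrable_mult_bounded_continuous[OF _ c B] int)
      also have "\<dots> = 0"
      proof -
        have "- (LINT x|lebesgue_on \<Omega>. (g x \<bullet> i) * \<phi> x) = - (LINT x|lebesgue_on \<Omega>. (h x \<bullet> i) * \<phi> x)"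
        proof -
          have "(LINT x|lebesgue_on \<Omega>. u x * frechet_derivative \<phi> (at x) i) = - (LINT x|lebesgue_on \<Omega>. (g x \<bullet> i) * \<phi> x)"
            using g \<phi> i by (simp add: has_weak_gradient_def)
          moreover have "(LINT x|lebesgue_on \<Omega>. u x * frechet_derivative \<phi> (at x) i) = - (LINT x|lebesgue_on \<Omega>. (h x \<bullet> i) * \<phi> x)"
            using h \<phi> i by (simp add: has_weak_gradient_def)
          ultimately show ?thesis by simp
        qed
        then show ?thesis by simp
      qed
      finally show "(LINT x|lborel. f x * \<phi> x) = 0" .
    qed
    with f(2) show ?thesis by eventually_elim auto
  qed
  then have "AE x in lborel. \<forall>i\<in>Basis. x \<in> \<Omega> \<longrightarrow> (g x - h x) \<bullet> i = 0" by (intro AE_finite_allI) auto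
  then have "AE x in lborel. x \<in> \<Omega> \<longrightarrow> g x = h x"
    by eventually_elim (auto simp: inner_diff_left intro: euclidean_eqI)
  then show ?thesis using S by (subst AE_restrict_space_iff) (auto intro: AE_completion)
qed

lemma has_weak_gradient_lincomb:
  fixes \<Omega> :: "'a::euclidean_space set"
  assumes \<Omega>: "open \<Omega>" "bounded \<Omega>" and u: "u \<in> Lp 2 \<Omega>" "has_weak_gradient \<Omega> u g"
    and v: "v \<in> Lp 2 \<Omega>" "has_weak_gradient \<Omega> v h"
  shows "has_weak_gradient \<Omega> (\<lambda>x. a * u x + b * v x) (\<lambda>x. a *\<^sub>R g x + b *\<^sub>R h x)"
proof -
  have S: "\<Omega> \<in> sets lebesgue" using \<Omega> by auto
  have L: "g \<in> Lp 2 \<Omega>" "h \<in> Lp 2 \<Omega>" using u v by (auto simp: has_weak_gradient_def)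
  show ?thesis
    unfolding has_weak_gradient_def
  proof (intro conjI allI impI ballI)
    show "(\<lambda>x. a *\<^sub>R g x + b *\<^sub>R h x) \<in> Lp 2 \<Omega>" using L by (rule Lp_2_lincomb)
    fix \<phi> and i :: 'a assume \<phi>: "test_function \<Omega> \<phi>" and i: "i \<in> Basis"
    obtain B where B: "\<And>x. \<bar>\<phi> x\<bar> \<le> B" using test_function_bounded(1)[OF \<phi>] by blast
    obtain B' where B': "\<And>x. \<bar>frechet_derivative \<phi> (at x) i\<bar> \<le> B'" using test_function_bounded(2)[OF \<phi> i] by blast
    note c = test_function_regular[OF \<phi> i]
    let ?D = "\<lambda>x. frechet_derivative \<phi> (at x) i"
    have i1: "integrable (lebesgue_on \<Omega>) (\<lambda>x. u x * ?D x)" "integrable (lebesgue_on \<Omega>) (\<lambda>x. v x * ?D x)"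
      using u v by (auto intro!: integrable_mult_bounded_continuous[OF _ c(2) B'] Lp_2_integrable \<Omega> S)
    have i2: "integrable (lebesgue_on \<Omega>) (\<lambda>x. (g x \<bullet> i) * \<phi> x)" "integrable (lebesgue_on \<Omega>) (\<lambda>x. (h x \<bullet> i) * \<phi> x)"
      using L by (auto intro!: integrable_mult_bounded_continuous[OF _ c(1) B] Lp_2_integrable Lp_2_inner \<Omega> S i)
    have e: "(LINT x|lebesgue_on \<Omega>. u x * ?D x) = - (LINT x|lebesgue_on \<Omega>. (g x \<bullet> i) * \<phi> x)"
      "(LINT x|lebesgue_on \<Omega>. v x * ?D x) = - (LINT x|lebesgue_on \<Omega>. (h x \<bullet> i) * \<phi> x)"
      using u(2) v(2) \<phi> i by (auto simp: has_weak_gradient_def)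
    have "(LINT x|lebesgue_on \<Omega>. (a * u x + b * v x) * ?D x) = (LINT x|lebesgue_on \<Omega>. a * (u x * ?D x) + b * (v x * ?D x))"
      by (simp add: algebra_simps)
    also have "\<dots> = a * (LINT x|lebesgue_on \<Omega>. u x * ?D x) + b * (LINT x|lebesgue_on \<Omega>. v x * ?D x)"
      using i1 by simp
    also have "\<dots> = - (a * (LINT x|lebesgue_on \<Omega>. (g x \<bullet> i) * \<phi> x) + b * (LINT x|lebesgue_on \<Omega>. (h x \<bullet> i) * \<phi> x))"
      by (simp add: e)
    also have "\<dots> = - (LINT x|lebesgue_on \<Omega>. a * ((g x \<bullet> i) * \<phi> x) + b * ((h x \<bullet> i) * \<phi> x))"
      using i2 by simp
    also have "\<dots> = - (LINT x|lebesgue_on \<Omega>. ((a *\<^sub>R g x + b *\<^sub>R h x) \<bullet> i) * \<phi> x)"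
      by (simp add: algebra_simps inner_simps)
    finally show "(LINT x|lebesgue_on \<Omega>. (a * u x + b * v x) * ?D x) = - (LINT x|lebesgue_on \<Omega>. ((a *\<^sub>R g x + b *\<^sub>R h x) \<bullet> i) * \<phi> x)" .
  qed
qed

section \<open>Limits of weak gradients and completeness of L^2\<close>

lemma L2_tendsto_imp_L1_tendsto:
  fixes f :: "nat \<Rightarrow> 'a \<Rightarrow> 'b::euclidean_space"
  assumes fin: "finite_measure M" and [measurable]: "\<And>n. f n \<in> borel_measurable M"
    and lim: "(\<lambda>n. \<integral>\<^sup>+x. ennreal ((norm (f n x))\<^sup>2) \<partial>M) \<longlonglongrightarrow> 0"
  shows "(\<lambda>n. \<integral>\<^sup>+x. ennreal (norm (f n x)) \<partial>M) \<longlonglongrightarrow> 0"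
proof (rule tendsto_zero_ennreal)
  fix e :: real assume e: "e > 0"
  have ms: "emeasure M (space M) < \<infinity>" using finite_measure.emeasure_finite[OF fin] by (simp add: top.not_eq_extremum)
  have cs: "(\<integral>\<^sup>+x. ennreal (norm (f n x)) \<partial>M)\<^sup>2 \<le> emeasure M (space M) * (\<integral>\<^sup>+x. ennreal ((norm (f n x))\<^sup>2) \<partial>M)" for n
    using Cauchy_Schwarz_nn_integral[of "\<lambda>x. ennreal (norm (f n x))" M "\<lambda>_. 1"] by (simp add: ennreal_power mult.commute)
  have "(\<lambda>n. emeasure M (space M) * (\<integral>\<^sup>+x. ennreal ((norm (f n x))\<^sup>2) \<partial>M)) \<longlonglongrightarrow> emeasure M (space M) * 0"
    using ms by (intro ennreal_tendsto_cmult lim) simp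
  then have "\<forall>\<^sub>F n in sequentially. emeasure M (space M) * (\<integral>\<^sup>+x. ennreal ((norm (f n x))\<^sup>2) \<partial>M) < ennreal (e\<^sup>2)"
    by (rule order_tendstoD) (use e in simp)
  then show "\<forall>\<^sub>F n in sequentially. (\<integral>\<^sup>+x. ennreal (norm (f n x)) \<partial>M) < ennreal e"
  proof eventually_elim
    case (elim n)
    then have "(\<integral>\<^sup>+x. ennreal (norm (f n x)) \<partial>M)\<^sup>2 < (ennreal e)\<^sup>2"
      using cs[of n] e by (simp add: ennreal_power)
    then show ?case using power_mono[of "ennreal e" "\<integral>\<^sup>+x. ennreal (norm (f n x)) \<partial>M" 2] by (simp add: not_le[symmetric]) blast
  qed
qed

lemma L2_tendsto_integral:
  fixes f :: "nat \<Rightarrow> 'a::euclidean_space \<Rightarrow> real"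
  assumes S: "bounded S" "S \<in> sets lebesgue" and f: "\<And>n. f n \<in> Lp 2 S" "l \<in> Lp 2 S"
    and lim: "(\<lambda>n. \<integral>\<^sup>+x. ennreal ((norm (f n x - l x))\<^sup>2) \<partial>lebesgue_on S) \<longlonglongrightarrow> 0"
    and \<psi>: "continuous_on UNIV \<psi>" "\<And>x. \<bar>\<psi> x\<bar> \<le> B"
  shows "(\<lambda>n. LINT x|lebesgue_on S. f n x * \<psi> x) \<longlonglongrightarrow> (LINT x|lebesgue_on S. l x * \<psi> x)"
proof -
  have int: "integrable (lebesgue_on S) (f n)" "integrable (lebesgue_on S) l" for n
    using f by (auto intro: Lp_2_integrable S)
  have i2: "integrable (lebesgue_on S) (\<lambda>x. f n x * \<psi> x)" "integrable (lebesgue_on S) (\<lambda>x. l x * \<psi> x)" for n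
    using int by (auto intro!: integrable_mult_bounded_continuous \<psi>)
  have i3: "integrable (lebesgue_on S) (\<lambda>x. f n x * \<psi> x - l x * \<psi> x)" for n using i2 by (rule Bochner_Integration.integrable_diff)
  have B: "0 \<le> B" using \<psi>(2)[of 0] by simp
  have "(\<lambda>n. \<integral>\<^sup>+x. ennreal (norm (f n x - l x)) \<partial>lebesgue_on S) \<longlonglongrightarrow> 0"
    by (rule L2_tendsto_imp_L1_tendsto[OF finite_measure_lebesgue_on_bounded[OF S] _ lim])
       (use int in \<open>auto dest!: borel_measurable_integrable\<close>)
  then have l: "(\<lambda>n. ennreal B * (\<integral>\<^sup>+x. ennreal (norm (f n x - l x)) \<partial>lebesgue_on S)) \<longlonglongrightarrow> ennreal B * 0"
    by (intro ennreal_tendsto_cmult) auto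
  have le: "ennreal (norm ((LINT x|lebesgue_on S. f n x * \<psi> x) - (LINT x|lebesgue_on S. l x * \<psi> x))) \<le> ennreal B * (\<integral>\<^sup>+x. ennreal (norm (f n x - l x)) \<partial>lebesgue_on S)" for n
  proof -
    have "(LINT x|lebesgue_on S. f n x * \<psi> x) - (LINT x|lebesgue_on S. l x * \<psi> x) = (LINT x|lebesgue_on S. f n x * \<psi> x - l x * \<psi> x)"
      using i2 by simp
    then have "ennreal (norm ((LINT x|lebesgue_on S. f n x * \<psi> x) - (LINT x|lebesgue_on S. l x * \<psi> x))) \<le> (\<integral>\<^sup>+x. ennreal (norm (f n x * \<psi> x - l x * \<psi> x)) \<partial>lebesgue_on S)"
      using integral_norm_bound_ennreal[OF i3] by simp
    also have "\<dots> \<le> (\<integral>\<^sup>+x. ennreal B * ennreal (norm (f n x - l x)) \<partial>lebesgue_on S)"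
    proof (rule nn_integral_mono)
      fix x
      have "norm (f n x * \<psi> x - l x * \<psi> x) \<le> B * norm (f n x - l x)"
        using mult_left_mono[OF \<psi>(2)[of x], of "\<bar>f n x - l x\<bar>"]
        by (simp only: left_diff_distrib[symmetric] real_norm_def abs_mult mult.commute[of B] abs_ge_zero)
      then show "ennreal (norm (f n x * \<psi> x - l x * \<psi> x)) \<le> ennreal B * ennreal (norm (f n x - l x))"
        using B by (simp add: ennreal_mult[symmetric] ennreal_leI)
    qed
    also have "\<dots> = ennreal B * (\<integral>\<^sup>+x. ennreal (norm (f n x - l x)) \<partial>lebesgue_on S)"
      using int by (intro nn_integral_cmult) (auto dest!: borel_measurable_integrable)
    finally show ?thesis .
  qed
  have "(\<lambda>n. ennreal (norm ((LINT x|lebesgue_on S. f n x * \<psi> x) - (LINT x|lebesgue_on S. l x * \<psi> x)))) \<longlonglongrightarrow> ennreal 0"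
    using tendsto_sandwich[OF _ _ tendsto_const l] le by simp
  then have "(\<lambda>n. norm ((LINT x|lebesgue_on S. f n x * \<psi> x) - (LINT x|lebesgue_on S. l x * \<psi> x))) \<longlonglongrightarrow> 0"
    by (subst (asm) tendsto_ennreal_iff) auto
  then have "(\<lambda>n. (LINT x|lebesgue_on S. f n x * \<psi> x) - (LINT x|lebesgue_on S. l x * \<psi> x)) \<longlonglongrightarrow> 0"
    by (rule tendsto_norm_zero_cancel)
  then show ?thesis by (rule LIM_zero_cancel)
qed

text \<open>Only integrals against bounded continuous functions have to pass to the limit. These are
  controlled by L^1 distances and hence, on a set of finite measure, by L^2 distances.\<close>

lemma has_weak_gradient_closed:
  fixes \<Omega> :: "'a::euclidean_space set"
  assumes \<Omega>: "open \<Omega>" "bounded \<Omega>" and un: "\<And>n. un n \<in> Lp 2 \<Omega>" "\<And>n. has_weak_gradient \<Omega> (un n) (gn n)"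
    and u: "u \<in> Lp 2 \<Omega>" "(\<lambda>n. \<integral>\<^sup>+x. ennreal ((norm (un n x - u x))\<^sup>2) \<partial>lebesgue_on \<Omega>) \<longlonglongrightarrow> 0"
    and g: "g \<in> Lp 2 \<Omega>" "(\<lambda>n. \<integral>\<^sup>+x. ennreal ((norm (gn n x - g x))\<^sup>2) \<partial>lebesgue_on \<Omega>) \<longlonglongrightarrow> 0"
  shows "has_weak_gradient \<Omega> u g"
  unfolding has_weak_gradient_def
proof (intro conjI allI impI ballI)
  have S: "\<Omega> \<in> sets lebesgue" using \<Omega> by auto
  show "g \<in> Lp 2 \<Omega>" by fact
  have gnL: "gn n \<in> Lp 2 \<Omega>" for n using un(2)[of n] by (simp add: has_weak_gradient_def)
  fix \<phi> and i :: 'a assume \<phi>: "test_function \<Omega> \<phi>" and i: "i \<in> Basis"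
  obtain B where B: "\<And>x. \<bar>\<phi> x\<bar> \<le> B" using test_function_bounded(1)[OF \<phi>] by blast
  obtain B' where B': "\<And>x. \<bar>frechet_derivative \<phi> (at x) i\<bar> \<le> B'" using test_function_bounded(2)[OF \<phi> i] by blast
  note c = test_function_regular[OF \<phi> i]
  have 1: "(\<lambda>n. LINT x|lebesgue_on \<Omega>. un n x * frechet_derivative \<phi> (at x) i) \<longlonglongrightarrow> (LINT x|lebesgue_on \<Omega>. u x * frechet_derivative \<phi> (at x) i)"
    by (rule L2_tendsto_integral[OF \<Omega>(2) S un(1) u c(2) B'])
  have 2: "(\<lambda>n. LINT x|lebesgue_on \<Omega>. (gn n x \<bullet> i) * \<phi> x) \<longlonglongrightarrow> (LINT x|lebesgue_on \<Omega>. (g x \<bullet> i) * \<phi> x)"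
  proof (rule L2_tendsto_integral[OF \<Omega>(2) S Lp_2_inner[OF gnL i] Lp_2_inner[OF g(1) i] _ c(1) B])
    show "(\<lambda>n. \<integral>\<^sup>+x. ennreal ((norm (gn n x \<bullet> i - g x \<bullet> i))\<^sup>2) \<partial>lebesgue_on \<Omega>) \<longlonglongrightarrow> 0"
    proof (rule tendsto_sandwich[OF _ _ tendsto_const g(2)])
      show "\<forall>\<^sub>F n in sequentially. (\<integral>\<^sup>+x. ennreal ((norm (gn n x \<bullet> i - g x \<bullet> i))\<^sup>2) \<partial>lebesgue_on \<Omega>) \<le> (\<integral>\<^sup>+x. ennreal ((norm (gn n x - g x))\<^sup>2) \<partial>lebesgue_on \<Omega>)"
        unfolding inner_diff_left[symmetric] real_norm_def
        by (intro always_eventually allI nn_integral_mono ennreal_leI power_mono Basis_le_norm i) auto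
    qed simp
  qed
  have "(LINT x|lebesgue_on \<Omega>. un n x * frechet_derivative \<phi> (at x) i) = - (LINT x|lebesgue_on \<Omega>. (gn n x \<bullet> i) * \<phi> x)" for n
    using un(2)[of n] \<phi> i by (simp add: has_weak_gradient_def)
  with 1 have "(\<lambda>n. - (LINT x|lebesgue_on \<Omega>. (gn n x \<bullet> i) * \<phi> x)) \<longlonglongrightarrow> (LINT x|lebesgue_on \<Omega>. u x * frechet_derivative \<phi> (at x) i)" by simp
  from LIMSEQ_unique[OF this tendsto_minus[OF 2]]
  show "(LINT x|lebesgue_on \<Omega>. u x * frechet_derivative \<phi> (at x) i) = - (LINT x|lebesgue_on \<Omega>. (g x \<bullet> i) * \<phi> x)" .
qed

text \<open>Riesz-Fischer in terms of squared integrals: weights 4^k on the squared increments take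
  the place of Minkowski's inequality. Fatou's lemma then gives convergence of the whole sequence in
  L^2, while pointwise convergence holds along the subsequence.\<close>

lemma L2_cauchy_converges:
  fixes f :: "nat \<Rightarrow> 'a \<Rightarrow> 'b::euclidean_space"
  assumes [measurable]: "\<And>n. f n \<in> borel_measurable M"
    and cauchy: "\<And>e. e > 0 \<Longrightarrow> \<exists>N. \<forall>m\<ge>N. \<forall>n\<ge>N. (\<integral>\<^sup>+x. ennreal ((norm (f m x - f n x))\<^sup>2) \<partial>M) \<le> ennreal e"
  shows "\<exists>l r. l \<in> borel_measurable M \<and> strict_mono (r::nat\<Rightarrow>nat) \<and> (AE x in M. (\<lambda>n. f (r n) x) \<longlonglongrightarrow> l x) \<and>
    (\<lambda>n. \<integral>\<^sup>+x. ennreal ((norm (f n x - l x))\<^sup>2) \<partial>M) \<longlonglongrightarrow> 0"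
proof -
  \<comment> \<open>The squared increments are made so small that they remain summable after
    multiplication by 4^k; pointwise this bounds the k-th increment by sqrt(s) / 2^k.\<close>
  have "\<forall>k. \<exists>N. \<forall>m\<ge>N. \<forall>n\<ge>N. (\<integral>\<^sup>+x. ennreal ((norm (f m x - f n x))\<^sup>2) \<partial>M) \<le> ennreal ((1/8)^k)"
    using cauchy by simp
  from choice[OF this] obtain N where N: "\<And>k m n. m \<ge> N k \<Longrightarrow> n \<ge> N k \<Longrightarrow> (\<integral>\<^sup>+x. ennreal ((norm (f m x - f n x))\<^sup>2) \<partial>M) \<le> ennreal ((1/8)^k)"
    by blast
  \<comment> \<open>The successor makes \<open>r\<close> strictly increasing, and
    \<open>N (Suc k)\<close> keeps it beyond the thresholds.\<close>
  define r where "r = rec_nat (N 0) (\<lambda>k a. max (Suc a) (N (Suc k)))"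
  have r: "r (Suc k) \<ge> Suc (r k)" "r k \<ge> N k" for k by (cases k; simp add: r_def)+
  have sm: "strict_mono r" using r(1) by (simp add: strict_mono_Suc_iff Suc_le_eq)
  define d where "d k x = f (r (Suc k)) x - f (r k) x" for k x
  have [measurable]: "d k \<in> borel_measurable M" for k unfolding d_def by measurable
  have "(\<integral>\<^sup>+x. (\<Sum>k. ennreal (4 ^ k * (norm (d k x))\<^sup>2)) \<partial>M) = (\<Sum>k. \<integral>\<^sup>+x. ennreal (4 ^ k * (norm (d k x))\<^sup>2) \<partial>M)"
    by (rule nn_integral_suminf) measurable
  also have "\<dots> \<le> (\<Sum>k. ennreal ((1/2)^k))"
  proof (rule suminf_le)
    fix k
    have "(\<integral>\<^sup>+x. ennreal (4 ^ k * (norm (d k x))\<^sup>2) \<partial>M) = ennreal (4 ^ k) * (\<integral>\<^sup>+x. ennreal ((norm (d k x))\<^sup>2) \<partial>M)"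
      by (subst nn_integral_cmult[symmetric]) (auto simp: ennreal_mult)
    also have "\<dots> \<le> ennreal (4 ^ k) * ennreal ((1/8)^k)"
      unfolding d_def using r(1)[of k] r(2)[of k] by (intro mult_left_mono N) auto
    also have "\<dots> = ennreal ((1/2)^k)" by (simp add: ennreal_mult[symmetric] power_mult_distrib[symmetric])
    finally show "(\<integral>\<^sup>+x. ennreal (4 ^ k * (norm (d k x))\<^sup>2) \<partial>M) \<le> ennreal ((1/2)^k)" .
  qed simp_all
  also have "\<dots> < \<infinity>"
    by (subst suminf_ennreal2) (auto intro: summable_geometric)
  finally have "AE x in M. (\<Sum>k. ennreal (4 ^ k * (norm (d k x))\<^sup>2)) \<noteq> \<infinity>"
    by (intro nn_integral_PInf_AE) auto
  then have conv: "AE x in M. convergent (\<lambda>n. f (r n) x)"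
  proof eventually_elim
    case (elim x)
    define s where "s = enn2real (\<Sum>k. ennreal (4 ^ k * (norm (d k x))\<^sup>2))"
    have s: "s \<ge> 0" "(\<Sum>k. ennreal (4 ^ k * (norm (d k x))\<^sup>2)) = ennreal s"
      using elim by (simp_all add: s_def top.not_eq_extremum)
    have bound: "norm (d k x) \<le> sqrt s * (1/2) ^ k" for k
    proof -
      have term_le: "\<phi> k \<le> suminf \<phi>" for \<phi> :: "nat \<Rightarrow> ennreal"
        using sum_le_suminf[of \<phi> "{k}"] by simp
      have "ennreal (4 ^ k * (norm (d k x))\<^sup>2) \<le> ennreal s" unfolding s(2)[symmetric] by (rule term_le)
      then have "4 ^ k * (norm (d k x))\<^sup>2 \<le> s" by (simp only: ennreal_le_iff[OF s(1)])
      moreover have "(4::real) ^ k = (2 ^ k)\<^sup>2" by (simp add: power2_eq_square power_mult_distrib[symmetric])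
      ultimately have "(2 ^ k * norm (d k x))\<^sup>2 \<le> s" by (simp add: power_mult_distrib)
      then have "2 ^ k * norm (d k x) \<le> sqrt s" by (rule real_le_rsqrt)
      then show ?thesis by (simp add: power_one_over field_simps)
    qed
    have "summable (\<lambda>k. d k x)"
      by (rule summable_comparison_test'[OF summable_mult[OF summable_geometric], of "1/2" 0 _ "sqrt s"]) (use bound in auto)
    then have "convergent (\<lambda>n. \<Sum>k<n. d k x)" by (simp add: summable_iff_convergent)
    moreover have "(\<Sum>k<n. d k x) = f (r n) x - f (r 0) x" for n
      unfolding d_def by (rule sum_lessThan_telescope)
    ultimately have "convergent (\<lambda>n. (f (r n) x - f (r 0) x) + f (r 0) x)"
      by (intro convergent_add convergent_const) simp
    then show ?case by simp
  qed
  define l where "l x = lim (\<lambda>n. f (r n) x)" for x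
  have [measurable]: "l \<in> borel_measurable M" unfolding l_def by measurable
  have lim: "AE x in M. (\<lambda>n. f (r n) x) \<longlonglongrightarrow> l x"
    using conv by eventually_elim (simp add: l_def convergent_LIMSEQ_iff)
  have "(\<lambda>n. \<integral>\<^sup>+x. ennreal ((norm (f n x - l x))\<^sup>2) \<partial>M) \<longlonglongrightarrow> 0"
  proof (rule tendsto_zero_ennreal)
    fix e :: real assume e: "e > 0"
    obtain N where N: "\<And>m n. m \<ge> N \<Longrightarrow> n \<ge> N \<Longrightarrow> (\<integral>\<^sup>+x. ennreal ((norm (f m x - f n x))\<^sup>2) \<partial>M) \<le> ennreal (e/2)"
      using cauchy[of "e/2"] e by auto
    have "(\<integral>\<^sup>+x. ennreal ((norm (f n x - l x))\<^sup>2) \<partial>M) < ennreal e" if n: "n \<ge> N" for n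
    proof -
      have "(\<integral>\<^sup>+x. ennreal ((norm (f n x - l x))\<^sup>2) \<partial>M) = (\<integral>\<^sup>+x. liminf (\<lambda>k. ennreal ((norm (f n x - f (r k) x))\<^sup>2)) \<partial>M)"
      proof (rule nn_integral_cong_AE)
        show "AE x in M. ennreal ((norm (f n x - l x))\<^sup>2) = liminf (\<lambda>k. ennreal ((norm (f n x - f (r k) x))\<^sup>2))"
          using lim
        proof eventually_elim
          case (elim x)
          then have "(\<lambda>k. ennreal ((norm (f n x - f (r k) x))\<^sup>2)) \<longlonglongrightarrow> ennreal ((norm (f n x - l x))\<^sup>2)"
            by (intro tendsto_intros)
          from lim_imp_Liminf[OF trivial_limit_sequentially this] show ?case by (rule sym)
        qed
      qed
      also have "\<dots> \<le> liminf (\<lambda>k. \<integral>\<^sup>+x. ennreal ((norm (f n x - f (r k) x))\<^sup>2) \<partial>M)"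
        by (rule nn_integral_liminf) measurable
      also have "\<dots> \<le> ennreal (e/2)"
      proof (rule Liminf_le)
        have "k \<ge> N \<Longrightarrow> r k \<ge> N" for k using seq_suble[OF sm, of k] by simp
        then show "\<forall>\<^sub>F k in sequentially. (\<integral>\<^sup>+x. ennreal ((norm (f n x - f (r k) x))\<^sup>2) \<partial>M) \<le> ennreal (e/2)"
          unfolding eventually_sequentially using N[OF n] by blast
      qed simp
      also have "\<dots> < ennreal e" using e by (simp add: ennreal_lessI)
      finally show ?thesis .
    qed
    then show "\<forall>\<^sub>F n in sequentially. (\<integral>\<^sup>+x. ennreal ((norm (f n x - l x))\<^sup>2) \<partial>M) < ennreal e"
      unfolding eventually_sequentially by blast
  qed
  with lim sm show ?thesis by (intro exI[of _ l] exI[of _ r]) simp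
qed

section \<open>The space W12, its Poincare inequality and its embedding\<close>

lemma W12_D:
  assumes "u \<in> W12 \<Omega>"
  shows "u \<in> Lp 2 \<Omega>" "has_weak_gradient \<Omega> u (weak_grad \<Omega> u)" "weak_grad \<Omega> u \<in> Lp 2 \<Omega>"
proof -
  show u: "u \<in> Lp 2 \<Omega>" using assms by (simp add: W12_def)
  show "has_weak_gradient \<Omega> u (weak_grad \<Omega> u)"
  proof -
    obtain g where "has_weak_gradient \<Omega> u g" using assms by (auto simp: W12_def)
    then show ?thesis unfolding weak_grad_def by (rule someI[of "has_weak_gradient \<Omega> u"])
  qed
  then show "weak_grad \<Omega> u \<in> Lp 2 \<Omega>" by (simp add: has_weak_gradient_def)
qed

lemma W12_weak_grad_eq:
  fixes \<Omega> :: "'a::euclidean_space set"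
  assumes \<Omega>: "open \<Omega>" "bounded \<Omega>" and u: "u \<in> Lp 2 \<Omega>" "has_weak_gradient \<Omega> u g"
  shows "u \<in> W12 \<Omega>" "AE x in lebesgue_on \<Omega>. weak_grad \<Omega> u x = g x"
proof -
  show "u \<in> W12 \<Omega>" using u by (auto simp: W12_def)
  from has_weak_gradient_unique[OF \<Omega> W12_D(2)[OF this] u(2)]
  show "AE x in lebesgue_on \<Omega>. weak_grad \<Omega> u x = g x" .
qed

lemma W12_lincomb:
  fixes \<Omega> :: "'a::euclidean_space set"
  assumes \<Omega>: "open \<Omega>" "bounded \<Omega>" and u: "u \<in> W12 \<Omega>" and v: "v \<in> W12 \<Omega>"
  shows "(\<lambda>x. a * u x + b * v x) \<in> W12 \<Omega>"
    and "AE x in lebesgue_on \<Omega>. weak_grad \<Omega> (\<lambda>x. a * u x + b * v x) x = a *\<^sub>R weak_grad \<Omega> u x + b *\<^sub>R weak_grad \<Omega> v x"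
proof -
  have L: "(\<lambda>x. a * u x + b * v x) \<in> Lp 2 \<Omega>"
    using Lp_2_lincomb[OF W12_D(1)[OF u] W12_D(1)[OF v], of a b] by simp
  note g = has_weak_gradient_lincomb[OF \<Omega> W12_D(1,2)[OF u] W12_D(1,2)[OF v], of a b]
  show "(\<lambda>x. a * u x + b * v x) \<in> W12 \<Omega>" by (rule W12_weak_grad_eq(1)[OF \<Omega> L g])
  show "AE x in lebesgue_on \<Omega>. weak_grad \<Omega> (\<lambda>x. a * u x + b * v x) x = a *\<^sub>R weak_grad \<Omega> u x + b *\<^sub>R weak_grad \<Omega> v x"
    by (rule W12_weak_grad_eq(2)[OF \<Omega> L g])
qed

lemma Lp_norm_2_squared: "(Lp_norm 2 S f)\<^sup>2 = (LINT x|lebesgue_on S. (norm (f x))\<^sup>2)"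
proof -
  have "0 \<le> (LINT x|lebesgue_on S. (norm (f x))\<^sup>2)" by simp
  then show ?thesis by (simp add: Lp_norm_def powr_half_sqrt)
qed

lemma W12_norm_squared:
  "(W12_norm \<Omega> u)\<^sup>2 = (LINT x|lebesgue_on \<Omega>. (u x)\<^sup>2) + (LINT x|lebesgue_on \<Omega>. (norm (weak_grad \<Omega> u x))\<^sup>2)"
proof -
  have "(W12_norm \<Omega> u)\<^sup>2 = (Lp_norm 2 \<Omega> u)\<^sup>2 + (Lp_norm 2 \<Omega> (weak_grad \<Omega> u))\<^sup>2"
    unfolding W12_norm_def by (rule real_sqrt_pow2) simp
  then show ?thesis by (simp only: Lp_norm_2_squared real_norm_def power2_abs)
qed

text \<open>The case k = 1 of the Sobolev-Poincare inequality. Its unspecified constant c is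
  replaced by the mean, which minimises the integral of (u - c)^2 over all constants.\<close>

lemma poincare_mean:
  fixes \<Omega> :: "'a::euclidean_space set"
  assumes dim: "DIM('a) = 2" and \<Omega>: "lipschitz_domain \<Omega>" "bounded \<Omega>"
  shows "\<exists>C\<ge>0. \<forall>u\<in>W12 \<Omega>. (LINT x|lebesgue_on \<Omega>. (u x - (LINT y|lebesgue_on \<Omega>. u y) / measure lebesgue \<Omega>)\<^sup>2)
    \<le> C * (LINT x|lebesgue_on \<Omega>. (norm (weak_grad \<Omega> u x))\<^sup>2)"
proof -
  have S: "\<Omega> \<in> sets lebesgue" using \<Omega> by (auto simp: lipschitz_domain_def)
  interpret finite_measure "lebesgue_on \<Omega>" using finite_measure_lebesgue_on_bounded[OF \<Omega>(2) S] .
  obtain C where C: "\<And>u g. u \<in> Lp 2 \<Omega> \<Longrightarrow> has_weak_gradient \<Omega> u g \<Longrightarrow> \<exists>c.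
     (\<integral>\<^sup>+x. ennreal (\<bar>u x - c\<bar> ^ (2 * 1)) \<partial>lebesgue_on \<Omega>)
       \<le> ennreal C * (\<integral>\<^sup>+x. ennreal ((norm (g x))\<^sup>2) \<partial>lebesgue_on \<Omega>) ^ 1"
    using sobolev_poincare[OF dim \<Omega>, of 1 0] by auto
  have "measure lebesgue \<Omega> > 0"
  proof -
    have "emeasure lebesgue \<Omega> > 0"
      using emeasure_open_pos[of \<Omega>] \<Omega> by (simp add: lipschitz_domain_def)
    moreover have "emeasure lebesgue \<Omega> = ennreal (measure lebesgue \<Omega>)"
      using bounded_set_imp_lmeasurable[OF \<Omega>(2) S] by (simp add: emeasure_eq_measure2)
    ultimately show ?thesis by simp
  qed
  then have mpos: "measure (lebesgue_on \<Omega>) (space (lebesgue_on \<Omega>)) > 0" 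
    and meq: "measure (lebesgue_on \<Omega>) (space (lebesgue_on \<Omega>)) = measure lebesgue \<Omega>"
    using S by (simp_all add: measure_restrict_space)
  have "(LINT x|lebesgue_on \<Omega>. (u x - (LINT y|lebesgue_on \<Omega>. u y) / measure lebesgue \<Omega>)\<^sup>2)
    \<le> max C 0 * (LINT x|lebesgue_on \<Omega>. (norm (weak_grad \<Omega> u x))\<^sup>2)" if u: "u \<in> W12 \<Omega>" for u
  proof -
    note L = W12_D[OF u]
    have iu: "integrable (lebesgue_on \<Omega>) u" by (rule Lp_2_integrable[OF L(1) \<Omega>(2) S])
    have iu2: "integrable (lebesgue_on \<Omega>) (\<lambda>x. (u x)\<^sup>2)" using L(1) by (simp add: Lp_2_iff)
    have ig: "integrable (lebesgue_on \<Omega>) (\<lambda>x. (norm (weak_grad \<Omega> u x))\<^sup>2)" using L(3) by (simp add: Lp_2_iff)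
    obtain c where c: "(\<integral>\<^sup>+x. ennreal (\<bar>u x - c\<bar> ^ (2 * 1)) \<partial>lebesgue_on \<Omega>)
       \<le> ennreal C * (\<integral>\<^sup>+x. ennreal ((norm (weak_grad \<Omega> u x))\<^sup>2) \<partial>lebesgue_on \<Omega>) ^ 1" using C[OF L(1,2)] by blast
    have ic: "integrable (lebesgue_on \<Omega>) (\<lambda>x. (u x - a)\<^sup>2)" for a
      using iu iu2 by (simp add: power2_diff)
    have "ennreal (LINT x|lebesgue_on \<Omega>. (u x - c)\<^sup>2) \<le> ennreal C * ennreal (LINT x|lebesgue_on \<Omega>. (norm (weak_grad \<Omega> u x))\<^sup>2)"
      using c nn_integral_eq_integral[OF ic[of c]] nn_integral_eq_integral[OF ig] by simp
    also have "\<dots> \<le> ennreal (max C 0) * ennreal (LINT x|lebesgue_on \<Omega>. (norm (weak_grad \<Omega> u x))\<^sup>2)"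
      by (intro mult_right_mono ennreal_leI) auto
    finally have "ennreal (LINT x|lebesgue_on \<Omega>. (u x - c)\<^sup>2) \<le> ennreal (max C 0) * ennreal (LINT x|lebesgue_on \<Omega>. (norm (weak_grad \<Omega> u x))\<^sup>2)" .
    then have le: "(LINT x|lebesgue_on \<Omega>. (u x - c)\<^sup>2) \<le> max C 0 * (LINT x|lebesgue_on \<Omega>. (norm (weak_grad \<Omega> u x))\<^sup>2)"
      by (simp add: ennreal_mult[symmetric])
    define a where "a = (LINT y|lebesgue_on \<Omega>. u y) / measure lebesgue \<Omega>"
    have "(LINT x|lebesgue_on \<Omega>. (u x - a)\<^sup>2) \<le> (LINT x|lebesgue_on \<Omega>. (u x - c)\<^sup>2)"
    proof -
      \<comment> \<open>Expanding the square shows a quadratic polynomial in \<open>b\<close> with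
        vertex \<open>a\<close>.\<close>
      have e: "(LINT x|lebesgue_on \<Omega>. (u x - b)\<^sup>2) = (LINT x|lebesgue_on \<Omega>. (u x)\<^sup>2) - 2 * b * (a * measure lebesgue \<Omega>) + b\<^sup>2 * measure lebesgue \<Omega>" for b
      proof -
        have "(LINT x|lebesgue_on \<Omega>. (u x - b)\<^sup>2) = (LINT x|lebesgue_on \<Omega>. (u x)\<^sup>2 + b\<^sup>2 - (2 * b) * u x)"
          by (simp add: power2_diff mult_ac)
        also have "\<dots> = (LINT x|lebesgue_on \<Omega>. (u x)\<^sup>2) + b\<^sup>2 * measure lebesgue \<Omega> - (2 * b) * (LINT x|lebesgue_on \<Omega>. u x)"
          using iu iu2 meq by simp
        also have "(LINT x|lebesgue_on \<Omega>. u x) = a * measure lebesgue \<Omega>" using mpos meq by (simp add: a_def)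
        finally show ?thesis by simp
      qed
      have "0 \<le> (a - c)\<^sup>2 * measure lebesgue \<Omega>" by simp
      then show ?thesis unfolding e by (simp add: power2_eq_square algebra_simps)
    qed
    with le show ?thesis unfolding a_def by linarith
  qed
  then show ?thesis by (intro exI[of _ "max C 0"]) auto
qed

text \<open>A power p = 2^(m+1) that is at least \<open>t\<close> is controlled by the
  Sobolev-Poincare inequality, and |u|^t is at most 1 + |u|^p on a domain of finite measure.\<close>

lemma W12_powr_integrable:
  fixes \<Omega> :: "'a::euclidean_space set"
  assumes dim: "DIM('a) = 2" and \<Omega>: "lipschitz_domain \<Omega>" "bounded \<Omega>" and u: "u \<in> W12 \<Omega>" and t: "t > 0"
  shows "integrable (lebesgue_on \<Omega>) (\<lambda>x. \<bar>u x\<bar> powr t)"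
proof -
  have S: "\<Omega> \<in> sets lebesgue" using \<Omega> by (auto simp: lipschitz_domain_def)
  interpret finite_measure "lebesgue_on \<Omega>" using finite_measure_lebesgue_on_bounded[OF \<Omega>(2) S] .
  note L = W12_D[OF u]
  have um [measurable]: "u \<in> borel_measurable (lebesgue_on \<Omega>)" using L(1) by (simp add: Lp_2_iff)
  obtain m :: nat where m: "t \<le> real m" using real_arch_simple by blast
  define p where "p = 2 * (2::nat) ^ m"
  have p: "t \<le> real p"
  proof -
    have "m \<le> 2 ^ m" using less_exp[of m] by (rule less_imp_le)
    then have "m \<le> p" unfolding p_def by linarith
    then show ?thesis using m by linarith
  qed
  obtain C c where c: "(\<integral>\<^sup>+x. ennreal (\<bar>u x - c\<bar> ^ p) \<partial>lebesgue_on \<Omega>)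
       \<le> ennreal C * (\<integral>\<^sup>+x. ennreal ((norm (weak_grad \<Omega> u x))\<^sup>2) \<partial>lebesgue_on \<Omega>) ^ (2 ^ m)"
    using sobolev_poincare[OF dim \<Omega> refl, of m] L(1,2) unfolding p_def by blast
  also have "\<dots> < \<infinity>"
  proof -
    have "(\<integral>\<^sup>+x. ennreal ((norm (weak_grad \<Omega> u x))\<^sup>2) \<partial>lebesgue_on \<Omega>) < \<infinity>"
      using L(3) by (simp add: Lp_2_iff integrable_iff_bounded)
    then show ?thesis by (simp add: ennreal_mult_less_top power_less_top_ennreal)
  qed
  finally have "integrable (lebesgue_on \<Omega>) (\<lambda>x. \<bar>u x - c\<bar> ^ p)"
    by (intro integrableI_bounded) simp_all
  then have i: "integrable (lebesgue_on \<Omega>) (\<lambda>x. 1 + 2 ^ p * (\<bar>u x - c\<bar> ^ p + \<bar>c\<bar> ^ p))" by simp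
  show ?thesis
  proof (rule Bochner_Integration.integrable_bound[OF i])
    show "AE x in lebesgue_on \<Omega>. norm (\<bar>u x\<bar> powr t) \<le> norm (1 + 2 ^ p * (\<bar>u x - c\<bar> ^ p + \<bar>c\<bar> ^ p))"
    proof (rule AE_I2)
      fix x
      have "\<bar>u x\<bar> powr t \<le> 1 + \<bar>u x\<bar> ^ p"
      proof (cases "\<bar>u x\<bar> \<le> 1")
        case True
        then have "\<bar>u x\<bar> powr t \<le> 1" using t by (intro powr_le1) auto
        then show ?thesis by (simp add: add_increasing2)
      next
        case False
        then have "\<bar>u x\<bar> powr t \<le> \<bar>u x\<bar> powr real p" using p by (intro powr_mono) auto
        also have "\<dots> = \<bar>u x\<bar> ^ p" using False by (simp add: powr_realpow)
        finally show ?thesis by simp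
      qed
      also have "\<bar>u x\<bar> ^ p \<le> 2 ^ p * (\<bar>u x - c\<bar> ^ p + \<bar>c\<bar> ^ p)" using power_abs_add_le[of "u x - c" c p] by simp
      finally show "norm (\<bar>u x\<bar> powr t) \<le> norm (1 + 2 ^ p * (\<bar>u x - c\<bar> ^ p + \<bar>c\<bar> ^ p))"
        by (simp add: abs_of_nonneg add_nonneg_nonneg)
    qed
  qed measurable
qed

section \<open>Minimisers of the energy\<close>

text \<open>The derivative of |y|^t. It enters only through the gradient inequality, strict
  monotonicity, continuity and growth bounds, so |y|^t is never differentiated.\<close>

definition psi :: "real \<Rightarrow> real \<Rightarrow> real" where
  "psi t y = t * \<bar>y\<bar> powr (t - 2) * y"

lemma psi_zero [simp]: "psi t 0 = 0"
  by (simp add: psi_def)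

lemma powr_abs_add_le:
  fixes a b :: real
  assumes "t > 0" shows "\<bar>a + b\<bar> powr t \<le> 2 powr t * (\<bar>a\<bar> powr t + \<bar>b\<bar> powr t)"
proof -
  have "\<bar>a + b\<bar> powr t \<le> (2 * max \<bar>a\<bar> \<bar>b\<bar>) powr t" using assms by (intro powr_mono2) auto
  also have "\<dots> = 2 powr t * max \<bar>a\<bar> \<bar>b\<bar> powr t" by (simp add: powr_mult)
  also have "max \<bar>a\<bar> \<bar>b\<bar> powr t \<le> \<bar>a\<bar> powr t + \<bar>b\<bar> powr t" by (simp add: max_def)
  finally show ?thesis by simp
qed

lemma psi_eq: "t > 1 \<Longrightarrow> psi t y = t * sgn y * \<bar>y\<bar> powr (t - 1)"
proof (cases "y = 0")
  case False
  have "\<bar>y\<bar> powr (t - 2) * \<bar>y\<bar> = \<bar>y\<bar> powr (t - 1)"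
    using powr_mult_base[of "\<bar>y\<bar>" "t - 2"] by (simp add: mult.commute)
  moreover have "y = sgn y * \<bar>y\<bar>" by (simp add: mult_sgn_abs)
  ultimately show ?thesis unfolding psi_def by (metis mult.assoc mult.commute)
qed simp

lemma psi_abs: "t > 1 \<Longrightarrow> \<bar>psi t y\<bar> = t * \<bar>y\<bar> powr (t - 1)"
  by (cases "y = 0") (auto simp: psi_eq abs_mult abs_sgn_eq)

lemma psi_self: "t > 1 \<Longrightarrow> psi t y * y = t * \<bar>y\<bar> powr t"
proof -
  assume t: "t > 1"
  have "psi t y * y = t * \<bar>y\<bar> powr (t - 1) * (sgn y * y)" by (simp add: psi_eq[OF t])
  also have "sgn y * y = \<bar>y\<bar>" by (simp add: abs_sgn mult.commute)
  also have "t * \<bar>y\<bar> powr (t - 1) * \<bar>y\<bar> = t * \<bar>y\<bar> powr t"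
    using powr_mult_base[of "\<bar>y\<bar>" "t - 1"] by (simp add: mult.commute)
  finally show ?thesis .
qed

text \<open>Young's inequality \<open>|y|\<^sup>t\<^sup>-\<^sup>1 |z| \<le> ((t - 1) |y|\<^sup>t + |z|\<^sup>t) / t\<close> is the convexity of \<open>|y|\<^sup>t\<close> in disguise.\<close>
lemma psi_gradient_inequality:
  assumes t: "t > 1" shows "\<bar>y\<bar> powr t + psi t y * (z - y) \<le> \<bar>z\<bar> powr t"
proof -
  have "psi t y * z \<le> (t - 1) * \<bar>y\<bar> powr t + \<bar>z\<bar> powr t"
  proof (cases "y = 0 \<or> z = 0")
    case True
    then show ?thesis using t by auto
  next
    case False
    have "(\<bar>y\<bar> powr t) powr ((t - 1) / t) * (\<bar>z\<bar> powr t) powr (1 / t) \<le> (t - 1) / t * \<bar>y\<bar> powr t + 1 / t * \<bar>z\<bar> powr t"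
      by (rule Youngs_inequality_0) (use t False in \<open>auto simp: field_simps\<close>)
    then have "\<bar>y\<bar> powr (t - 1) * \<bar>z\<bar> \<le> ((t - 1) * \<bar>y\<bar> powr t + \<bar>z\<bar> powr t) / t"
      using t by (simp add: powr_powr add_divide_distrib)
    then have "t * \<bar>y\<bar> powr (t - 1) * \<bar>z\<bar> \<le> (t - 1) * \<bar>y\<bar> powr t + \<bar>z\<bar> powr t"
      using t by (simp add: field_simps)
    moreover have "psi t y * z \<le> \<bar>psi t y\<bar> * \<bar>z\<bar>" by (metis abs_ge_self abs_mult)
    ultimately show ?thesis by (simp add: psi_abs[OF t])
  qed
  then show ?thesis using psi_self[OF t, of y] by (simp add: algebra_simps)
qed

text \<open>The gradient inequality at the midpoint, added for both endpoints; the linear terms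
  cancel.\<close>

lemma powr_midpoint_convex:
  fixes y z :: real
  assumes t: "t > 1" shows "2 * \<bar>(y + z) / 2\<bar> powr t \<le> \<bar>y\<bar> powr t + \<bar>z\<bar> powr t"
proof -
  let ?w = "(y + z) / 2"
  have "psi t ?w * (y - ?w) + psi t ?w * (z - ?w) = psi t ?w * 0"
    unfolding distrib_left[symmetric] by (simp add: field_simps)
  then show ?thesis
    using psi_gradient_inequality[OF t, of ?w y] psi_gradient_inequality[OF t, of ?w z] by linarith
qed

lemma psi_strict_mono:
  assumes t: "t > 1" and yz: "y < z" shows "psi t y < psi t z"
proof -
  have *: "psi t a < psi t b" if "0 \<le> a" "a < b" for a b
    using that t by (cases "a = 0") (auto simp: psi_eq[OF t] intro!: powr_less_mono2)
  have neg: "psi t (- a) = - psi t a" for a by (simp add: psi_def)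
  consider "0 \<le> y" | "z \<le> 0" | "y < 0" "0 < z" using yz by linarith
  then show ?thesis
  proof cases
    case 2
    then show ?thesis using *[of "- z" "- y"] yz neg by simp
  next
    case 3
    then show ?thesis using *[of 0 z] *[of 0 "- y"] neg[of y] by simp
  qed (use * yz in simp)
qed

lemma psi_monotone:
  assumes t: "t > 1" shows "0 \<le> (psi t y - psi t z) * (y - z)" "(psi t y - psi t z) * (y - z) = 0 \<Longrightarrow> y = z"
proof -
  consider "y < z" | "z < y" | "y = z" by linarith
  then have "0 < (psi t y - psi t z) * (y - z) \<or> y = z"
  proof cases
    case 1
    then show ?thesis using psi_strict_mono[OF t 1] by (auto intro: mult_neg_neg)
  next
    case 2
    then show ?thesis using psi_strict_mono[OF t 2] by (auto intro: mult_pos_pos)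
  qed simp
  then show "0 \<le> (psi t y - psi t z) * (y - z)" "(psi t y - psi t z) * (y - z) = 0 \<Longrightarrow> y = z" by auto
qed

text \<open>For t < 2 the factor |y|^(t - 2) is singular at 0, so continuity there is read off from
  the absolute value t |y|^(t - 1), whose exponent is positive.\<close>

lemma tendsto_psi:
  assumes t: "t > 1" and f: "(f \<longlongrightarrow> y) F" shows "((\<lambda>x. psi t (f x)) \<longlongrightarrow> psi t y) F"
proof (cases "y = 0")
  case False
  then show ?thesis unfolding psi_def by (intro tendsto_intros f) auto
next
  case True
  have "((\<lambda>x. t * \<bar>f x\<bar> powr (t - 1)) \<longlongrightarrow> t * \<bar>0\<bar> powr (t - 1)) F"
    using f t unfolding True by (intro tendsto_intros tendsto_powr' ) auto
  then have "((\<lambda>x. \<bar>psi t (f x)\<bar>) \<longlongrightarrow> 0) F" by (simp add: psi_abs[OF t])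
  then show ?thesis using True by (simp add: tendsto_rabs_zero_iff)
qed

text \<open>Both |y| and |b| are at most |y| + |b|. This crude bound takes the place of Hoelder's
  inequality with exponents t/(t - 1) and t, both for integrability and for the dominating function
  in the variation.\<close>

lemma psi_mult_bound:
  assumes t: "t > 1" shows "\<bar>psi t y * b\<bar> \<le> t * (\<bar>y\<bar> + \<bar>b\<bar>) powr t"
proof -
  have "\<bar>psi t y * b\<bar> = t * (\<bar>y\<bar> powr (t - 1) * \<bar>b\<bar>)" by (simp add: abs_mult psi_abs[OF t])
  also have "\<dots> \<le> t * ((\<bar>y\<bar> + \<bar>b\<bar>) powr (t - 1) * (\<bar>y\<bar> + \<bar>b\<bar>))"
    using t by (intro mult_left_mono mult_mono powr_mono2) auto
  also have "(\<bar>y\<bar> + \<bar>b\<bar>) powr (t - 1) * (\<bar>y\<bar> + \<bar>b\<bar>) = (\<bar>y\<bar> + \<bar>b\<bar>) powr t"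
    using powr_mult_base[of "\<bar>y\<bar> + \<bar>b\<bar>" "t - 1"] by (simp add: mult.commute)
  finally show ?thesis .
qed

lemma psi_measurable [measurable]: "psi t \<in> borel_measurable borel"
  unfolding psi_def by measurable

section \<open>Positive definite matrix fields and L^2 fields\<close>

lemma norm_matrix_vector_mult_le: "norm (A *v x) \<le> norm A * norm x" for A :: "real^'n^'m"
proof -
  have "norm (A *v x) = L2_set (\<lambda>i. \<bar>A $ i \<bullet> x\<bar>) UNIV" by (simp add: norm_vec_def matrix_vector_mul_component)
  also have "\<dots> \<le> L2_set (\<lambda>i. norm (A $ i) * norm x) UNIV"
    by (intro L2_set_mono Cauchy_Schwarz_ineq2) auto
  also have "\<dots> = norm A * norm x" by (simp add: norm_vec_def[of A] L2_set_left_distrib)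
  finally show ?thesis .
qed

lemma inner_matrix_vector_le: "\<bar>(A *v x) \<bullet> y\<bar> \<le> norm A * norm x * norm y" for A :: "real^'n^'m"
  using Cauchy_Schwarz_ineq2[of "A *v x" y] mult_right_mono[OF norm_matrix_vector_mult_le[of A x], of "norm y"] by simp

lemma inner_matrix_vector_sum:
  "(A *v x) \<bullet> y = (\<Sum>i\<in>UNIV. \<Sum>j\<in>UNIV. A $ i $ j * x $ j * y $ i)" for A :: "real^'n^'m"
  by (simp add: inner_vec_def matrix_vector_mult_def sum_distrib_right)

lemma C0_sym_posdef_bounded:
  assumes "compact S" "A \<in> C0_sym_posdef S"
  shows "\<exists>b>0. \<forall>x\<in>S. norm (A x) \<le> b"
proof -
  have "compact (A ` S)" using assms by (intro compact_continuous_image) (auto simp: C0_sym_posdef_def)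
  from compact_imp_bounded[OF this] show ?thesis unfolding bounded_pos by blast
qed

text \<open>The quadratic form attains a positive minimum on the compact product of \<open>S\<close>
  with the unit circle; homogeneity extends the bound to all vectors. The constant depends on
  \<open>A\<close>.\<close>

lemma C0_sym_posdef_elliptic:
  assumes S: "compact S" "S \<noteq> {}" and A: "A \<in> C0_sym_posdef S"
  shows "\<exists>\<alpha>>0. \<forall>x\<in>S. \<forall>Q. \<alpha> * (norm Q)\<^sup>2 \<le> (A x *v Q) \<bullet> Q"
proof -
  let ?h = "\<lambda>p. (A (fst p) *v snd p) \<bullet> snd p"
  have cA: "continuous_on S A" using A by (simp add: C0_sym_posdef_def)
  have "compact (S \<times> sphere (0::real^2) 1)" using S by (intro compact_Times) auto
  moreover have "S \<times> sphere (0::real^2) 1 \<noteq> {}"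
  proof -
    have "axis 1 1 \<in> sphere (0::real^2) 1" by simp
    then show ?thesis using S(2) by blast
  qed
  moreover have "continuous_on (S \<times> sphere (0::real^2) 1) ?h"
    unfolding inner_matrix_vector_sum
    by (intro continuous_intros continuous_on_compose2[OF cA]) auto
  ultimately obtain p where p: "p \<in> S \<times> sphere (0::real^2) 1" "\<And>q. q \<in> S \<times> sphere (0::real^2) 1 \<Longrightarrow> ?h p \<le> ?h q"
    using continuous_attains_inf[of "S \<times> sphere (0::real^2) 1" ?h] by blast
  have "snd p \<noteq> 0" using p(1) by (auto simp: mem_Times_iff)
  then have pos: "?h p > 0" using p(1) A by (auto simp: C0_sym_posdef_def sym_posdef_def mem_Times_iff)
  have "?h p * (norm Q)\<^sup>2 \<le> (A x *v Q) \<bullet> Q" if "x \<in> S" for x Q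
  proof (cases "Q = 0")
    case False
    have "?h p \<le> (A x *v (Q /\<^sub>R norm Q)) \<bullet> (Q /\<^sub>R norm Q)"
      using p(2)[of "(x, Q /\<^sub>R norm Q)"] that False by simp
    also have "\<dots> = ((A x *v Q) \<bullet> Q) / (norm Q)\<^sup>2"
      by (simp add: matrix_vector_mult_scaleR power2_eq_square divide_inverse mult_ac)
    finally show ?thesis using False by (simp add: field_simps)
  qed simp
  with pos show ?thesis by blast
qed

lemma Lp_2_nn_integral:
  "f \<in> Lp 2 S \<Longrightarrow> (\<integral>\<^sup>+x. ennreal ((norm (f x))\<^sup>2) \<partial>lebesgue_on S) = ennreal (LINT x|lebesgue_on S. (norm (f x))\<^sup>2)"
  by (intro nn_integral_eq_integral) (auto simp: Lp_2_iff)

lemma Lp_2_limit: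
  fixes l :: "'a::euclidean_space \<Rightarrow> 'b::euclidean_space"
  assumes f: "\<And>n. f n \<in> Lp 2 S" and l: "l \<in> borel_measurable (lebesgue_on S)"
    and lim: "(\<lambda>n. \<integral>\<^sup>+x. ennreal ((norm (f n x - l x))\<^sup>2) \<partial>lebesgue_on S) \<longlonglongrightarrow> 0"
  shows "l \<in> Lp 2 S"
proof -
  have "\<forall>\<^sub>F n in sequentially. (\<integral>\<^sup>+x. ennreal ((norm (f n x - l x))\<^sup>2) \<partial>lebesgue_on S) < 1"
    using lim by (rule order_tendstoD) simp
  then obtain n where n: "(\<integral>\<^sup>+x. ennreal ((norm (f n x - l x))\<^sup>2) \<partial>lebesgue_on S) < 1"
    by (auto simp: eventually_sequentially)
  have m: "(\<lambda>x. f n x - l x) \<in> borel_measurable (lebesgue_on S)"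
    using f[of n] l by (auto simp: Lp_2_iff intro: borel_measurable_diff)
  have "(\<lambda>x. f n x - l x) \<in> Lp 2 S"
    unfolding Lp_2_iff using m n by (auto intro!: integrableI_bounded intro: less_trans)
  from Lp_2_lincomb[OF f[of n] this, of 1 "-1"] show ?thesis by simp
qed

lemma Lp_2_diff: "f \<in> Lp 2 S \<Longrightarrow> g \<in> Lp 2 S \<Longrightarrow> (\<lambda>x. f x - g x) \<in> Lp 2 S"
  for f g :: "'a::euclidean_space \<Rightarrow> 'b::euclidean_space"
  using Lp_2_lincomb[of f S g 1 "-1"] by simp

text \<open>The datum is assumed on all of \<Omega>, so that every integral runs over the one
  measure \<open>M\<close>, with \<open>K\<close> entering through its indicator. A datum given on
  \<open>K\<close> is extended by zero before interpretation.\<close>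

locale energy_problem =
  fixes \<Omega> K :: "(real^2) set" and t lam :: real and f :: "real^2 \<Rightarrow> real"
  assumes lipschitz: "lipschitz_domain \<Omega>" and bdd: "bounded \<Omega>"
    and K: "K \<in> sets lebesgue" "K \<subseteq> \<Omega>" "emeasure lebesgue K > 0"
    and t: "t > 1" and lam: "lam > 0"
    and f_measurable [measurable]: "f \<in> borel_measurable (lebesgue_on \<Omega>)"
    and f_integrable: "integrable (lebesgue_on \<Omega>) (\<lambda>x. \<bar>f x\<bar> powr t)"
begin

abbreviation "M \<equiv> lebesgue_on \<Omega>"
abbreviation "V \<equiv> W12 \<Omega>"
abbreviation "G \<equiv> weak_grad \<Omega>"

definition form :: "(real^2 \<Rightarrow> real^2^2) \<Rightarrow> (real^2 \<Rightarrow> real^2) \<Rightarrow> (real^2 \<Rightarrow> real^2) \<Rightarrow> real" where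
  "form A g h = (LINT x|M. (A x *v g x) \<bullet> h x)"

text \<open>The quadratic part is halved and the data term is not divided by \<open>t\<close>: the
  first variation is then exactly the weak form, with the factor \<open>t\<close> inside
  \<open>psi\<close>.\<close>

definition density :: "(real^2 \<Rightarrow> real^2^2) \<Rightarrow> (real^2 \<Rightarrow> real) \<Rightarrow> (real^2 \<Rightarrow> real^2) \<Rightarrow> real^2 \<Rightarrow> real" where
  "density A u g x = (A x *v g x) \<bullet> g x / 2 + lam * (indicator K x * \<bar>u x - f x\<bar> powr t)"

definition energy :: "(real^2 \<Rightarrow> real^2^2) \<Rightarrow> (real^2 \<Rightarrow> real) \<Rightarrow> real" where
  "energy A u = (LINT x|M. density A u (G u) x)"

lemma open_dom: "open \<Omega>" and dom_ne: "\<Omega> \<noteq> {}" and dom_sets: "\<Omega> \<in> sets lebesgue"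
  using lipschitz by (auto simp: lipschitz_domain_def)

lemma compact_closure: "compact (closure \<Omega>)" "closure \<Omega> \<noteq> {}"
  using bdd dom_ne by auto

lemma finite_M: "finite_measure M"
  using bdd dom_sets by (rule finite_measure_lebesgue_on_bounded)

lemma K_sets_M [measurable]: "K \<in> sets M"
  using K(1,2) dom_sets by (simp add: sets_restrict_space_iff)

lemma measure_K_pos: "measure M K > 0"
proof -
  have "emeasure M K = emeasure lebesgue K" using K(2) dom_sets by (simp add: emeasure_restrict_space)
  then have "emeasure M K > 0" using K(3) by simp
  then show ?thesis using finite_measure.emeasure_eq_measure[OF finite_M, of K] by simp
qed

lemma measure_dom_pos: "measure lebesgue \<Omega> > 0"
proof -
  have "measure M K \<le> measure M (space M)" by (rule finite_measure.bounded_measure[OF finite_M])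
  also have "measure M (space M) = measure lebesgue \<Omega>" using dom_sets by (simp add: measure_restrict_space)
  finally show ?thesis using measure_K_pos by linarith
qed

lemma integrable_const_M [simp]: "integrable M (\<lambda>x. c::real)"
  using finite_measure.integrable_const[OF finite_M] .

lemma integral_const_M: "(LINT x|M. (c::real)) = c * measure lebesgue \<Omega>"
proof -
  interpret finite_measure M by (rule finite_M)
  show ?thesis using dom_sets by (simp add: measure_restrict_space mult.commute)
qed

lemma integrable_indicator_K: "integrable M h \<Longrightarrow> integrable M (\<lambda>x. indicator K x * h x)" for h :: "real^2 \<Rightarrow> real"
  using integrable_mult_indicator[OF K_sets_M, of h] by simp

lemma V_D:
  assumes "u \<in> V"
  shows "u \<in> borel_measurable M" "integrable M u" "integrable M (\<lambda>x. (u x)\<^sup>2)" "G u \<in> Lp 2 \<Omega>"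
    "G u \<in> borel_measurable M" "integrable M (\<lambda>x. (norm (G u x))\<^sup>2)" "u \<in> Lp 2 \<Omega>"
    "integrable M (\<lambda>x. \<bar>u x\<bar> powr t)"
  using W12_D[OF assms] Lp_2_integrable[OF W12_D(1)[OF assms] bdd dom_sets]
    W12_powr_integrable[OF _ lipschitz bdd assms, of t] t
  by (auto simp: Lp_2_iff)

lemma V_lincomb: "u \<in> V \<Longrightarrow> v \<in> V \<Longrightarrow> (\<lambda>x. a * u x + b * v x) \<in> V"
  by (rule W12_lincomb(1)[OF open_dom bdd])

lemma G_lincomb: "u \<in> V \<Longrightarrow> v \<in> V \<Longrightarrow> AE x in M. G (\<lambda>x. a * u x + b * v x) x = a *\<^sub>R G u x + b *\<^sub>R G v x"
  by (rule W12_lincomb(2)[OF open_dom bdd])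

lemma V_diff: "u \<in> V \<Longrightarrow> v \<in> V \<Longrightarrow> (\<lambda>x. u x - v x) \<in> V"
  using V_lincomb[of u v 1 "-1"] by simp

lemma G_diff: "u \<in> V \<Longrightarrow> v \<in> V \<Longrightarrow> AE x in M. G (\<lambda>x. u x - v x) x = G u x - G v x"
  using G_lincomb[of u v 1 "-1"] by simp

lemma V_zero: "(\<lambda>x. 0) \<in> V" "AE x in M. G (\<lambda>x. 0) x = 0"
proof -
  have L: "(\<lambda>x. 0::real) \<in> Lp 2 \<Omega>" "(\<lambda>x. 0::real^2) \<in> Lp 2 \<Omega>" by (simp_all add: Lp_2_iff)
  then have "has_weak_gradient \<Omega> (\<lambda>x. 0) (\<lambda>x. 0)" by (simp add: has_weak_gradient_def)
  then show "(\<lambda>x. 0) \<in> V" "AE x in M. G (\<lambda>x. 0) x = 0"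
    using W12_weak_grad_eq[OF open_dom bdd L(1)] by auto
qed

abbreviation "Coef \<equiv> C0_sym_posdef (closure \<Omega>)"

lemma Coef_measurable:
  assumes A: "A \<in> Coef" and g: "g \<in> borel_measurable M" "h \<in> borel_measurable M"
  shows "(\<lambda>x. (A x *v g x) \<bullet> h x) \<in> borel_measurable M"
proof -
  have cA: "continuous_on \<Omega> A" using A closure_subset[of \<Omega>] by (auto simp: C0_sym_posdef_def intro: continuous_on_subset)
  have "(\<lambda>x. A x $ i $ j) \<in> borel_measurable M" for i j
    by (rule continuous_imp_measurable_on_sets_lebesgue[OF _ dom_sets]) (intro continuous_intros cA)
  moreover have "(\<lambda>x. g x $ j) \<in> borel_measurable M" "(\<lambda>x. h x $ j) \<in> borel_measurable M" for j
    using g by (auto simp: cart_eq_inner_axis intro: borel_measurable_inner)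
  ultimately show ?thesis unfolding inner_matrix_vector_sum by (intro borel_measurable_sum borel_measurable_times)
qed

lemma form_integrable:
  assumes A: "A \<in> Coef" and g: "g \<in> Lp 2 \<Omega>" "h \<in> Lp 2 \<Omega>"
  shows "integrable M (\<lambda>x. (A x *v g x) \<bullet> h x)"
proof -
  obtain b where b: "b > 0" "\<And>x. x \<in> closure \<Omega> \<Longrightarrow> norm (A x) \<le> b" using C0_sym_posdef_bounded[OF compact_closure(1) A] by blast
  have "integrable M (\<lambda>x. b * ((norm (g x))\<^sup>2 + (norm (h x))\<^sup>2))" using g by (simp add: Lp_2_iff)
  then show ?thesis
  proof (rule Bochner_Integration.integrable_bound)
    show "(\<lambda>x. (A x *v g x) \<bullet> h x) \<in> borel_measurable M" using g by (intro Coef_measurable A) (auto simp: Lp_2_iff)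
    show "AE x in M. norm ((A x *v g x) \<bullet> h x) \<le> norm (b * ((norm (g x))\<^sup>2 + (norm (h x))\<^sup>2))"
    proof (rule AE_I2)
      fix x assume "x \<in> space M"
      then have "x \<in> closure \<Omega>" using closure_subset[of \<Omega>] by (auto simp: space_restrict_space)
      then have "norm (A x) * norm (g x) * norm (h x) \<le> b * (norm (g x) * norm (h x))"
        using b(2) by (simp add: mult.assoc mult_right_mono)
      also have "\<dots> \<le> b * ((norm (g x))\<^sup>2 + (norm (h x))\<^sup>2)"
      proof (rule mult_left_mono)
        have "0 \<le> norm (g x) * norm (h x)" by simp
        then show "norm (g x) * norm (h x) \<le> (norm (g x))\<^sup>2 + (norm (h x))\<^sup>2"
          using sum_squares_bound[of "norm (g x)" "norm (h x)"] by linarith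
      qed (use b(1) in simp)
      finally have "\<bar>(A x *v g x) \<bullet> h x\<bar> \<le> b * ((norm (g x))\<^sup>2 + (norm (h x))\<^sup>2)"
        using inner_matrix_vector_le[of "A x" "g x" "h x"] by linarith
      then show "norm ((A x *v g x) \<bullet> h x) \<le> norm (b * ((norm (g x))\<^sup>2 + (norm (h x))\<^sup>2))" by simp
    qed
  qed
qed

lemma data_integrable:
  assumes "u \<in> V" shows "integrable M (\<lambda>x. indicator K x * \<bar>u x - f x\<bar> powr t)"
proof (rule integrable_indicator_K)
  have "integrable M (\<lambda>x. 2 powr t * (\<bar>u x\<bar> powr t + \<bar>f x\<bar> powr t))"
    using V_D[OF assms] f_integrable by simp
  then show "integrable M (\<lambda>x. \<bar>u x - f x\<bar> powr t)"
  proof (rule Bochner_Integration.integrable_bound)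
    show "(\<lambda>x. \<bar>u x - f x\<bar> powr t) \<in> borel_measurable M" using V_D(1)[OF assms] by simp
    show "AE x in M. norm (\<bar>u x - f x\<bar> powr t) \<le> norm (2 powr t * (\<bar>u x\<bar> powr t + \<bar>f x\<bar> powr t))"
      using powr_abs_add_le[of t "u x" "- f x" for x] t by (intro AE_I2) (simp add: abs_mult)
  qed
qed

lemma density_integrable:
  assumes "A \<in> Coef" "u \<in> V" shows "integrable M (density A u (G u))"
  unfolding density_def[abs_def] using form_integrable[OF assms(1) V_D(4)[OF assms(2)] V_D(4)[OF assms(2)]] data_integrable[OF assms(2)]
  by simp

lemma energy_eq:
  assumes "A \<in> Coef" "u \<in> V"
  shows "energy A u = form A (G u) (G u) / 2 + lam * (LINT x|M. indicator K x * \<bar>u x - f x\<bar> powr t)"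
  unfolding energy_def density_def form_def
  using form_integrable[OF assms(1) V_D(4)[OF assms(2)] V_D(4)[OF assms(2)]] data_integrable[OF assms(2)]
  by simp

lemma data_nonneg: "0 \<le> (LINT x|M. indicator K x * \<bar>u x - f x\<bar> powr t)"
  by (rule Bochner_Integration.integral_nonneg) simp

lemma form_nonneg:
  assumes "A \<in> Coef" shows "0 \<le> form A g g"
  unfolding form_def
proof (rule integral_nonneg_AE, rule AE_I2)
  fix x assume "x \<in> space M"
  then have "x \<in> closure \<Omega>" using closure_subset[of \<Omega>] by (auto simp: space_restrict_space)
  then show "0 \<le> (A x *v g x) \<bullet> g x"
    using assms by (cases "g x = 0") (auto simp: C0_sym_posdef_def sym_posdef_def intro!: less_imp_le)
qed

lemma form_elliptic:
  assumes A: "A \<in> Coef" and \<alpha>: "\<And>x Q. x \<in> closure \<Omega> \<Longrightarrow> \<alpha> * (norm Q)\<^sup>2 \<le> (A x *v Q) \<bullet> Q" and g: "g \<in> Lp 2 \<Omega>"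
  shows "\<alpha> * (LINT x|M. (norm (g x))\<^sup>2) \<le> form A g g"
proof -
  have "\<alpha> * (LINT x|M. (norm (g x))\<^sup>2) = (LINT x|M. \<alpha> * (norm (g x))\<^sup>2)" by simp
  also have "\<dots> \<le> form A g g"
    unfolding form_def
  proof (rule integral_mono)
    show "integrable M (\<lambda>x. \<alpha> * (norm (g x))\<^sup>2)" using g by (simp add: Lp_2_iff)
    show "integrable M (\<lambda>x. (A x *v g x) \<bullet> g x)" by (rule form_integrable[OF A g g])
    fix x assume "x \<in> space M"
    then have "x \<in> closure \<Omega>" using closure_subset[of \<Omega>] by (auto simp: space_restrict_space)
    then show "\<alpha> * (norm (g x))\<^sup>2 \<le> (A x *v g x) \<bullet> g x" by (rule \<alpha>)
  qed
  finally show ?thesis .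
qed

lemma energy_nonneg: "A \<in> Coef \<Longrightarrow> u \<in> V \<Longrightarrow> 0 \<le> energy A u"
  using energy_eq form_nonneg data_nonneg lam by simp

lemma energy_gradient_bound:
  assumes A: "A \<in> Coef" and \<alpha>: "\<And>x Q. x \<in> closure \<Omega> \<Longrightarrow> \<alpha> * (norm Q)\<^sup>2 \<le> (A x *v Q) \<bullet> Q" and u: "u \<in> V"
  shows "\<alpha> * (LINT x|M. (norm (G u x))\<^sup>2) \<le> 2 * energy A u"
  using form_elliptic[OF A \<alpha> V_D(4)[OF u]] energy_eq[OF A u] mult_nonneg_nonneg[OF less_imp_le[OF lam] data_nonneg[of u]] by simp

text \<open>The parallelogram identity turns the quadratic parts into a quarter of the form at
  \<open>G u - G v\<close>, and the data terms are midpoint convex. So the energy gap between two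
  functions and their midpoint bounds the distance of the gradients.\<close>

lemma energy_parallelogram:
  assumes A: "A \<in> Coef" and \<alpha>: "\<And>x Q. x \<in> closure \<Omega> \<Longrightarrow> \<alpha> * (norm Q)\<^sup>2 \<le> (A x *v Q) \<bullet> Q"
    and u: "u \<in> V" and v: "v \<in> V"
  shows "\<alpha> * (LINT x|M. (norm (G u x - G v x))\<^sup>2) \<le> 4 * (energy A u + energy A v - 2 * energy A (\<lambda>x. 1/2 * u x + 1/2 * v x))"
proof -
  let ?w = "\<lambda>x. 1/2 * u x + 1/2 * v x"
  have w: "?w \<in> V" by (rule V_lincomb[OF u v])
  have Ld: "(\<lambda>x. G u x - G v x) \<in> Lp 2 \<Omega>" by (intro Lp_2_diff V_D(4) u v)
  note i = density_integrable[OF A u] density_integrable[OF A v] density_integrable[OF A w]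
  have "\<alpha> * (LINT x|M. (norm (G u x - G v x))\<^sup>2) = (LINT x|M. \<alpha> * (norm (G u x - G v x))\<^sup>2)" by simp
  also have "\<dots> \<le> (LINT x|M. 4 * (density A u (G u) x + density A v (G v) x - 2 * density A ?w (G ?w) x))"
  proof (rule integral_mono_AE)
    show "integrable M (\<lambda>x. \<alpha> * (norm (G u x - G v x))\<^sup>2)" using Ld by (simp add: Lp_2_iff)
    show "integrable M (\<lambda>x. 4 * (density A u (G u) x + density A v (G v) x - 2 * density A ?w (G ?w) x))"
      using i by simp
    show "AE x in M. \<alpha> * (norm (G u x - G v x))\<^sup>2 \<le> 4 * (density A u (G u) x + density A v (G v) x - 2 * density A ?w (G ?w) x)"
      using G_lincomb[OF u v, of "1/2" "1/2"] AE_space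
    proof eventually_elim
      case (elim x)
      then have x: "x \<in> closure \<Omega>" using closure_subset[of \<Omega>] by (auto simp: space_restrict_space)
      define a where "a = G u x"
      define b where "b = G v x"
      have Gw: "G ?w x = (1/2) *\<^sub>R (a + b)" using elim(1) by (simp add: a_def b_def scaleR_add_right)
      have "(A x *v a) \<bullet> a / 2 + (A x *v b) \<bullet> b / 2 - 2 * ((A x *v G ?w x) \<bullet> G ?w x / 2) = (A x *v (a - b)) \<bullet> (a - b) / 4"
        unfolding Gw
        by (simp add: matrix_vector_mult_scaleR matrix_vector_right_distrib matrix_vector_mult_diff_distrib inner_add_left inner_add_right inner_diff_left inner_diff_right field_simps)
      moreover have "\<alpha> * (norm (a - b))\<^sup>2 \<le> (A x *v (a - b)) \<bullet> (a - b)" by (rule \<alpha>[OF x])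
      moreover have "lam * (indicator K x * (2 * \<bar>?w x - f x\<bar> powr t)) \<le> lam * (indicator K x * (\<bar>u x - f x\<bar> powr t + \<bar>v x - f x\<bar> powr t))"
        using powr_midpoint_convex[OF t, of "u x - f x" "v x - f x"] lam
        by (intro mult_left_mono) (simp_all add: field_simps)
      ultimately show ?case unfolding density_def a_def[symmetric] b_def[symmetric] by (simp add: algebra_simps)
    qed
  qed
  also have "\<dots> = 4 * (energy A u + energy A v - 2 * energy A ?w)"
    using i by (simp add: energy_def)
  finally show ?thesis .
qed


section \<open>Coercivity and compactness of minimising sequences\<close>

definition mean :: "(real^2 \<Rightarrow> real) \<Rightarrow> real" where
  "mean u = (LINT x|M. u x) / measure lebesgue \<Omega>"

definition poincare_const :: real where
  "poincare_const = (SOME C. C \<ge> 0 \<and> (\<forall>u\<in>V. (LINT x|M. (u x - mean u)\<^sup>2) \<le> C * (LINT x|M. (norm (G u x))\<^sup>2)))"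

lemma poincare_const: "poincare_const \<ge> 0"
  "u \<in> V \<Longrightarrow> (LINT x|M. (u x - mean u)\<^sup>2) \<le> poincare_const * (LINT x|M. (norm (G u x))\<^sup>2)"
proof -
  have "\<exists>C. C \<ge> 0 \<and> (\<forall>u\<in>V. (LINT x|M. (u x - mean u)\<^sup>2) \<le> C * (LINT x|M. (norm (G u x))\<^sup>2))"
    using poincare_mean[OF _ lipschitz bdd] unfolding mean_def by simp
  from someI_ex[OF this, folded poincare_const_def]
  show "poincare_const \<ge> 0" "u \<in> V \<Longrightarrow> (LINT x|M. (u x - mean u)\<^sup>2) \<le> poincare_const * (LINT x|M. (norm (G u x))\<^sup>2)" by auto
qed

lemma centred_square_integrable: "u \<in> V \<Longrightarrow> integrable M (\<lambda>x. (u x - c)\<^sup>2)"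
  using V_D(2,3)[of u] by (simp add: power2_diff)

text \<open>The function is split into its mean and its fluctuation, and the latter is bounded by
  the Poincare inequality.\<close>

lemma square_integral_bound:
  assumes u: "u \<in> V"
  shows "(LINT x|M. (u x)\<^sup>2) \<le> 2 * poincare_const * (LINT x|M. (norm (G u x))\<^sup>2) + 2 * measure lebesgue \<Omega> * (mean u)\<^sup>2"
proof -
  have "(LINT x|M. (u x)\<^sup>2) \<le> (LINT x|M. 2 * (u x - mean u)\<^sup>2 + 2 * (mean u)\<^sup>2)"
  proof (rule integral_mono)
    fix x
    have "0 \<le> (u x - 2 * mean u)\<^sup>2" by simp
    then show "(u x)\<^sup>2 \<le> 2 * (u x - mean u)\<^sup>2 + 2 * (mean u)\<^sup>2"
      by (simp add: power2_eq_square algebra_simps)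
  qed (use V_D(3)[OF u] centred_square_integrable[OF u] in simp_all)
  also have "\<dots> = 2 * (LINT x|M. (u x - mean u)\<^sup>2) + 2 * (mean u)\<^sup>2 * measure lebesgue \<Omega>"
    using centred_square_integrable[OF u, of "mean u"] integral_const_M[of "2 * (mean u)\<^sup>2"] by simp
  finally show ?thesis using poincare_const(2)[OF u] by (simp add: mult_ac)
qed

lemma mean_diff: "u \<in> V \<Longrightarrow> v \<in> V \<Longrightarrow> mean (\<lambda>x. u x - v x) = mean u - mean v"
  using V_D(2) by (simp add: mean_def diff_divide_distrib)

lemma gradient_diff_integral:
  assumes "u \<in> V" "v \<in> V"
  shows "(LINT x|M. (norm (G (\<lambda>x. u x - v x) x))\<^sup>2) = (LINT x|M. (norm (G u x - G v x))\<^sup>2)"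
proof (rule integral_cong_AE)
  show "AE x in M. (norm (G (\<lambda>x. u x - v x) x))\<^sup>2 = (norm (G u x - G v x))\<^sup>2"
    using G_diff[OF assms] by eventually_elim simp
qed (use V_D(5)[OF V_diff[OF assms]] V_D(5)[OF assms(1)] V_D(5)[OF assms(2)] in simp_all)

text \<open>On \<open>K\<close> the modulus of the mean is at most |u - mean u| + |u - f| + |f|.
  Each summand is bounded by 1 plus its square or its t-th power, which accounts for the 3. As
  \<open>K\<close> has positive measure, this bounds the mean by the fluctuation and the data
  term.\<close>

lemma mean_bound:
  assumes u: "u \<in> V"
  shows "\<bar>mean u\<bar> * measure M K \<le> 3 * measure lebesgue \<Omega> + (LINT x|M. (u x - mean u)\<^sup>2)
    + (LINT x|M. indicator K x * \<bar>u x - f x\<bar> powr t) + (LINT x|M. \<bar>f x\<bar> powr t)"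
proof -
  interpret finite_measure M by (rule finite_M)
  have powr_bound: "y \<le> 1 + y powr t" if "y \<ge> 0" for y :: real
  proof (cases "y \<le> 1")
    case True
    then show ?thesis by (smt (verit) powr_ge_zero)
  next
    case False
    then have "y powr 1 \<le> y powr t" using t by (intro powr_mono) auto
    then show ?thesis using False by simp
  qed
  have sq_bound: "\<bar>a\<bar> \<le> 1 + a\<^sup>2" for a :: real
  proof -
    have "0 \<le> (\<bar>a\<bar> - 1)\<^sup>2 + \<bar>a\<bar>" by simp
    then show ?thesis by (simp add: power2_diff)
  qed
  have "\<bar>mean u\<bar> * measure M K = (LINT x|M. \<bar>mean u\<bar> * indicator K x)"
    using K(2) by (simp add: space_restrict_space Int_absorb2)
  also have "\<dots> \<le> (LINT x|M. 3 + (u x - mean u)\<^sup>2 + indicator K x * \<bar>u x - f x\<bar> powr t + \<bar>f x\<bar> powr t)"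
  proof (rule integral_mono)
    show "integrable M (\<lambda>x. \<bar>mean u\<bar> * indicator K x)" by (intro integrable_mult_right integrable_real_indicator) (auto simp: emeasure_eq_measure)
    show "integrable M (\<lambda>x. 3 + (u x - mean u)\<^sup>2 + indicator K x * \<bar>u x - f x\<bar> powr t + \<bar>f x\<bar> powr t)"
      using centred_square_integrable[OF u] data_integrable[OF u] f_integrable by simp
    fix x
    show "\<bar>mean u\<bar> * indicator K x \<le> 3 + (u x - mean u)\<^sup>2 + indicator K x * \<bar>u x - f x\<bar> powr t + \<bar>f x\<bar> powr t"
    proof (cases "x \<in> K")
      case True
      have "\<bar>u x - mean u\<bar> \<le> 1 + (u x - mean u)\<^sup>2"
        by (rule sq_bound)
      moreover have "\<bar>u x - f x\<bar> \<le> 1 + \<bar>u x - f x\<bar> powr t" "\<bar>f x\<bar> \<le> 1 + \<bar>f x\<bar> powr t" by (intro powr_bound; simp)+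
      ultimately show ?thesis using True by simp
    next
      case False
      then show ?thesis by (simp add: add_nonneg_nonneg)
    qed
  qed
  also have "\<dots> = 3 * measure lebesgue \<Omega> + (LINT x|M. (u x - mean u)\<^sup>2)
    + (LINT x|M. indicator K x * \<bar>u x - f x\<bar> powr t) + (LINT x|M. \<bar>f x\<bar> powr t)"
    using centred_square_integrable[OF u, of "mean u"] data_integrable[OF u] f_integrable integral_const_M[of 3] by simp
  finally show ?thesis .
qed

lemma density_nonneg: "A \<in> Coef \<Longrightarrow> x \<in> \<Omega> \<Longrightarrow> 0 \<le> density A u g x"
proof -
  assume A: "A \<in> Coef" and "x \<in> \<Omega>"
  then have "x \<in> closure \<Omega>" using closure_subset by blast
  then have "0 \<le> (A x *v g x) \<bullet> g x"
    using A by (cases "g x = 0") (auto simp: C0_sym_posdef_def sym_posdef_def intro!: less_imp_le)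
  then show ?thesis using lam by (simp add: density_def)
qed

lemma energy_nn_integral:
  "A \<in> Coef \<Longrightarrow> u \<in> V \<Longrightarrow> (\<integral>\<^sup>+x. ennreal (density A u (G u) x) \<partial>M) = ennreal (energy A u)"
  unfolding energy_def
  by (intro nn_integral_eq_integral density_integrable) (auto intro!: AE_I2 density_nonneg simp: space_restrict_space)

text \<open>Lower semicontinuity through Fatou's lemma: the densities are nonnegative and converge
  pointwise, whether or not the data integrals converge.\<close>

lemma energy_fatou:
  assumes A: "A \<in> Coef" and v: "\<And>n. v n \<in> V" and u: "u \<in> V"
    and lim: "AE x in M. (\<lambda>n. v n x) \<longlonglongrightarrow> u x" "AE x in M. (\<lambda>n. G (v n) x) \<longlonglongrightarrow> G u x"
    and m: "(\<lambda>n. energy A (v n)) \<longlonglongrightarrow> m"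
  shows "energy A u \<le> m"
proof -
  have m0: "0 \<le> m" by (rule LIMSEQ_le_const[OF m]) (use energy_nonneg[OF A v] in auto)
  have "ennreal (energy A u) = (\<integral>\<^sup>+x. ennreal (density A u (G u) x) \<partial>M)" by (rule energy_nn_integral[OF A u, symmetric])
  also have "\<dots> = (\<integral>\<^sup>+x. liminf (\<lambda>n. ennreal (density A (v n) (G (v n)) x)) \<partial>M)"
  proof (rule nn_integral_cong_AE)
    show "AE x in M. ennreal (density A u (G u) x) = liminf (\<lambda>n. ennreal (density A (v n) (G (v n)) x))"
      using lim
    proof eventually_elim
      case (elim x)
      have "(\<lambda>n. A x *v G (v n) x) \<longlonglongrightarrow> A x *v G u x"
        by (rule bounded_linear.tendsto[OF matrix_vector_mul_bounded_linear elim(2)])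
      then have "(\<lambda>n. (A x *v G (v n) x) \<bullet> G (v n) x / 2 + lam * (indicator K x * \<bar>v n x - f x\<bar> powr t))
          \<longlonglongrightarrow> (A x *v G u x) \<bullet> G u x / 2 + lam * (indicator K x * \<bar>u x - f x\<bar> powr t)"
        using t by (intro tendsto_intros elim tendsto_powr') auto
      then have "(\<lambda>n. ennreal (density A (v n) (G (v n)) x)) \<longlonglongrightarrow> ennreal (density A u (G u) x)"
        unfolding density_def by (rule tendsto_ennrealI)
      from lim_imp_Liminf[OF trivial_limit_sequentially this] show ?case by (rule sym)
    qed
  qed
  also have "\<dots> \<le> liminf (\<lambda>n. \<integral>\<^sup>+x. ennreal (density A (v n) (G (v n)) x) \<partial>M)"
    by (rule nn_integral_liminf) (use density_integrable[OF A v] in \<open>auto dest!: borel_measurable_integrable\<close>)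
  also have "\<dots> = liminf (\<lambda>n. ennreal (energy A (v n)))" by (simp add: energy_nn_integral[OF A v])
  also have "\<dots> = ennreal m" by (intro lim_imp_Liminf trivial_limit_sequentially tendsto_ennrealI m)
  finally show ?thesis using m0 by simp
qed

lemma W12_norm_tendsto_0:
  assumes v: "\<And>n. v n \<in> V" and u: "u \<in> V"
    and 1: "(\<lambda>n. \<integral>\<^sup>+x. ennreal ((norm (v n x - u x))\<^sup>2) \<partial>M) \<longlonglongrightarrow> 0"
    and 2: "(\<lambda>n. \<integral>\<^sup>+x. ennreal ((norm (G (v n) x - G u x))\<^sup>2) \<partial>M) \<longlonglongrightarrow> 0"
  shows "(\<lambda>n. W12_norm \<Omega> (\<lambda>x. v n x - u x)) \<longlonglongrightarrow> 0"
proof -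
  have "(\<lambda>n. ennreal (LINT x|M. (norm (v n x - u x))\<^sup>2)) \<longlonglongrightarrow> ennreal 0"
    using 1 Lp_2_nn_integral[OF Lp_2_diff[OF V_D(7)[OF v] V_D(7)[OF u]]] by simp
  then have 3: "(\<lambda>n. LINT x|M. (v n x - u x)\<^sup>2) \<longlonglongrightarrow> 0"
    by (subst (asm) tendsto_ennreal_iff) auto
  have "(\<lambda>n. ennreal (LINT x|M. (norm (G (v n) x - G u x))\<^sup>2)) \<longlonglongrightarrow> ennreal 0"
    using 2 Lp_2_nn_integral[OF Lp_2_diff[OF V_D(4)[OF v] V_D(4)[OF u]]] by simp
  then have 4: "(\<lambda>n. LINT x|M. (norm (G (v n) x - G u x))\<^sup>2) \<longlonglongrightarrow> 0"
    by (subst (asm) tendsto_ennreal_iff) auto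
  have "(W12_norm \<Omega> (\<lambda>x. v n x - u x))\<^sup>2 = (LINT x|M. (v n x - u x)\<^sup>2) + (LINT x|M. (norm (G (v n) x - G u x))\<^sup>2)" for n
    unfolding W12_norm_squared gradient_diff_integral[OF v u] ..
  then have "(\<lambda>n. (W12_norm \<Omega> (\<lambda>x. v n x - u x))\<^sup>2) \<longlonglongrightarrow> 0" using tendsto_add[OF 3 4] by simp
  then have "(\<lambda>n. sqrt ((W12_norm \<Omega> (\<lambda>x. v n x - u x))\<^sup>2)) \<longlonglongrightarrow> sqrt 0" by (rule tendsto_real_sqrt)
  then show ?thesis by (simp add: W12_norm_def)
qed

text \<open>The gradients are Cauchy along the whole sequence, but the means are merely bounded, so
  a subsequence has to be extracted before the functions become Cauchy. The limit attains the lower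
  bound \<open>m\<close>.\<close>

lemma minimizing_sequence_compact:
  assumes A: "A \<in> Coef" and un: "\<And>n. un n \<in> V" and m: "\<And>v. v \<in> V \<Longrightarrow> m \<le> energy A v"
    and lim: "(\<lambda>n. energy A (un n)) \<longlonglongrightarrow> m"
  shows "\<exists>u\<in>V. \<exists>r. strict_mono (r::nat\<Rightarrow>nat) \<and> energy A u \<le> m \<and> (\<lambda>n. W12_norm \<Omega> (\<lambda>x. un (r n) x - u x)) \<longlonglongrightarrow> 0"
proof -
  obtain \<alpha> where \<alpha>: "\<alpha> > 0" "\<And>x Q. x \<in> closure \<Omega> \<Longrightarrow> \<alpha> * (norm Q)\<^sup>2 \<le> (A x *v Q) \<bullet> Q"
    using C0_sym_posdef_elliptic[OF compact_closure A] by blast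
  define J where "J n = energy A (un n)" for n
  define D where "D i j = (LINT x|M. (norm (G (un i) x - G (un j) x))\<^sup>2)" for i j
  \<comment> \<open>The midpoint has energy at least \<open>m\<close>, so the gap in the
    parallelogram estimate is at most the sum of the two excesses over \<open>m\<close>.\<close>
  have D: "D i j \<le> (4 / \<alpha>) * ((J i - m) + (J j - m))" for i j
    using energy_parallelogram[OF A \<alpha>(2) un[of i] un[of j]] m[OF V_lincomb[OF un[of i] un[of j], of "1/2" "1/2"]] \<alpha>(1)
    by (simp add: D_def J_def field_simps)
  have Dc: "\<exists>N. \<forall>i\<ge>N. \<forall>j\<ge>N. D i j \<le> e" if "e > 0" for e
  proof -
    \<comment> \<open>Two excesses of e\<alpha>/8 each, times 4/\<alpha>, give e.\<close>
    have "m < m + e * \<alpha> / 8" using that \<alpha>(1) by simp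
    then have "\<forall>\<^sub>F n in sequentially. J n < m + e * \<alpha> / 8" using lim unfolding J_def by (intro order_tendstoD)
    then obtain N where N: "\<And>n. n \<ge> N \<Longrightarrow> J n < m + e * \<alpha> / 8" by (auto simp: eventually_sequentially)
    have "D i j \<le> e" if "i \<ge> N" "j \<ge> N" for i j
    proof -
      have "(4 / \<alpha>) * ((J i - m) + (J j - m)) \<le> (4 / \<alpha>) * (e * \<alpha> / 8 + e * \<alpha> / 8)"
        using N[OF that(1)] N[OF that(2)] \<alpha>(1) by (intro mult_left_mono add_mono) auto
      also have "\<dots> = e" using \<alpha>(1) by simp
      finally show ?thesis using D[of i j] by linarith
    qed
    then show ?thesis by blast
  qed
  have "Bseq J" using lim unfolding J_def[abs_def] by (intro convergent_imp_Bseq convergentI)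
  then obtain B where B: "\<And>n. J n \<le> B" unfolding Bseq_def by (auto intro: order_trans[OF abs_ge_self])
  \<comment> \<open>Both parts of the energy are nonnegative and their sum is at most
    \<open>B\<close>, so the gradient integral is at most 2B/\<alpha> and the data integral at most
    B divided by \<open>lam\<close>; \<open>mean_bound\<close> turns this into a bound of the
    mean.\<close>
  define R where "R = (3 * measure lebesgue \<Omega> + poincare_const * (2 * B / \<alpha>) + B / lam + (LINT x|M. \<bar>f x\<bar> powr t)) / measure M K"
  have "\<bar>mean (un n)\<bar> \<le> R" for n
  proof -
    have g: "(LINT x|M. (norm (G (un n) x))\<^sup>2) \<le> 2 * B / \<alpha>"
      using energy_gradient_bound[OF A \<alpha>(2) un[of n]] B[of n] \<alpha>(1) by (simp add: J_def field_simps)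
    have "(LINT x|M. (un n x - mean (un n))\<^sup>2) \<le> poincare_const * (2 * B / \<alpha>)"
      using poincare_const(2)[OF un[of n]] mult_left_mono[OF g poincare_const(1)] by linarith
    moreover have "(LINT x|M. indicator K x * \<bar>un n x - f x\<bar> powr t) \<le> B / lam"
      using energy_eq[OF A un[of n]] form_nonneg[OF A, of "G (un n)"] B[of n] lam by (simp add: J_def field_simps)
    ultimately have "\<bar>mean (un n)\<bar> * measure M K \<le> 3 * measure lebesgue \<Omega> + poincare_const * (2 * B / \<alpha>) + B / lam + (LINT x|M. \<bar>f x\<bar> powr t)"
      using mean_bound[OF un[of n]] by linarith
    then show ?thesis using measure_K_pos by (simp add: R_def field_simps)
  qed
  then have "bounded (range (\<lambda>n. mean (un n)))" by (intro boundedI[where B=R]) auto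
  then obtain c r1 where r1: "strict_mono (r1::nat\<Rightarrow>nat)" "((\<lambda>n. mean (un n)) \<circ> r1) \<longlonglongrightarrow> c"
    using bounded_imp_convergent_subsequence by blast
  have mC: "Cauchy (\<lambda>n. mean (un (r1 n)))" using r1(2) by (intro LIMSEQ_imp_Cauchy) (simp add: o_def)
  have ge: "n \<ge> N \<Longrightarrow> r1 n \<ge> N" for n N using seq_suble[OF r1(1), of n] by simp
  have cauchyV: "\<exists>N. \<forall>i\<ge>N. \<forall>j\<ge>N. (\<integral>\<^sup>+x. ennreal ((norm (un (r1 i) x - un (r1 j) x))\<^sup>2) \<partial>M) \<le> ennreal e" if e: "e > 0" for e
  proof -
    \<comment> \<open>Shares of e/2 for the gradient part and the mean part of
      \<open>square_integral_bound\<close>; the added 1 keeps the denominators positive.\<close>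
    define e1 where "e1 = e / (4 * (poincare_const + 1))"
    define e2 where "e2 = e / (4 * (measure lebesgue \<Omega> + 1))"
    have pos: "e1 > 0" "e2 > 0" using e poincare_const(1) by (auto simp: e1_def e2_def add_nonneg_pos)
    obtain N1 where N1: "\<And>i j. i \<ge> N1 \<Longrightarrow> j \<ge> N1 \<Longrightarrow> D i j \<le> e1" using Dc[OF pos(1)] by blast
    obtain N2 where N2: "\<And>i j. i \<ge> N2 \<Longrightarrow> j \<ge> N2 \<Longrightarrow> norm (mean (un (r1 i)) - mean (un (r1 j))) < sqrt e2"
      using CauchyD[OF mC, of "sqrt e2"] pos(2) by auto
    have "(\<integral>\<^sup>+x. ennreal ((norm (un (r1 i) x - un (r1 j) x))\<^sup>2) \<partial>M) \<le> ennreal e" if i: "i \<ge> max N1 N2" and j: "j \<ge> max N1 N2" for i j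
    proof -
      let ?w = "\<lambda>x. un (r1 i) x - un (r1 j) x"
      have w: "?w \<in> V" by (intro V_diff un)
      have g: "(LINT x|M. (norm (G ?w x))\<^sup>2) \<le> e1"
        unfolding gradient_diff_integral[OF un un] using N1[OF ge ge, of i j] i j by (simp add: D_def)
      have "(mean ?w)\<^sup>2 \<le> (sqrt e2)\<^sup>2"
        unfolding mean_diff[OF un un] using N2[of i j] i j
        by (subst power2_abs[symmetric]) (intro power_mono, auto)
      then have mw: "(mean ?w)\<^sup>2 \<le> e2" using pos(2) by simp
      have "(LINT x|M. (?w x)\<^sup>2) \<le> 2 * poincare_const * (LINT x|M. (norm (G ?w x))\<^sup>2) + 2 * measure lebesgue \<Omega> * (mean ?w)\<^sup>2"
        by (rule square_integral_bound[OF w])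
      also have "\<dots> \<le> 2 * poincare_const * e1 + 2 * measure lebesgue \<Omega> * e2"
        using poincare_const(1) by (intro add_mono mult_left_mono g mw) auto
      also have "\<dots> \<le> e / 2 + e / 2"
      proof (rule add_mono)
        show "2 * poincare_const * e1 \<le> e / 2"
          using e poincare_const(1) by (simp add: e1_def divide_simps)
        show "2 * measure lebesgue \<Omega> * e2 \<le> e / 2"
          using e measure_dom_pos by (simp add: e2_def divide_simps)
      qed
      finally have "(LINT x|M. (?w x)\<^sup>2) \<le> e" by simp
      then show ?thesis using Lp_2_nn_integral[OF V_D(7)[OF w]] by (simp add: ennreal_leI)
    qed
    then show ?thesis by blast
  qed
  have mV: "un n \<in> borel_measurable M" "G (un n) \<in> borel_measurable M" for n using V_D(1,5)[OF un] by auto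
  obtain l r2 where l: "l \<in> borel_measurable M" and r2: "strict_mono (r2::nat\<Rightarrow>nat)"
    "AE x in M. (\<lambda>n. un (r1 (r2 n)) x) \<longlonglongrightarrow> l x" and lL2: "(\<lambda>n. \<integral>\<^sup>+x. ennreal ((norm (un (r1 n) x - l x))\<^sup>2) \<partial>M) \<longlonglongrightarrow> 0"
    using L2_cauchy_converges[of "\<lambda>n. un (r1 n)" M, OF mV(1) cauchyV] by blast
  define q where "q n = r1 (r2 n)" for n
  have q: "strict_mono q" using r1(1) r2(1) by (simp add: q_def strict_mono_def)
  have geq: "n \<ge> N \<Longrightarrow> q n \<ge> N" for n N using seq_suble[OF q, of n] by simp
  have cauchyG: "\<exists>N. \<forall>i\<ge>N. \<forall>j\<ge>N. (\<integral>\<^sup>+x. ennreal ((norm (G (un (q i)) x - G (un (q j)) x))\<^sup>2) \<partial>M) \<le> ennreal e" if e: "e > 0" for e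
  proof -
    obtain N where N: "\<And>i j. i \<ge> N \<Longrightarrow> j \<ge> N \<Longrightarrow> D i j \<le> e" using Dc[OF e] by blast
    have "(\<integral>\<^sup>+x. ennreal ((norm (G (un (q i)) x - G (un (q j)) x))\<^sup>2) \<partial>M) \<le> ennreal e" if "i \<ge> N" "j \<ge> N" for i j
      using N[OF geq geq, OF that] Lp_2_nn_integral[OF Lp_2_diff[OF V_D(4)[OF un] V_D(4)[OF un]], of "q i" "q j"]
      by (simp add: D_def ennreal_leI)
    then show ?thesis by blast
  qed
  obtain g r3 where g: "g \<in> borel_measurable M" and r3: "strict_mono (r3::nat\<Rightarrow>nat)"
    "AE x in M. (\<lambda>n. G (un (q (r3 n))) x) \<longlonglongrightarrow> g x" and gL2: "(\<lambda>n. \<integral>\<^sup>+x. ennreal ((norm (G (un (q n)) x - g x))\<^sup>2) \<partial>M) \<longlonglongrightarrow> 0"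
    using L2_cauchy_converges[of "\<lambda>n. G (un (q n))" M, OF mV(2) cauchyG] by blast
  \<comment> \<open>The third extraction: after the means and the functions, the gradients converge
    almost everywhere. Fatou's lemma needs one common subsequence.\<close>
  define r where "r n = q (r3 n)" for n
  have r: "strict_mono r" using q r3(1) by (simp add: r_def strict_mono_def)
  have lr: "(\<lambda>n. \<integral>\<^sup>+x. ennreal ((norm (un (r n) x - l x))\<^sup>2) \<partial>M) \<longlonglongrightarrow> 0"
    using LIMSEQ_subseq_LIMSEQ[OF LIMSEQ_subseq_LIMSEQ[OF lL2 r2(1)] r3(1)] by (simp add: o_def r_def q_def)
  have gr: "(\<lambda>n. \<integral>\<^sup>+x. ennreal ((norm (G (un (r n)) x - g x))\<^sup>2) \<partial>M) \<longlonglongrightarrow> 0"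
    using LIMSEQ_subseq_LIMSEQ[OF gL2 r3(1)] by (simp add: o_def r_def)
  have lLp: "l \<in> Lp 2 \<Omega>" by (rule Lp_2_limit[OF V_D(7)[OF un] l lr])
  have gLp: "g \<in> Lp 2 \<Omega>" by (rule Lp_2_limit[OF V_D(4)[OF un] g gr])
  have "has_weak_gradient \<Omega> l g"
    by (rule has_weak_gradient_closed[OF open_dom bdd V_D(7)[OF un] W12_D(2)[OF un] lLp lr gLp gr])
  note lV = W12_weak_grad_eq[OF open_dom bdd lLp this]
  have "(\<lambda>n. \<integral>\<^sup>+x. ennreal ((norm (G (un (r n)) x - G l x))\<^sup>2) \<partial>M) \<longlonglongrightarrow> 0"
  proof -
    have "(\<integral>\<^sup>+x. ennreal ((norm (G (un (r n)) x - G l x))\<^sup>2) \<partial>M) = (\<integral>\<^sup>+x. ennreal ((norm (G (un (r n)) x - g x))\<^sup>2) \<partial>M)" for n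
    proof (rule nn_integral_cong_AE)
      show "AE x in M. ennreal ((norm (G (un (r n)) x - G l x))\<^sup>2) = ennreal ((norm (G (un (r n)) x - g x))\<^sup>2)"
        using lV(2) by eventually_elim simp
    qed
    then show ?thesis using gr by simp
  qed
  then have conv: "(\<lambda>n. W12_norm \<Omega> (\<lambda>x. un (r n) x - l x)) \<longlonglongrightarrow> 0"
    by (rule W12_norm_tendsto_0[OF un lV(1) lr])
  have "energy A l \<le> m"
  proof (rule energy_fatou[OF A un lV(1)])
    show "AE x in M. (\<lambda>n. un (r n) x) \<longlonglongrightarrow> l x"
      using r2(2)
    proof eventually_elim
      case (elim x)
      from LIMSEQ_subseq_LIMSEQ[OF this r3(1)] show ?case by (simp add: o_def r_def q_def)
    qed
    show "AE x in M. (\<lambda>n. G (un (r n)) x) \<longlonglongrightarrow> G l x"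
      using r3(2) lV(2) by eventually_elim (simp add: r_def)
    show "(\<lambda>n. energy A (un (r n))) \<longlonglongrightarrow> m"
      using LIMSEQ_subseq_LIMSEQ[OF lim r] by (simp add: o_def)
  qed
  with lV(1) r conv show ?thesis by blast
qed

section \<open>Existence of minimisers, the Euler-Lagrange equation and uniqueness\<close>

definition minimizer :: "(real^2 \<Rightarrow> real^2^2) \<Rightarrow> (real^2 \<Rightarrow> real) \<Rightarrow> bool" where
  "minimizer A u \<longleftrightarrow> u \<in> V \<and> (\<forall>v\<in>V. energy A u \<le> energy A v)"

lemma minimizer_exists:
  assumes A: "A \<in> Coef" shows "\<exists>u. minimizer A u"
proof -
  define m where "m = Inf (energy A ` V)"
  have bb: "bdd_below (energy A ` V)" using energy_nonneg[OF A] by (intro bdd_belowI2) auto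
  have mle: "m \<le> energy A v" if "v \<in> V" for v unfolding m_def using bb that by (intro cINF_lower)
  have "\<exists>v\<in>V. energy A v < m + 1 / Suc n" for n
  proof -
    have "m < m + 1 / Suc n" by simp
    then show ?thesis using V_zero(1) bb unfolding m_def by (subst (asm) cINF_less_iff) auto
  qed
  then obtain un where un: "\<And>n. un n \<in> V" "\<And>n. energy A (un n) < m + 1 / Suc n" by metis
  have "(\<lambda>n. energy A (un n)) \<longlonglongrightarrow> m"
  proof (rule tendsto_sandwich[where f = "\<lambda>_. m" and h = "\<lambda>n. m + 1 / Suc n"])
    show "(\<lambda>n. m + 1 / Suc n) \<longlonglongrightarrow> m"
      using tendsto_add[OF tendsto_const[of m] LIMSEQ_inverse_real_of_nat] by (simp add: inverse_eq_divide)
    show "\<forall>\<^sub>F n in sequentially. energy A (un n) \<le> m + 1 / Suc n" using un(2) by (intro always_eventually allI less_imp_le)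
    show "\<forall>\<^sub>F n in sequentially. m \<le> energy A (un n)" using mle[OF un(1)] by (intro always_eventually allI)
  qed simp
  from minimizing_sequence_compact[OF A un(1) mle this] obtain u where "u \<in> V" "energy A u \<le> m" by blast
  then have "minimizer A u" using mle by (force simp: minimizer_def)
  then show ?thesis by blast
qed

lemma test_integrable:
  assumes u: "u \<in> V" and \<phi>: "\<phi> \<in> V"
  shows "integrable M (\<lambda>x. indicator K x * (psi t (u x - f x) * \<phi> x))"
proof (rule integrable_indicator_K)
  have "integrable M (\<lambda>x. t * (2 powr t * (2 powr t * (\<bar>u x\<bar> powr t + \<bar>f x\<bar> powr t) + \<bar>\<phi> x\<bar> powr t)))"
    using V_D(8)[OF u] V_D(8)[OF \<phi>] f_integrable by simp
  then show "integrable M (\<lambda>x. psi t (u x - f x) * \<phi> x)"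
  proof (rule Bochner_Integration.integrable_bound)
    show "(\<lambda>x. psi t (u x - f x) * \<phi> x) \<in> borel_measurable M" using V_D(1)[OF u] V_D(1)[OF \<phi>] by measurable
    show "AE x in M. norm (psi t (u x - f x) * \<phi> x) \<le> norm (t * (2 powr t * (2 powr t * (\<bar>u x\<bar> powr t + \<bar>f x\<bar> powr t) + \<bar>\<phi> x\<bar> powr t)))"
    proof (rule AE_I2)
      fix x
      have t0: "t > 0" using t by simp
      have "\<bar>psi t (u x - f x) * \<phi> x\<bar> \<le> t * (\<bar>u x - f x\<bar> + \<bar>\<phi> x\<bar>) powr t" by (rule psi_mult_bound[OF t])
      also have "\<dots> \<le> t * (2 powr t * (\<bar>u x - f x\<bar> powr t + \<bar>\<phi> x\<bar> powr t))"
        using powr_abs_add_le[OF t0, of "\<bar>u x - f x\<bar>" "\<bar>\<phi> x\<bar>"] t by (intro mult_left_mono) auto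
      also have "\<dots> \<le> t * (2 powr t * (2 powr t * (\<bar>u x\<bar> powr t + \<bar>f x\<bar> powr t) + \<bar>\<phi> x\<bar> powr t))"
        using powr_abs_add_le[OF t0, of "u x" "- f x"] t by (intro mult_left_mono add_right_mono) auto
      finally show "norm (psi t (u x - f x) * \<phi> x) \<le> norm (t * (2 powr t * (2 powr t * (\<bar>u x\<bar> powr t + \<bar>f x\<bar> powr t) + \<bar>\<phi> x\<bar> powr t)))"
        by simp
    qed
  qed
qed


text \<open>Symmetry of the matrices makes the first variation of half the quadratic form equal to
  the form itself rather than to its symmetrisation.\<close>

lemma form_sym:
  assumes A: "A \<in> Coef" shows "form A g h = form A h g"
  unfolding form_def
proof (rule Bochner_Integration.integral_cong)
  fix x assume "x \<in> space M"
  then have "x \<in> closure \<Omega>" using closure_subset[of \<Omega>] by (auto simp: space_restrict_space)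
  then have "transpose (A x) = A x" using A by (auto simp: C0_sym_posdef_def sym_posdef_def)
  then have "(A x *v g x) \<bullet> h x = (g x v* A x) \<bullet> h x" by (metis transpose_matrix_vector)
  also have "\<dots> = g x \<bullet> (A x *v h x)" by (rule dot_lmul_matrix)
  finally show "(A x *v g x) \<bullet> h x = (A x *v h x) \<bullet> g x" by (simp only: inner_commute)
qed simp

lemma form_cong_AE:
  assumes A: "A \<in> Coef" and m: "g \<in> borel_measurable M" "h \<in> borel_measurable M" "g' \<in> borel_measurable M" "h' \<in> borel_measurable M"
    and eq: "AE x in M. g x = g' x" "AE x in M. h x = h' x"
  shows "form A g h = form A g' h'"
  unfolding form_def
proof (rule integral_cong_AE)
  show "AE x in M. (A x *v g x) \<bullet> h x = (A x *v g' x) \<bullet> h' x" using eq by eventually_elim simp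
qed (intro Coef_measurable A m)+

lemma form_lincomb_left:
  assumes A: "A \<in> Coef" and L: "g \<in> Lp 2 \<Omega>" "g' \<in> Lp 2 \<Omega>" "h \<in> Lp 2 \<Omega>"
  shows "form A (\<lambda>x. a *\<^sub>R g x + b *\<^sub>R g' x) h = a * form A g h + b * form A g' h"
proof -
  have "form A (\<lambda>x. a *\<^sub>R g x + b *\<^sub>R g' x) h = (LINT x|M. a * ((A x *v g x) \<bullet> h x) + b * ((A x *v g' x) \<bullet> h x))"
    unfolding form_def by (simp add: matrix_vector_right_distrib matrix_vector_mult_scaleR inner_add_left)
  also have "\<dots> = a * form A g h + b * form A g' h"
    unfolding form_def using form_integrable[OF A L(1,3)] form_integrable[OF A L(2,3)] by simp
  finally show ?thesis .
qed

lemma form_G_lincomb: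
  assumes A: "A \<in> Coef" and u: "u \<in> V" and v: "v \<in> V" and w: "w \<in> V"
  shows "form A (G (\<lambda>x. a * u x + b * v x)) (G w) = a * form A (G u) (G w) + b * form A (G v) (G w)"
proof -
  have "(\<lambda>x. a *\<^sub>R G u x + b *\<^sub>R G v x) \<in> borel_measurable M"
    using Lp_2_lincomb[OF V_D(4)[OF u] V_D(4)[OF v], of a b] by (simp add: Lp_2_iff)
  then have "form A (G (\<lambda>x. a * u x + b * v x)) (G w) = form A (\<lambda>x. a *\<^sub>R G u x + b *\<^sub>R G v x) (G w)"
    by (intro form_cong_AE A V_D(5) V_lincomb u v w G_lincomb) auto
  then show ?thesis using form_lincomb_left[OF A V_D(4)[OF u] V_D(4)[OF v] V_D(4)[OF w]] by simp
qed

text \<open>Variation with step \<open>s n = 1 / Suc n\<close>. The gradient inequality, taken at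
  the perturbed function, bounds the increase of the data term by \<open>s n\<close> times the
  integral of psi(v - f) \<phi> over \<open>K\<close>. After division by \<open>s n\<close>,
  continuity of \<open>psi\<close> and dominated convergence give the limit, and no difference
  quotient of the data term occurs.\<close>

lemma euler_lagrange_ineq:
  assumes A: "A \<in> Coef" and u: "minimizer A u" and \<phi>: "\<phi> \<in> V"
  shows "0 \<le> form A (G u) (G \<phi>) + lam * (LINT x|M. indicator K x * (psi t (u x - f x) * \<phi> x))"
proof -
  have uV: "u \<in> V" using u by (simp add: minimizer_def)
  define s where "s n = 1 / real (Suc n)" for n
  have s: "0 < s n" "s n \<le> 1" for n by (auto simp: s_def)
  have s0: "s \<longlonglongrightarrow> 0" using LIMSEQ_inverse_real_of_nat unfolding s_def by (simp only: inverse_eq_divide)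
  define v where "v n x = 1 * u x + s n * \<phi> x" for n x
  have vV: "v n \<in> V" for n unfolding v_def by (intro V_lincomb uV \<phi>)
  define I where "I n = (LINT x|M. indicator K x * (psi t (v n x - f x) * \<phi> x))" for n
  let ?I = "LINT x|M. indicator K x * (psi t (u x - f x) * \<phi> x)"
  have ge: "0 \<le> form A (G u) (G \<phi>) + s n / 2 * form A (G \<phi>) (G \<phi>) + lam * I n" for n
  proof -
    have vn: "v n = (\<lambda>x. 1 * u x + s n * \<phi> x)" by (simp add: v_def fun_eq_iff)
    have left: "form A (G (v n)) (G w) = form A (G u) (G w) + s n * form A (G \<phi>) (G w)" if "w \<in> V" for w
      unfolding vn using form_G_lincomb[OF A uV \<phi> that, of 1 "s n"] by simp
    have "form A (G (v n)) (G (v n)) = form A (G (v n)) (G u) + s n * form A (G (v n)) (G \<phi>)"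
      unfolding left[OF vV] form_sym[OF A, of "G u" "G (v n)"] form_sym[OF A, of "G \<phi>" "G (v n)"] ..
    also have "\<dots> = form A (G u) (G u) + s n * form A (G \<phi>) (G u) + s n * (form A (G u) (G \<phi>) + s n * form A (G \<phi>) (G \<phi>))"
      unfolding left[OF uV] left[OF \<phi>] ..
    finally have Q: "form A (G (v n)) (G (v n)) = form A (G u) (G u) + 2 * s n * form A (G u) (G \<phi>) + s n * s n * form A (G \<phi>) (G \<phi>)"
      using form_sym[OF A, of "G \<phi>" "G u"] by (simp add: algebra_simps)
    have "(LINT x|M. indicator K x * \<bar>v n x - f x\<bar> powr t) \<le> (LINT x|M. indicator K x * \<bar>u x - f x\<bar> powr t + s n * (indicator K x * (psi t (v n x - f x) * \<phi> x)))"
    proof (rule integral_mono)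
      show "integrable M (\<lambda>x. indicator K x * \<bar>v n x - f x\<bar> powr t)" by (rule data_integrable[OF vV])
      show "integrable M (\<lambda>x. indicator K x * \<bar>u x - f x\<bar> powr t + s n * (indicator K x * (psi t (v n x - f x) * \<phi> x)))"
        using data_integrable[OF uV] test_integrable[OF vV \<phi>] by simp
      fix x
      have "(u x - f x) - (v n x - f x) = - (s n * \<phi> x)" by (simp add: v_def)
      then have "\<bar>v n x - f x\<bar> powr t - s n * (psi t (v n x - f x) * \<phi> x) \<le> \<bar>u x - f x\<bar> powr t"
        using psi_gradient_inequality[OF t, of "v n x - f x" "u x - f x"] by (simp add: mult_ac)
      then show "indicator K x * \<bar>v n x - f x\<bar> powr t \<le> indicator K x * \<bar>u x - f x\<bar> powr t + s n * (indicator K x * (psi t (v n x - f x) * \<phi> x))"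
        by (simp add: indicator_def)
    qed
    also have "\<dots> = (LINT x|M. indicator K x * \<bar>u x - f x\<bar> powr t) + s n * I n"
      unfolding I_def using data_integrable[OF uV] test_integrable[OF vV \<phi>] by simp
    finally have P: "lam * (LINT x|M. indicator K x * \<bar>v n x - f x\<bar> powr t) \<le> lam * ((LINT x|M. indicator K x * \<bar>u x - f x\<bar> powr t) + s n * I n)"
      using lam by (intro mult_left_mono) auto
    have "energy A u \<le> energy A (v n)" using u vV by (simp add: minimizer_def)
    then have "0 \<le> s n * (form A (G u) (G \<phi>) + s n / 2 * form A (G \<phi>) (G \<phi>) + lam * I n)"
      using P unfolding energy_eq[OF A uV] energy_eq[OF A vV] Q by (simp add: algebra_simps add_divide_distrib)
    then show ?thesis using s(1)[of n] by (simp add: zero_le_mult_iff)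
  qed
  have "I \<longlonglongrightarrow> ?I"
    unfolding I_def
  proof (rule integral_dominated_convergence)
    \<comment> \<open>The dominating function: \<open>s n\<close> is at most 1, so |v - f| +
      |\<phi>| is at most |u - f| + 2|\<phi>|, and \<open>psi_mult_bound\<close> applies uniformly
      in \<open>n\<close>.\<close>
    let ?w = "\<lambda>x. t * (2 powr t * (2 powr t * (\<bar>u x\<bar> powr t + \<bar>f x\<bar> powr t) + 2 powr t * \<bar>\<phi> x\<bar> powr t))"
    show "integrable M ?w" using V_D(8)[OF uV] V_D(8)[OF \<phi>] f_integrable by simp
    show "(\<lambda>x. indicator K x * (psi t (u x - f x) * \<phi> x)) \<in> borel_measurable M"
      using test_integrable[OF uV \<phi>] by (rule borel_measurable_integrable)
    show "(\<lambda>x. indicator K x * (psi t (v n x - f x) * \<phi> x)) \<in> borel_measurable M" for n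
      using test_integrable[OF vV \<phi>] by (rule borel_measurable_integrable)
    show "AE x in M. (\<lambda>n. indicator K x * (psi t (v n x - f x) * \<phi> x)) \<longlonglongrightarrow> indicator K x * (psi t (u x - f x) * \<phi> x)"
    proof (rule AE_I2)
      fix x
      have "(\<lambda>n. v n x) \<longlonglongrightarrow> 1 * u x + 0 * \<phi> x" unfolding v_def by (intro tendsto_intros s0)
      then show "(\<lambda>n. indicator K x * (psi t (v n x - f x) * \<phi> x)) \<longlonglongrightarrow> indicator K x * (psi t (u x - f x) * \<phi> x)"
        by (intro tendsto_mult tendsto_const tendsto_psi[OF t] tendsto_diff) simp
    qed
    show "AE x in M. norm (indicator K x * (psi t (v n x - f x) * \<phi> x)) \<le> ?w x" for n
    proof (rule AE_I2)
      fix x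
      have t0: "t > 0" using t by simp
      have "\<bar>indicator K x * (psi t (v n x - f x) * \<phi> x)\<bar> \<le> \<bar>psi t (v n x - f x) * \<phi> x\<bar>" by (simp add: indicator_def)
      also have "\<dots> \<le> t * (\<bar>v n x - f x\<bar> + \<bar>\<phi> x\<bar>) powr t" by (rule psi_mult_bound[OF t])
      also have "\<dots> \<le> t * (\<bar>u x - f x\<bar> + 2 * \<bar>\<phi> x\<bar>) powr t"
      proof -
        have "\<bar>v n x - f x\<bar> \<le> \<bar>u x - f x\<bar> + \<bar>s n * \<phi> x\<bar>" by (simp add: v_def)
        also have "\<bar>s n * \<phi> x\<bar> \<le> \<bar>\<phi> x\<bar>" using s[of n] by (simp add: abs_mult mult_left_le_one_le)
        finally show ?thesis using t by (intro mult_left_mono powr_mono2) auto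
      qed
      also have "\<dots> \<le> t * (2 powr t * (\<bar>u x - f x\<bar> powr t + (2 * \<bar>\<phi> x\<bar>) powr t))"
        using powr_abs_add_le[OF t0, of "\<bar>u x - f x\<bar>" "2 * \<bar>\<phi> x\<bar>"] t by (intro mult_left_mono) auto
      also have "\<dots> \<le> ?w x"
        using powr_abs_add_le[OF t0, of "u x" "- f x"] t by (intro mult_left_mono add_mono) (auto simp: powr_mult)
      finally show "norm (indicator K x * (psi t (v n x - f x) * \<phi> x)) \<le> ?w x" by simp
    qed
  qed
  then have "(\<lambda>n. form A (G u) (G \<phi>) + s n / 2 * form A (G \<phi>) (G \<phi>) + lam * I n)
      \<longlonglongrightarrow> form A (G u) (G \<phi>) + 0 / 2 * form A (G \<phi>) (G \<phi>) + lam * ?I"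
    by (intro tendsto_intros s0) auto
  then have "0 \<le> form A (G u) (G \<phi>) + 0 / 2 * form A (G \<phi>) (G \<phi>) + lam * ?I"
    by (rule LIMSEQ_le_const) (use ge in blast)
  then show ?thesis by simp
qed

lemma euler_lagrange:
  assumes A: "A \<in> Coef" and u: "minimizer A u" and \<phi>: "\<phi> \<in> V"
  shows "form A (G u) (G \<phi>) + lam * (LINT x|M. indicator K x * (psi t (u x - f x) * \<phi> x)) = 0"
proof -
  have uV: "u \<in> V" using u by (simp add: minimizer_def)
  \<comment> \<open>The function -\<phi>, written as a linear combination so that the almost
    everywhere rule for weak gradients of combinations covers it.\<close>
  let ?m = "\<lambda>x. (-1) * \<phi> x + 0 * \<phi> x"
  have m: "?m \<in> V" by (intro V_lincomb \<phi>)
  have "form A (G u) (G ?m) = - form A (G u) (G \<phi>)"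
    using form_G_lincomb[OF A \<phi> \<phi> uV, of "-1" 0] form_sym[OF A, of "G u"] by simp
  moreover have "(LINT x|M. indicator K x * (psi t (u x - f x) * ?m x)) = - (LINT x|M. indicator K x * (psi t (u x - f x) * \<phi> x))"
    by simp
  ultimately show ?thesis
    using euler_lagrange_ineq[OF A u m] euler_lagrange_ineq[OF A u \<phi>] by simp
qed

text \<open>Subtracting the two Euler-Lagrange equations and testing with the difference leaves two
  nonnegative terms with sum zero. Ellipticity and the Poincare inequality make the difference
  constant, strict monotonicity of \<open>psi\<close> makes it zero on \<open>K\<close>, and
  \<open>K\<close> has positive measure. Equality is in the seminorm, as functions that agree almost
  everywhere are not identified.\<close>

lemma minimizer_unique:
  assumes A: "A \<in> Coef" and u: "minimizer A u" and v: "minimizer A v"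
  shows "W12_norm \<Omega> (\<lambda>x. u x - v x) = 0"
proof -
  interpret finite_measure M by (rule finite_M)
  obtain \<alpha> where \<alpha>: "\<alpha> > 0" "\<And>x Q. x \<in> closure \<Omega> \<Longrightarrow> \<alpha> * (norm Q)\<^sup>2 \<le> (A x *v Q) \<bullet> Q"
    using C0_sym_posdef_elliptic[OF compact_closure A] by blast
  have uV: "u \<in> V" "v \<in> V" using u v by (auto simp: minimizer_def)
  define d where "d x = u x - v x" for x
  have d: "d \<in> V" unfolding d_def[abs_def] by (intro V_diff uV)
  have d': "d = (\<lambda>x. 1 * u x + (-1) * v x)" by (simp add: d_def fun_eq_iff)
  let ?P = "\<lambda>w. LINT x|M. indicator K x * (psi t (w x - f x) * d x)"
  let ?h = "\<lambda>x. indicator K x * ((psi t (u x - f x) - psi t (v x - f x)) * d x)"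
  have ih: "integrable M ?h"
    using Bochner_Integration.integrable_diff[OF test_integrable[OF uV(1) d] test_integrable[OF uV(2) d]] by (simp add: algebra_simps)
  have h0: "0 \<le> ?h x" for x
    using psi_monotone(1)[OF t, of "u x - f x" "v x - f x"] by (simp add: d_def indicator_def)
  have cs: "form A (G d) (G d) = form A (G u) (G d) - form A (G v) (G d)"
    using form_G_lincomb[OF A uV d, of 1 "-1"] unfolding d'[symmetric] by simp
  have hs: "(LINT x|M. ?h x) = ?P u - ?P v"
  proof -
    have "?h x = indicator K x * (psi t (u x - f x) * d x) - indicator K x * (psi t (v x - f x) * d x)" for x
      by (simp add: algebra_simps)
    then show ?thesis
      using Bochner_Integration.integral_diff[OF test_integrable[OF uV(1) d] test_integrable[OF uV(2) d]] by simp
  qed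
  have sum: "form A (G d) (G d) + lam * (LINT x|M. ?h x) = 0"
    unfolding cs hs right_diff_distrib using euler_lagrange[OF A u d] euler_lagrange[OF A v d] by linarith
  have hi: "0 \<le> (LINT x|M. ?h x)" using h0 by (rule Bochner_Integration.integral_nonneg)
  with sum form_nonneg[OF A, of "G d"] lam have z: "form A (G d) (G d) = 0" "(LINT x|M. ?h x) = 0"
    by (smt (verit) mult_nonneg_nonneg mult_pos_pos)+
  have g0: "(LINT x|M. (norm (G d x))\<^sup>2) = 0"
  proof -
    have "\<alpha> * (LINT x|M. (norm (G d x))\<^sup>2) \<le> 0" using form_elliptic[OF A \<alpha>(2) V_D(4)[OF d]] z(1) by simp
    moreover have "0 \<le> (LINT x|M. (norm (G d x))\<^sup>2)" by simp
    ultimately show ?thesis using \<alpha>(1) by (simp add: mult_le_0_iff)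
  qed
  then have "(LINT x|M. (d x - mean d)\<^sup>2) \<le> 0" using poincare_const(2)[OF d] by simp
  then have "(LINT x|M. (d x - mean d)\<^sup>2) = 0" by (simp add: antisym)
  then have c: "AE x in M. d x = mean d"
    using integral_nonneg_eq_0_iff_AE[OF centred_square_integrable[OF d, of "mean d"]] by simp
  have "AE x in M. ?h x = 0" using integral_nonneg_eq_0_iff_AE[OF ih] h0 z(2) by simp
  then have "AE x in M. x \<in> K \<longrightarrow> d x = 0"
  proof eventually_elim
    case (elim x)
    then show ?case using psi_monotone(2)[OF t, of "u x - f x" "v x - f x"] by (auto simp: d_def)
  qed
  with c have k: "AE x in M. x \<in> K \<longrightarrow> mean d = 0" by eventually_elim auto
  have "mean d = 0"
  proof (rule ccontr)
    assume "mean d \<noteq> 0"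
    then have "AE x in M. x \<notin> K" by (intro eventually_mono[OF k]) auto
    have eqK: "{x \<in> space M. \<not> x \<notin> K} = K" using K(2) by (auto simp: space_restrict_space)
    have "emeasure M K = 0" by (rule AE_iff_measurable[OF K_sets_M eqK, THEN iffD1]) fact
    then show False using measure_K_pos by (simp add: emeasure_eq_measure)
  qed
  with square_integral_bound[OF d] g0 have "(LINT x|M. (d x)\<^sup>2) \<le> 0" by simp
  moreover have "0 \<le> (LINT x|M. (d x)\<^sup>2)" by simp
  ultimately have "(W12_norm \<Omega> d)\<^sup>2 = 0" unfolding W12_norm_squared g0 by simp
  then show ?thesis by (simp add: d_def[abs_def])
qed

section \<open>Continuous dependence of the minimiser on the coefficients\<close>

lemma W12_norm_add_squared:
  assumes a: "a \<in> V" and b: "b \<in> V"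
  shows "(W12_norm \<Omega> (\<lambda>x. a x + b x))\<^sup>2 \<le> 2 * (W12_norm \<Omega> a)\<^sup>2 + 2 * (W12_norm \<Omega> b)\<^sup>2"
proof -
  have ab: "(\<lambda>x. a x + b x) \<in> V" using V_lincomb[OF a b, of 1 1] by simp
  \<comment> \<open>Squares with a factor 2 stand in for the triangle inequality of the seminorm;
    the factor is harmless where the bound is used.\<close>
  have ineq: "(norm (y + z))\<^sup>2 \<le> 2 * (norm y)\<^sup>2 + 2 * (norm z)\<^sup>2" for y z :: "'b::real_normed_vector"
  proof -
    have "(norm (y + z))\<^sup>2 \<le> (norm y + norm z)\<^sup>2" by (intro power_mono norm_triangle_ineq) simp
    also have "\<dots> \<le> 2 * (norm y)\<^sup>2 + 2 * (norm z)\<^sup>2"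
      using sum_squares_bound[of "norm y" "norm z"] by (simp add: power2_sum)
    finally show ?thesis .
  qed
  have "(LINT x|M. (a x + b x)\<^sup>2) \<le> (LINT x|M. 2 * (a x)\<^sup>2 + 2 * (b x)\<^sup>2)"
    using V_D(3)[OF ab] V_D(3)[OF a] V_D(3)[OF b] ineq[of "a x" "b x" for x]
    by (intro integral_mono) auto
  moreover have "(LINT x|M. (norm (G (\<lambda>x. a x + b x) x))\<^sup>2) \<le> (LINT x|M. 2 * (norm (G a x))\<^sup>2 + 2 * (norm (G b x))\<^sup>2)"
  proof (rule integral_mono_AE)
    show "AE x in M. (norm (G (\<lambda>x. a x + b x) x))\<^sup>2 \<le> 2 * (norm (G a x))\<^sup>2 + 2 * (norm (G b x))\<^sup>2"
      using G_lincomb[OF a b, of 1 1] by eventually_elim (simp add: ineq)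
  qed (use V_D(6)[OF ab] V_D(6)[OF a] V_D(6)[OF b] in simp_all)
  ultimately show ?thesis
    unfolding W12_norm_squared using V_D(3,6)[OF a] V_D(3,6)[OF b] by simp
qed

text \<open>Every subsequence contains a further one that converges to some minimiser, and all
  minimisers are at distance zero from \<open>u\<close>; hence the whole sequence converges.\<close>

lemma minimizing_sequence_converges:
  assumes A: "A \<in> Coef" and u: "minimizer A u" and un: "\<And>n. un n \<in> V" and lim: "(\<lambda>n. energy A (un n)) \<longlonglongrightarrow> energy A u"
  shows "(\<lambda>n. W12_norm \<Omega> (\<lambda>x. un n x - u x)) \<longlonglongrightarrow> 0"
proof (rule ccontr)
  assume "\<not> ?thesis"
  then obtain e where e: "e > 0" "\<not> (\<forall>\<^sub>F n in sequentially. dist (W12_norm \<Omega> (\<lambda>x. un n x - u x)) 0 < e)"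
    by (auto simp: tendsto_iff)
  obtain s where s: "strict_mono (s::nat\<Rightarrow>nat)" "\<And>n. \<not> dist (W12_norm \<Omega> (\<lambda>x. un (s n) x - u x)) 0 < e"
    using not_eventually_sequentiallyD[OF e(2)] by blast
  have uV: "u \<in> V" using u by (simp add: minimizer_def)
  have lim': "(\<lambda>n. energy A (un (s n))) \<longlonglongrightarrow> energy A u" using LIMSEQ_subseq_LIMSEQ[OF lim s(1)] by (simp add: o_def)
  have mle: "energy A u \<le> energy A v" if "v \<in> V" for v using u that by (simp add: minimizer_def)
  obtain u' r where u': "u' \<in> V" "energy A u' \<le> energy A u" "(\<lambda>n. W12_norm \<Omega> (\<lambda>x. un (s (r n)) x - u' x)) \<longlonglongrightarrow> 0"
    using minimizing_sequence_compact[of A "\<lambda>n. un (s n)", OF A un mle lim'] by blast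
  have "minimizer A u'" unfolding minimizer_def using u'(1,2) mle order_trans by blast
  from minimizer_unique[OF A this u] have z: "W12_norm \<Omega> (\<lambda>x. u' x - u x) = 0" .
  have "\<forall>\<^sub>F n in sequentially. W12_norm \<Omega> (\<lambda>x. un (s (r n)) x - u' x) < e / 2"
    using u'(3) by (rule order_tendstoD) (use e(1) in simp)
  then obtain n where n: "W12_norm \<Omega> (\<lambda>x. un (s (r n)) x - u' x) < e / 2" by (auto simp: eventually_sequentially)
  have W0: "0 \<le> W12_norm \<Omega> w" for w by (simp add: W12_norm_def)
  have "(W12_norm \<Omega> (\<lambda>x. un (s (r n)) x - u x))\<^sup>2 \<le> 2 * (W12_norm \<Omega> (\<lambda>x. un (s (r n)) x - u' x))\<^sup>2"
    using W12_norm_add_squared[OF V_diff[OF un u'(1)] V_diff[OF u'(1) uV], of "s (r n)"] z by simp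
  also have "\<dots> \<le> 2 * (e / 2)\<^sup>2" using n W0 by (intro mult_left_mono power_mono) auto
  also have "\<dots> < e\<^sup>2" using e(1) by (simp add: power2_eq_square)
  finally have "W12_norm \<Omega> (\<lambda>x. un (s (r n)) x - u x) < e" using e(1) by (rule power2_less_imp_less[OF _ less_imp_le])
  then show False using s(2)[of "r n"] W0 by simp
qed

text \<open>Let J be the energy for \<open>A\<close> of the n-th minimiser. Exchanging
  \<open>A\<close> for \<open>An n\<close> and back changes energies by at most \<epsilon>/2 times
  squared gradient norms, and minimality of \<open>un n\<close> for \<open>An n\<close> gives the
  comparison with \<open>u\<close>. The gradient of \<open>un n\<close> is in turn controlled by J
  through the ellipticity of \<open>A\<close>, so one ellipticity constant serves all
  \<open>n\<close>.\<close>

lemma minimizer_continuous: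
  assumes An: "\<And>n. An n \<in> Coef" and A: "A \<in> Coef" and lim: "uniform_limit (closure \<Omega>) An A sequentially"
    and un: "\<And>n. minimizer (An n) (un n)" and u: "minimizer A u"
  shows "(\<lambda>n. W12_norm \<Omega> (\<lambda>x. un n x - u x)) \<longlonglongrightarrow> 0"
proof (rule minimizing_sequence_converges[OF A u])
  show uV: "un n \<in> V" for n using un by (simp add: minimizer_def)
  have uu: "u \<in> V" using u by (simp add: minimizer_def)
  obtain \<alpha> where \<alpha>: "\<alpha> > 0" "\<And>x Q. x \<in> closure \<Omega> \<Longrightarrow> \<alpha> * (norm Q)\<^sup>2 \<le> (A x *v Q) \<bullet> Q"
    using C0_sym_posdef_elliptic[OF compact_closure A] by blast
  define X where "X = (LINT x|M. (norm (G u x))\<^sup>2)"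
  define m where "m = energy A u"
  \<comment> \<open>\<open>Y\<close> is the factor of \<epsilon> in the final bound: half of
    \<open>X\<close> comes from the gradient of \<open>u\<close>, the other half and 2m/\<alpha>
    from the gradients of the minimisers for \<open>An\<close>.\<close>
  define Y where "Y = X + 2 * m / \<alpha>"
  have m0: "m \<ge> 0" unfolding m_def by (rule energy_nonneg[OF A uu])
  have X0: "X \<ge> 0" unfolding X_def by simp
  have Y0: "Y \<ge> 0" using X0 m0 \<alpha>(1) by (simp add: Y_def)
  have diff: "\<bar>form B g g - form A g g\<bar> \<le> \<epsilon> * (LINT x|M. (norm (g x))\<^sup>2)"
    if B: "B \<in> Coef" and close: "\<And>x. x \<in> closure \<Omega> \<Longrightarrow> norm (B x - A x) \<le> \<epsilon>" and g: "g \<in> Lp 2 \<Omega>" for B \<epsilon> g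
  proof -
    note i = form_integrable[OF B g g] form_integrable[OF A g g]
    have "\<bar>form B g g - form A g g\<bar> = norm (LINT x|M. (B x *v g x) \<bullet> g x - (A x *v g x) \<bullet> g x)"
      unfolding form_def using i by simp
    also have "\<dots> \<le> (LINT x|M. \<epsilon> * (norm (g x))\<^sup>2)"
    proof (rule Bochner_Integration.integral_norm_bound_integral)
      fix x assume "x \<in> space M"
      then have x: "x \<in> closure \<Omega>" using closure_subset[of \<Omega>] by (auto simp: space_restrict_space)
      have "(B x *v g x) \<bullet> g x - (A x *v g x) \<bullet> g x = ((B x - A x) *v g x) \<bullet> g x"
        by (simp add: matrix_vector_mult_diff_rdistrib inner_diff_left)
      also have "\<bar>\<dots>\<bar> \<le> norm (B x - A x) * norm (g x) * norm (g x)" by (rule inner_matrix_vector_le)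
      also have "\<dots> \<le> \<epsilon> * (norm (g x))\<^sup>2"
        using mult_right_mono[OF close[OF x], of "(norm (g x))\<^sup>2"] by (simp add: power2_eq_square mult.assoc)
      finally show "norm ((B x *v g x) \<bullet> g x - (A x *v g x) \<bullet> g x) \<le> \<epsilon> * (norm (g x))\<^sup>2" by simp
    qed (use i g in \<open>simp_all add: Lp_2_iff\<close>)
    finally show ?thesis by simp
  qed
  have key: "energy A (un n) \<le> m + \<epsilon> * Y"
    if \<epsilon>: "0 < \<epsilon>" "\<epsilon> \<le> \<alpha> / 2" and close: "\<And>x. x \<in> closure \<Omega> \<Longrightarrow> norm (An n x - A x) \<le> \<epsilon>" for n \<epsilon>
  proof -
    define N where "N = (LINT x|M. (norm (G (un n) x))\<^sup>2)"
    define J where "J = energy A (un n)"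
    have 1: "J \<le> energy (An n) (un n) + \<epsilon> / 2 * N"
      using diff[OF An close V_D(4)[OF uV[of n]]] unfolding J_def energy_eq[OF A uV] energy_eq[OF An uV] N_def by simp
    have 2: "energy (An n) (un n) \<le> energy (An n) u" using un[of n] uu by (simp add: minimizer_def)
    have 3: "energy (An n) u \<le> m + \<epsilon> / 2 * X"
      using diff[OF An close V_D(4)[OF uu]] unfolding m_def energy_eq[OF A uu] energy_eq[OF An uu] X_def by simp
    have "\<alpha> * N \<le> 2 * J" using energy_gradient_bound[OF A \<alpha>(2) uV[of n]] by (simp add: N_def J_def)
    then have N: "N \<le> 2 * J / \<alpha>" using \<alpha>(1) by (simp add: field_simps)
    have "\<epsilon> / 2 * N \<le> \<epsilon> / 2 * (2 * J / \<alpha>)" using \<epsilon>(1) N by (intro mult_left_mono) auto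
    also have "\<epsilon> / 2 * (2 * J / \<alpha>) = \<epsilon> / \<alpha> * J" by simp
    finally have 4: "J \<le> m + \<epsilon> / 2 * X + \<epsilon> / \<alpha> * J" using 1 2 3 by linarith
    have J0: "J \<ge> 0" unfolding J_def by (rule energy_nonneg[OF A uV])
    \<comment> \<open>A crude bound comes first: since \<epsilon> \<le> \<alpha>/2, half of J is
      absorbed on the left. Inserting it into the error term \<epsilon>/\<alpha> times J makes the
      excess linear in \<epsilon>.\<close>
    have "\<epsilon> / \<alpha> * J \<le> 1 / 2 * J" using \<epsilon> \<alpha>(1) J0 by (intro mult_right_mono) (simp_all add: field_simps)
    moreover have "\<epsilon> / 2 * X = \<epsilon> * X / 2" by simp
    ultimately have "J \<le> 2 * m + \<epsilon> * X" using 4 by linarith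
    also have "\<dots> \<le> 2 * m + \<alpha> / 2 * X" using \<epsilon>(2) X0 by (intro add_left_mono mult_right_mono)
    finally have "\<epsilon> / \<alpha> * J \<le> \<epsilon> / \<alpha> * (2 * m + \<alpha> / 2 * X)" using \<epsilon>(1) \<alpha>(1) by (intro mult_left_mono) auto
    also have "\<dots> = \<epsilon> * (2 * m / \<alpha>) + \<epsilon> / 2 * X" using \<alpha>(1) by (simp add: field_simps)
    finally show ?thesis using 4 unfolding J_def Y_def by (simp add: algebra_simps)
  qed
  show "(\<lambda>n. energy A (un n)) \<longlonglongrightarrow> energy A u"
  proof (rule LIMSEQ_I)
    fix e :: real assume e: "e > 0"
    \<comment> \<open>The first entry allows the absorption in \<open>key\<close>, the second makes
      \<epsilon>Y smaller than e, with 1 added in case \<open>Y\<close> vanishes.\<close>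
    define \<epsilon> where "\<epsilon> = min (\<alpha> / 2) (e / (2 * (Y + 1)))"
    have \<epsilon>: "0 < \<epsilon>" "\<epsilon> \<le> \<alpha> / 2" "\<epsilon> \<le> e / (2 * (Y + 1))" using e \<alpha>(1) Y0 unfolding \<epsilon>_def by (simp, intro min.cobounded1, intro min.cobounded2)
    have "\<epsilon> * Y \<le> e / (2 * (Y + 1)) * Y" using \<epsilon>(3) Y0 by (rule mult_right_mono)
    also have "\<dots> < e" using e Y0 by (simp add: divide_simps)
    finally have Ye: "\<epsilon> * Y < e" .
    from uniform_limitD[OF lim \<epsilon>(1)] obtain N where N: "\<And>n x. n \<ge> N \<Longrightarrow> x \<in> closure \<Omega> \<Longrightarrow> norm (An n x - A x) < \<epsilon>"
      by (auto simp: eventually_sequentially dist_norm)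
    have "norm (energy A (un n) - energy A u) < e" if "n \<ge> N" for n
    proof -
      have "energy A (un n) \<le> m + \<epsilon> * Y" using N[OF that] by (intro key \<epsilon>) (auto intro: less_imp_le)
      moreover have "m \<le> energy A (un n)" using u uV by (simp add: m_def minimizer_def)
      ultimately show ?thesis using Ye by (simp add: m_def)
    qed
    then show "\<exists>no. \<forall>n\<ge>no. norm (energy A (un n) - energy A u) < e" by blast
  qed
qed

lemma minimizer_data_bound:
  assumes A: "A \<in> Coef" and u: "minimizer A u"
  shows "(LINT x|M. indicator K x * \<bar>u x - f x\<bar> powr t) \<le> (LINT x|M. indicator K x * \<bar>f x\<bar> powr t)"
proof -
  have uV: "u \<in> V" using u by (simp add: minimizer_def)
  have z: "form A (G (\<lambda>x. 0)) (G (\<lambda>x. 0)) = 0"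
  proof -
    have "form A (G (\<lambda>x. 0)) (G (\<lambda>x. 0)) = form A (\<lambda>x. 0) (\<lambda>x. 0)"
      by (intro form_cong_AE A V_D(5) V_zero) auto
    then show ?thesis by (simp add: form_def)
  qed
  have "energy A u \<le> energy A (\<lambda>x. 0)" using u V_zero(1) by (simp add: minimizer_def)
  then have "lam * (LINT x|M. indicator K x * \<bar>u x - f x\<bar> powr t) \<le> lam * (LINT x|M. indicator K x * \<bar>f x\<bar> powr t)"
    unfolding energy_eq[OF A uV] energy_eq[OF A V_zero(1)] z using form_nonneg[OF A, of "G u"] by simp
  then show ?thesis using lam by simp
qed

end

section \<open>The fixed point of the coefficient map\<close>

text \<open>The data term of the equation is an integral over \<open>K\<close>, that of the energy
  an integral over \<Omega> with an indicator; this passes between the two.\<close>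

lemma integrable_lebesgue_on_subset_iff:
  fixes h :: "'a::euclidean_space \<Rightarrow> real"
  assumes "K \<in> sets lebesgue" "S \<in> sets lebesgue" "K \<subseteq> S"
  shows "integrable (lebesgue_on K) h \<longleftrightarrow> integrable (lebesgue_on S) (\<lambda>x. indicator K x * h x)"
    and "(LINT x|lebesgue_on K. h x) = (LINT x|lebesgue_on S. indicator K x * h x)"
proof -
  have eq: "indicator S x *\<^sub>R (indicator K x * h x) = indicator K x *\<^sub>R h x" for x
    using assms(3) by (auto simp: indicator_def)
  show "integrable (lebesgue_on K) h \<longleftrightarrow> integrable (lebesgue_on S) (\<lambda>x. indicator K x * h x)"
    using assms by (simp only: integrable_restrict_space Int_UNIV_right space_completion space_lborel eq space_borel)
  show "(LINT x|lebesgue_on K. h x) = (LINT x|lebesgue_on S. indicator K x * h x)"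
    using assms by (simp only: integral_restrict_space Int_UNIV_right space_completion space_lborel eq space_borel)
qed

lemma borel_measurable_indicator_mult_lebesgue_on:
  fixes h :: "'a::euclidean_space \<Rightarrow> real"
  assumes K: "K \<in> sets lebesgue" and h: "h \<in> borel_measurable (lebesgue_on K)"
  shows "(\<lambda>x. indicator K x * h x) \<in> borel_measurable (lebesgue_on S)"
proof -
  have "(\<lambda>x. indicator K x *\<^sub>R h x) \<in> borel_measurable lebesgue"
    using h K by (subst (asm) borel_measurable_restrict_space_iff) auto
  then show ?thesis by (auto intro: measurable_restrict_space1)
qed

text \<open>Weights may vanish, but since they sum to one at least one is positive, which keeps the
  combination strictly positive definite.\<close>

lemma sum_in_sym_posdef:
  fixes F :: "nat \<Rightarrow> real^2^2"
  assumes F: "\<And>i. i \<le> n \<Longrightarrow> F i \<in> sym_posdef" and c: "\<And>i. i \<le> n \<Longrightarrow> 0 \<le> c i" "(\<Sum>i\<le>n. c i) = (1::real)"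
  shows "(\<Sum>i\<le>n. c i *\<^sub>R F i) \<in> sym_posdef"
proof -
  have tr: "F i $ k $ j = F i $ j $ k" if "i \<le> n" for i j k
  proof -
    have "transpose (F i) $ j $ k = F i $ j $ k" using F[OF that] by (simp add: sym_posdef_def)
    then show ?thesis by (simp add: transpose_def)
  qed
  have "transpose (\<Sum>i\<le>n. c i *\<^sub>R F i) = (\<Sum>i\<le>n. c i *\<^sub>R F i)"
    by (simp add: vec_eq_iff transpose_def tr)
  moreover have "((\<Sum>i\<le>n. c i *\<^sub>R F i) *v Q) \<bullet> Q > 0" if Q: "Q \<noteq> 0" for Q
  proof -
    have "((\<Sum>i\<le>n. c i *\<^sub>R F i) *v Q) = (\<Sum>i\<le>n. c i *\<^sub>R (F i *v Q))"
      by (induction n) (simp_all add: matrix_vector_mult_add_rdistrib scaleR_matrix_vector_assoc)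
    then have eq: "((\<Sum>i\<le>n. c i *\<^sub>R F i) *v Q) \<bullet> Q = (\<Sum>i\<le>n. c i * ((F i *v Q) \<bullet> Q))"
      by (simp add: inner_sum_left)
    have pos: "(F i *v Q) \<bullet> Q > 0" if "i \<le> n" for i using F[OF that] Q by (simp add: sym_posdef_def)
    have "\<exists>i\<le>n. c i \<noteq> 0"
    proof (rule ccontr)
      assume "\<not> ?thesis"
      then have "(\<Sum>i\<le>n. c i) = 0" by simp
      with c(2) show False by simp
    qed
    then obtain i where i: "i \<le> n" "c i \<noteq> 0" by blast
    then have "c i > 0" using c(1)[OF i(1)] by simp
    then have "0 < c i * ((F i *v Q) \<bullet> Q)" using pos[OF i(1)] by simp
    then have "0 < (\<Sum>i\<le>n. c i * ((F i *v Q) \<bullet> Q))"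
      using i(1) by (intro sum_pos2[of _ i]) (auto intro: mult_nonneg_nonneg[OF c(1) less_imp_le[OF pos]])
    then show ?thesis unfolding eq .
  qed
  ultimately show ?thesis by (simp add: sym_posdef_def)
qed

lemma convex_combination_C0_sym_posdef:
  fixes A :: "nat \<Rightarrow> real^2 \<Rightarrow> real^2^2"
  assumes A: "\<And>i. i \<le> n \<Longrightarrow> A i \<in> C0_sym_posdef S" and c: "\<And>i. i \<le> n \<Longrightarrow> 0 \<le> c i" "(\<Sum>i\<le>n. c i) = (1::real)"
  shows "(\<lambda>x. \<Sum>i\<le>n. c i *\<^sub>R A i x) \<in> C0_sym_posdef S"
  unfolding C0_sym_posdef_def
proof (intro CollectI conjI image_subsetI)
  show "continuous_on S (\<lambda>x. \<Sum>i\<le>n. c i *\<^sub>R A i x)"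
    using A by (intro continuous_intros) (auto simp: C0_sym_posdef_def)
  show "(\<Sum>i\<le>n. c i *\<^sub>R A i x) \<in> sym_posdef" if "x \<in> S" for x
    using A c that by (intro sum_in_sym_posdef) (auto simp: C0_sym_posdef_def)
qed

text \<open>The radius does not depend on \<open>A\<close>, because the zero function has the same
  energy for every coefficient field.\<close>

lemma (in energy_problem) minimizer_in_data_ball:
  "\<exists>R>0. \<forall>A\<in>Coef. \<forall>u. minimizer A u \<longrightarrow> u \<in> data_ball \<Omega> K t R"
proof -
  define P where "P = (LINT x|M. indicator K x * \<bar>f x\<bar> powr t)"
  \<comment> \<open>From |u|^t \<le> 2^t (|u - f|^t + |f|^t), where both integrals over
    \<open>K\<close> are at most \<open>P\<close>; the added 1 keeps \<open>R\<close> positive when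
    \<open>P = 0\<close>.\<close>
  define R where "R = (2 powr t * (P + P)) powr (1 / t) + 1"
  have "R > 0" by (simp add: R_def add_nonneg_pos)
  moreover have "u \<in> data_ball \<Omega> K t R" if A: "A \<in> Coef" and u: "minimizer A u" for A u
  proof -
    have uV: "u \<in> V" using u by (simp add: minimizer_def)
    note sub = integrable_lebesgue_on_subset_iff[OF K(1) dom_sets K(2)]
    have i1: "integrable M (\<lambda>x. indicator K x * \<bar>u x\<bar> powr t)" by (intro integrable_indicator_K V_D(8) uV)
    have i2: "integrable M (\<lambda>x. indicator K x * \<bar>f x\<bar> powr t)" by (intro integrable_indicator_K f_integrable)
    have "u \<in> borel_measurable (lebesgue_on K)"
      using V_D(1)[OF uV] K(2) by (metis measurable_restrict_mono)
    then have Lp: "u \<in> Lp t K" using i1 by (simp add: Lp_def sub(1))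
    have "(LINT x|M. indicator K x * \<bar>u x\<bar> powr t)
        \<le> (LINT x|M. 2 powr t * (indicator K x * \<bar>u x - f x\<bar> powr t + indicator K x * \<bar>f x\<bar> powr t))"
    proof (rule integral_mono[OF i1])
      show "integrable M (\<lambda>x. 2 powr t * (indicator K x * \<bar>u x - f x\<bar> powr t + indicator K x * \<bar>f x\<bar> powr t))"
        using data_integrable[OF uV] i2 by simp
      show "indicator K x * \<bar>u x\<bar> powr t \<le> 2 powr t * (indicator K x * \<bar>u x - f x\<bar> powr t + indicator K x * \<bar>f x\<bar> powr t)" for x
        using powr_abs_add_le[of t "u x - f x" "f x"] t by (simp add: indicator_def)
    qed
    also have "\<dots> = 2 powr t * ((LINT x|M. indicator K x * \<bar>u x - f x\<bar> powr t) + P)"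
      using data_integrable[OF uV] i2 by (simp add: P_def)
    also have "\<dots> \<le> 2 powr t * (P + P)"
      using minimizer_data_bound[OF A u] by (intro mult_left_mono add_right_mono) (simp_all add: P_def)
    finally have "Lp_norm t K u \<le> (2 powr t * (P + P)) powr (1 / t)"
      unfolding Lp_norm_def sub(2) using t by (intro powr_mono2) (auto intro!: Bochner_Integration.integral_nonneg)
    then have "Lp_norm t K u \<le> R" by (simp add: R_def)
    with Lp uV show ?thesis by (simp add: data_ball_def)
  qed
  ultimately show ?thesis by blast
qed

theorem theorem1p1:
  fixes \<Omega> K :: "(real^2) set"
    and t lam :: real
    and f :: "real^2 \<Rightarrow> real"
    and \<D> :: "(real^2 \<Rightarrow> real) \<Rightarrow> real^2 \<Rightarrow> real^2^2"
  assumes "lipschitz_domain \<Omega>" and "bounded \<Omega>"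
    and "K \<in> sets lebesgue" and "K \<subseteq> \<Omega>" and "emeasure lebesgue K > 0"
    and "t > 1" and "f \<in> Lp t K" and "lam > 0"
    and "\<D> \<in> W12 \<Omega> \<rightarrow> C0_sym_posdef (closure \<Omega>)"
    and "continuous_W12_C0 \<Omega> \<D>"
    and "\<And>R. R > 0 \<Longrightarrow> precompact_C0 (closure \<Omega>) (\<D> ` data_ball \<Omega> K t R)"
  shows "\<exists>u\<in>W12 \<Omega>. weak_solution \<Omega> K t lam f (\<D> u) u"
proof -
  have \<Omega>: "\<Omega> \<in> sets lebesgue" using assms(1) by (auto simp: lipschitz_domain_def)
  \<comment> \<open>The datum is only known on \<open>K\<close>; its extension by zero has an
    integrable t-th power on \<Omega> and gives the same data term, because that term carries the
    indicator of \<open>K\<close>.\<close>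
  define fK where "fK x = indicator K x * f x" for x
  note sub = integrable_lebesgue_on_subset_iff[OF assms(3) \<Omega> assms(4)]
  have ind: "\<bar>fK x\<bar> powr t = indicator K x * \<bar>f x\<bar> powr t" for x
    by (simp add: fK_def indicator_def)
  interpret energy_problem \<Omega> K t lam fK
  proof
    show "fK \<in> borel_measurable (lebesgue_on \<Omega>)"
      using borel_measurable_indicator_mult_lebesgue_on[OF assms(3)] assms(7) by (simp add: fK_def[abs_def] Lp_def)
    show "integrable (lebesgue_on \<Omega>) (\<lambda>x. \<bar>fK x\<bar> powr t)"
      using assms(7) unfolding ind sub(1)[symmetric] by (simp add: Lp_def)
  qed (use assms in auto)
  obtain R where R: "R > 0" "\<And>A u. A \<in> Coef \<Longrightarrow> minimizer A u \<Longrightarrow> u \<in> data_ball \<Omega> K t R"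
    using minimizer_in_data_ball by blast
  \<comment> \<open>A chosen minimiser. Different choices are at \<open>W12_norm\<close> distance
    zero, so the continuity of \<open>\<D>\<close> makes \<open>\<D> (U A)\<close> on the closure of
    \<Omega> independent of the choice.\<close>
  define U where "U A = (SOME u. minimizer A u)" for A
  have U: "minimizer A (U A)" if "A \<in> Coef" for A
    unfolding U_def using minimizer_exists[OF that] by (rule someI_ex)
  have UV: "U A \<in> V" if "A \<in> Coef" for A using U[OF that] by (simp add: minimizer_def)
  have DC: "\<D> u \<in> Coef" if "u \<in> V" for u using assms(9) that by blast
  have "\<exists>A\<in>Coef. \<forall>x\<in>closure \<Omega>. \<D> (U A) x = A x"
  proof (rule uniform_fixed_point[where P = "\<D> ` data_ball \<Omega> K t R"])
    show "closure \<Omega> \<noteq> {}" by (rule compact_closure)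
    show "(\<lambda>x. \<Sum>i\<le>n. c i *\<^sub>R A i x) \<in> Coef"
      if "\<And>i. i \<le> n \<Longrightarrow> A i \<in> Coef" "\<And>i. i \<le> n \<Longrightarrow> 0 \<le> c i" "(\<Sum>i\<le>n. c i) = 1" for n :: nat and c A
      using that by (rule convex_combination_C0_sym_posdef)
    show "bounded (A ` closure \<Omega>)" if "A \<in> Coef" for A
      using that compact_closure(1) by (auto simp: C0_sym_posdef_def intro!: compact_imp_bounded compact_continuous_image)
    show "\<D> ` data_ball \<Omega> K t R \<subseteq> Coef" using DC by (auto simp: data_ball_def)
    have "(\<lambda>x. 0) \<in> data_ball \<Omega> K t R"
      using V_zero(1) R(1) assms(6) by (simp add: data_ball_def Lp_def Lp_norm_def)
    then show "\<D> ` data_ball \<Omega> K t R \<noteq> {}" by blast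
    show "\<D> (U A) \<in> \<D> ` data_ball \<Omega> K t R" if "A \<in> Coef" for A
      using R(2)[OF that U[OF that]] by blast
    show "\<exists>l\<in>Coef. \<exists>r. strict_mono (r::nat\<Rightarrow>nat) \<and> uniform_limit (closure \<Omega>) (\<lambda>n. s (r n)) l sequentially"
      if "\<And>n. s n \<in> \<D> ` data_ball \<Omega> K t R" for s :: "nat \<Rightarrow> real^2 \<Rightarrow> real^2^2"
      using assms(11)[OF R(1)] that unfolding precompact_C0_def by blast
    show "uniform_limit (closure \<Omega>) (\<lambda>n. \<D> (U (s n))) (\<D> (U l)) sequentially"
      if s: "\<And>n. s n \<in> Coef" and l: "l \<in> Coef" and lim: "uniform_limit (closure \<Omega>) s l sequentially" for s l
    proof (rule uniform_limitI)
      fix e :: real assume "e > 0"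
      then obtain d where d: "d > 0" "\<And>v. v \<in> V \<Longrightarrow> W12_norm \<Omega> (\<lambda>x. v x - U l x) < d \<Longrightarrow> \<forall>x\<in>closure \<Omega>. norm (\<D> v x - \<D> (U l) x) < e"
        using assms(10) UV[OF l] unfolding continuous_W12_C0_def by meson
      have "(\<lambda>n. W12_norm \<Omega> (\<lambda>x. U (s n) x - U l x)) \<longlonglongrightarrow> 0"
        by (rule minimizer_continuous[OF s l lim U[OF s] U[OF l]])
      then have "\<forall>\<^sub>F n in sequentially. W12_norm \<Omega> (\<lambda>x. U (s n) x - U l x) < d" using d(1) by (rule order_tendstoD)
      then show "\<forall>\<^sub>F n in sequentially. \<forall>x\<in>closure \<Omega>. dist (\<D> (U (s n)) x) (\<D> (U l) x) < e"
        by (rule eventually_mono) (use d(2)[OF UV[OF s]] in \<open>simp add: dist_norm\<close>)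
    qed
  qed
  then obtain A where A: "A \<in> Coef" "\<And>x. x \<in> closure \<Omega> \<Longrightarrow> \<D> (U A) x = A x" by blast
  define u where "u = U A"
  have u: "minimizer A u" "u \<in> V" using U[OF A(1)] UV[OF A(1)] by (simp_all add: u_def)
  \<comment> \<open>The fixed point identity holds on the closure of \<Omega>, which contains the
    domain of all the integrals.\<close>
  have Du: "\<D> u x = A x" if "x \<in> space M" for x
    using A(2)[of x] that closure_subset[of \<Omega>] by (auto simp: u_def space_restrict_space)
  have psiK: "indicator K x * (t * \<bar>u x - f x\<bar> powr (t - 2) * (u x - f x) * \<phi> x) = indicator K x * (psi t (u x - fK x) * \<phi> x)" for \<phi> x
    by (simp add: psi_def fK_def indicator_def)
  have "weak_solution \<Omega> K t lam f (\<D> u) u"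
    unfolding weak_solution_def
  proof (intro ballI conjI)
    fix \<phi> assume \<phi>: "\<phi> \<in> V"
    have eq: "integrable M (\<lambda>x. (\<D> u x *v G u x) \<bullet> G \<phi> x) \<longleftrightarrow> integrable M (\<lambda>x. (A x *v G u x) \<bullet> G \<phi> x)"
      "(LINT x|M. (\<D> u x *v G u x) \<bullet> G \<phi> x) = form A (G u) (G \<phi>)"
      unfolding form_def by (intro Bochner_Integration.integrable_cong Bochner_Integration.integral_cong; simp add: Du)+
    show "integrable M (\<lambda>x. (\<D> u x *v G u x) \<bullet> G \<phi> x)"
      unfolding eq by (rule form_integrable[OF A(1) V_D(4)[OF u(2)] V_D(4)[OF \<phi>]])
    show "integrable (lebesgue_on K) (\<lambda>x. t * \<bar>u x - f x\<bar> powr (t - 2) * (u x - f x) * \<phi> x)"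
      unfolding sub(1) psiK by (rule test_integrable[OF u(2) \<phi>])
    show "(LINT x|M. (\<D> u x *v G u x) \<bullet> G \<phi> x) + lam * (LINT x|lebesgue_on K. t * \<bar>u x - f x\<bar> powr (t - 2) * (u x - f x) * \<phi> x) = 0"
      unfolding eq sub(2) psiK by (rule euler_lagrange[OF A(1) u(1) \<phi>])
  qed
  with u(2) show ?thesis by blast
qed

end
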